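(* Assume Hypothesis (A) (stated in the context) holds and let $(Y^0,\mu^0)\in\chi$ be given, with $\mu^0$ of bounded support in $B(0,R)$. Let $(\mu^0_N)_{N\in\mathbb{N}}$ be a sequence of atomic probability measures, equi-compactly supported in $B(0,R)$, such that each $\mu^0_N$ is given by $\mu^0_N=\frac1N\sum_{i=1}^N\delta_{X^0_{i,N}}$ and $\lim_{N\to\infty}\mathcal{W}_1(\mu_N^0,\mu^0)=0$. Fix a convergent sequence $(\mathbf{u}_N)_{N\in\mathbb{N}}\subset L^\infty([0,T],\mathcal{U})$ of control functions, i.e. $\mathbf{u}_N\to\mathbf{u}^*$ in $L^\infty([0,T],\mathcal{U})$, with $\mathcal{U}$ a nonempty compact subset of $\mathbb{R}^{md}$. For each initial datum $\zeta_N^0=(Y^0,X^0_N)$, $X_N^0=(X^0_{1,N},\dots,X^0_{N,N})$, let $\zeta_N(t)=(Y_N(t),X_N(t))$ be the unique solution of the finite-dimensional system $$\begin{cases}\dot Y_k=\mathbf{u}_k,& k=1,\dots,m,\\ \dot X_i=(H*\mu_N)(X_i)+\sum_{\ell=1}^d(G^\ell*\mu_{m\,\ell})(X_i),& i=1,\dots,N,\end{cases}$$ with control $\mathbf{u}=\mathbf{u}_N$, and identify $\zeta_N$ with $(Y_N,\mu_N)$, where $\mu_N(t)=\frac1N\sum_{i=1}^N\delta_{X_{i,N}(t)}$. Then the sequence $(Y_N,\mu_N)$ converges in $C^0([0,T],\chi)$ to some $(Y^*,\mu^* )$ which is a solution, with initial data $(Y^0,\mu^0)$ and control $\mathbf{u}=\mathbf{u}^*$,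 of $$\begin{cases}\dot Y_k=\mathbf{u}_k,& k=1,\dots,m,\\ \partial_t\mu+\nabla\cdot\Big[\big(H*\mu+\sum_{\ell=1}^dG^\ell*\mu_{m\,\ell}\big)\mu\Big]=0 .\end{cases}$$
   Context: $\mathcal{P}_1(\mathbb{R}^d)$: probability measures on $\mathbb{R}^d$ with finite first moment; $\mathcal{W}_1$: 1-Wasserstein distance; $B(0,R)$: ball of radius $R$ about $0$; $\chi:=\mathbb{R}^{dm}\times\mathcal{P}_1(\mathbb{R}^d)$ with the metric $\|(Y,\mu)-(Y',\mu')\|_\chi:=\frac1m\sum_{k=1}^m|Y_k-Y_k'|+\mathcal{W}_1(\mu,\mu')$. Write $\mathbf{u}_k=(u_{k\,1},\dots,u_{k\,d})\in\mathbb{R}^d$ for the $k$-th block of a control $\mathbf{u}$, and $\mu_{m\,\ell}(t)=\frac1m\sum_{k=1}^m u_{k\,\ell}(t)\,\delta_{Y_k(t)}$ (formed with the relevant control and trajectories). Convolution: $(F*\nu)(x)=\int F(x-\xi)\,d\nu(\xi)$. Solutions of the finite-dimensional system are Carathéodory solutions. Solution of the limit system: for a control $\mathbf{u}\in L^\infty([0,T],\mathcal{U})$, a map $(Y,\mu):[0,T]\to\chi$ is a solution if: (i) there is $R'>0$ with $\mathrm{supp}\,\mu(t)\subset B(0,R')$ for all $t\in[0,T]$; (ii) it is continuous in time with respect to the metric of $\chi$; (iii) $Y$ is a Carathéodory solution of $\dot Y_k=\mathbf{u}_k$; (iv) for every $\varphi\in C_c^\infty(\mathbb{R}^d)$, $\frac{d}{dt}\int\varphi\,d\mu(t)=\int\nabla\varphi(x)\cdot\big((H*\mu(t))(x)+\sum_{\ell=1}^d(G^\ell*\mu_{m\,\ell}(t))(x)\big)\,d\mu(t)(x)$.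 Hypothesis (A): Let $H:\mathbb{R}^d\to\mathbb{R}^d$ and $G^\ell:\mathbb{R}^d\to\mathbb{R}^d$, $\ell=1,\dots,d$, be locally Lipschitz functions with sub-linear growth, i.e. $|H(\xi)|\le C_H(1+|\xi|)$, $|G^\ell(\xi)|\le C_G^\ell(1+|\xi|)$. Let $\mu,\nu:[0,T]\to\mathcal{P}_1(\mathbb{R}^d)$ be continuous with respect to $\mathcal{W}_1$, both satisfying $\mathrm{supp}\,\mu(t)\subset B(0,R)$, $\mathrm{supp}\,\nu(t)\subset B(0,R)$. Let $\mathbf{u}\in L^\infty$ be fixed and let $\mu_{m\,\ell}=\frac1m\sum_{k=1}^m u_{k\,\ell}\,\delta_{Y_k}$ and $\mu'_{m\,\ell}=\frac1m\sum_{k=1}^m u'_{k\,\ell}\,\delta_{Y'_k}$ be time-dependent measures supported on the respective absolutely continuous trajectories $t\mapsto Y_k(t)$ and $t\mapsto Y'_k(t)$ (with weights $u_{k\,\ell}$ and $u'_{k\,\ell}$ respectively). Assume that for every $\rho>0$ there exist constants $L_{\rho,R,H}$ and $L_{\rho,R,M,G^\ell}$ such that $$\|H*\mu(t)-H*\nu(t)\|_{L^\infty(B(0,\rho))}\le L_{\rho,R,H}\,\mathcal{W}_1(\mu(t),\nu(t)),$$ $$\|G^\ell*\mu_{m\,\ell}(t)-G^\ell*\mu'_{m\,\ell}(t)\|_{L^\infty(B(0,\rho))}\le L_{\rho,R,M,G^\ell}\,\frac1m\sum_{k=1}^m|Y_k(t)-Y'_k(t)|,$$ where $M$ is the maximum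 of the absolute values of $u_k$ and $u'_k$. *)

theory Defs
  imports "HOL-Probability.Probability"
begin

section \<open>Functions of a real variable and function spaces\<close>

definition abs_cont_on :: "real \<Rightarrow> real \<Rightarrow> (real \<Rightarrow> 'a::metric_space) \<Rightarrow> bool" where
  "abs_cont_on a b f \<longleftrightarrow>
     (\<forall>\<epsilon>>0. \<exists>\<delta>>0. \<forall>(n::nat) l r.
        (\<forall>i<n. a \<le> l i \<and> l i \<le> r i \<and> r i \<le> b) \<and>
        (\<forall>i<n. \<forall>j<n. i \<noteq> j \<longrightarrow> {l i<..<r i} \<inter> {l j<..<r j} = {}) \<and>
        (\<Sum>i<n. r i - l i) < \<delta> \<longrightarrow>
        (\<Sum>i<n. dist (f (l i)) (f (r i))) < \<epsilon>)"

text \<open>\<open>caratheodory T f g\<close>: \<open>f\<close> solves \<open>f' = g\<close> on \<open>[0,T]\<close> in the sense of Caratheodory.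
  For an equation \<open>f'(t) = F(t, f(t))\<close> one takes \<open>g t = F (t, f t)\<close>.\<close>

definition caratheodory :: "real \<Rightarrow> (real \<Rightarrow> 'a::real_normed_vector) \<Rightarrow> (real \<Rightarrow> 'a) \<Rightarrow> bool" where
  "caratheodory T f g \<longleftrightarrow> abs_cont_on 0 T f \<and>
     (AE t in lebesgue_on {0..T}. (f has_vector_derivative g t) (at t within {0..T}))"

definition Linf_norm :: "'a measure \<Rightarrow> ('a \<Rightarrow> 'b::real_normed_vector) \<Rightarrow> ereal" where
  "Linf_norm M f = esssup M (\<lambda>x. ereal (norm (f x)))"

text \<open>The space \<open>L\<^sup>\<infinity>([0,T], U)\<close>; its elements are represented by functions defined on all
  of \<open>\<real>\<close>, and every later use depends only on the class up to null sets in \<open>[0,T]\<close>.\<close>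

definition Linf :: "real \<Rightarrow> 'a::euclidean_space set \<Rightarrow> (real \<Rightarrow> 'a) set" where
  "Linf T U = {u \<in> borel_measurable (lebesgue_on {0..T}).
     Linf_norm (lebesgue_on {0..T}) u < \<infinity> \<and> (AE t in lebesgue_on {0..T}. u t \<in> U)}"

definition locally_lipschitz :: "('a::metric_space \<Rightarrow> 'b::metric_space) \<Rightarrow> bool" where
  "locally_lipschitz F \<longleftrightarrow> (\<forall>x. \<exists>r>0. \<exists>L. L-lipschitz_on (cball x r) F)"

definition sublinear_growth :: "('a::real_normed_vector \<Rightarrow> 'b::real_normed_vector) \<Rightarrow> bool" where
  "sublinear_growth F \<longleftrightarrow> (\<exists>C. \<forall>\<xi>. norm (F \<xi>) \<le> C * (1 + norm \<xi>))"

text \<open>Functions of class \<open>C\<^sup>k\<close>: continuous for \<open>k = 0\<close>; otherwise differentiable with all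
  directional derivatives of class \<open>C\<^sup>k\<^sup>-\<^sup>1\<close>.\<close>

fun Ck_function :: "nat \<Rightarrow> ('a::euclidean_space \<Rightarrow> real) \<Rightarrow> bool" where
  "Ck_function 0 f \<longleftrightarrow> continuous_on UNIV f"
| "Ck_function (Suc k) f \<longleftrightarrow> (\<forall>x. f differentiable (at x)) \<and>
     (\<forall>v. Ck_function k (\<lambda>x. frechet_derivative f (at x) v))"

definition test_function :: "('a::euclidean_space \<Rightarrow> real) \<Rightarrow> bool" where
  "test_function \<phi> \<longleftrightarrow> (\<forall>k. Ck_function k \<phi>) \<and> compact (closure {x. \<phi> x \<noteq> 0})"

definition grad :: "(real^'d \<Rightarrow> real) \<Rightarrow> real^'d \<Rightarrow> real^'d" where
  "grad \<phi> x = (\<chi> i. frechet_derivative \<phi> (at x) (axis i 1))"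


section \<open>Probability measures and the Wasserstein distance\<close>

definition P1 :: "'a::euclidean_space measure set" where
  "P1 = {\<mu>. prob_space \<mu> \<and> sets \<mu> = sets borel \<and> integrable \<mu> norm}"

definition supp :: "'a::topological_space measure \<Rightarrow> 'a set" where
  "supp \<mu> = {x. \<forall>S. open S \<and> x \<in> S \<longrightarrow> emeasure \<mu> S > 0}"

definition couplings :: "'a::euclidean_space measure \<Rightarrow> 'a measure \<Rightarrow> ('a \<times> 'a) measure set" where
  "couplings \<mu> \<nu> = {\<pi>. sets \<pi> = sets (borel \<Otimes>\<^sub>M borel) \<and>
     distr \<pi> borel fst = \<mu> \<and> distr \<pi> borel snd = \<nu>}"

text \<open>Only meaningful for arguments in \<open>P1\<close>, where the set of couplings is nonempty and all the
  integrals are finite.\<close>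

definition W1 :: "'a::euclidean_space measure \<Rightarrow> 'a measure \<Rightarrow> real" where
  "W1 \<mu> \<nu> = (INF \<pi>\<in>couplings \<mu> \<nu>. \<integral>p. dist (fst p) (snd p) \<partial>\<pi>)"

definition W1_continuous :: "real \<Rightarrow> (real \<Rightarrow> 'a::euclidean_space measure) \<Rightarrow> bool" where
  "W1_continuous T \<mu> \<longleftrightarrow> (\<forall>t\<in>{0..T}. \<mu> t \<in> P1) \<and>
     (\<forall>t\<in>{0..T}. ((\<lambda>s. W1 (\<mu> s) (\<mu> t)) \<longlongrightarrow> 0) (at t within {0..T}))"

text \<open>\<open>1/N \<Sum>\<^sub>i \<delta>\<^sub>x\<^sub>i\<close>, for \<open>N \<ge> 1\<close>, as the image of the uniform distribution on the indices.\<close>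

definition empirical :: "nat \<Rightarrow> (nat \<Rightarrow> 'a::topological_space) \<Rightarrow> 'a measure" where
  "empirical N x = distr (uniform_count_measure {1..N}) borel x"

definition conv :: "('a::euclidean_space \<Rightarrow> 'b::euclidean_space) \<Rightarrow> 'a measure \<Rightarrow> 'a \<Rightarrow> 'b" where
  "conv F \<nu> x = (\<integral>\<xi>. F (x - \<xi>) \<partial>\<nu>)"

text \<open>\<open>conv_atoms F w y\<close> is the convolution of \<open>F\<close> with the signed measure
  \<open>1/m \<Sum>\<^sub>k w\<^sub>k \<delta>\<^sub>y\<^sub>k\<close>, where \<open>m = CARD('m)\<close>.\<close>

definition conv_atoms :: "(real^'d \<Rightarrow> real^'d) \<Rightarrow> ('m::finite \<Rightarrow> real) \<Rightarrow> ('m \<Rightarrow> real^'d) \<Rightarrow>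
    real^'d \<Rightarrow> real^'d" where
  "conv_atoms F w y x = (1 / real CARD('m)) *\<^sub>R (\<Sum>k\<in>UNIV. w k *\<^sub>R F (x - y k))"


section \<open>The space \<open>\<chi>\<close>\<close>

definition mean_dist :: "real^'d^'m \<Rightarrow> real^'d^'m \<Rightarrow> real" where
  "mean_dist y y' = (1 / real CARD('m)) * (\<Sum>k\<in>UNIV. norm (y $ k - y' $ k))"

definition chi_space :: "((real^'d^'m) \<times> (real^'d) measure) set" where
  "chi_space = UNIV \<times> P1"

definition chi_dist :: "(real^'d^'m) \<times> (real^'d) measure \<Rightarrow> (real^'d^'m) \<times> (real^'d) measure \<Rightarrow> real"
  where "chi_dist z z' = mean_dist (fst z) (fst z') + W1 (snd z) (snd z')"

definition C0_chi :: "real \<Rightarrow> (real \<Rightarrow> (real^'d^'m) \<times> (real^'d) measure) set" where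
  "C0_chi T = {z. (\<forall>t\<in>{0..T}. z t \<in> chi_space) \<and>
     (\<forall>t\<in>{0..T}. ((\<lambda>s. chi_dist (z s) (z t)) \<longlongrightarrow> 0) (at t within {0..T}))}"

text \<open>Convergence in \<open>C\<^sup>0([0,T], \<chi>)\<close> of a sequence indexed by \<open>N \<ge> 1\<close>.\<close>

definition C0_chi_converges :: "real \<Rightarrow> (nat \<Rightarrow> real \<Rightarrow> (real^'d^'m) \<times> (real^'d) measure) \<Rightarrow>
    (real \<Rightarrow> (real^'d^'m) \<times> (real^'d) measure) \<Rightarrow> bool" where
  "C0_chi_converges T z zs \<longleftrightarrow> (\<forall>N\<ge>1. z N \<in> C0_chi T) \<and> zs \<in> C0_chi T \<and>
     (\<forall>\<epsilon>>0. \<forall>\<^sub>F N in sequentially. \<forall>t\<in>{0..T}. chi_dist (z N t) (zs t) < \<epsilon>)"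


section \<open>The two systems\<close>

text \<open>The dimensions are \<open>d = CARD('d)\<close>, \<open>m = CARD('m)\<close>; a control value is \<open>u :: real^'d^'m\<close> with
  blocks \<open>u $ k\<close>.\<close>

definition velocity :: "(real^'d \<Rightarrow> real^'d) \<Rightarrow> ('d \<Rightarrow> real^'d \<Rightarrow> real^'d) \<Rightarrow>
    real^'d^'m \<Rightarrow> real^'d^'m \<Rightarrow> (real^'d) measure \<Rightarrow> real^'d \<Rightarrow> real^'d" where
  "velocity H G u y \<mu> x =
     conv H \<mu> x + (\<Sum>l\<in>UNIV. conv_atoms (G l) (\<lambda>k. u $ k $ l) (\<lambda>k. y $ k) x)"

definition finite_solution :: "(real^'d \<Rightarrow> real^'d) \<Rightarrow> ('d \<Rightarrow> real^'d \<Rightarrow> real^'d) \<Rightarrow> real \<Rightarrow>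
    (real \<Rightarrow> real^'d^'m) \<Rightarrow> nat \<Rightarrow> (real \<Rightarrow> real^'d^'m) \<Rightarrow> (nat \<Rightarrow> real \<Rightarrow> real^'d) \<Rightarrow> bool" where
  "finite_solution H G T u N Y X \<longleftrightarrow>
     (\<forall>k. caratheodory T (\<lambda>t. Y t $ k) (\<lambda>t. u t $ k)) \<and>
     (\<forall>i\<in>{1..N}. caratheodory T (X i)
        (\<lambda>t. velocity H G (u t) (Y t) (empirical N (\<lambda>j. X j t)) (X i t)))"

text \<open>In the weak equation the right-hand side involves \<open>u t\<close>, hence is only determined for almost
  every \<open>t\<close>; the equation is understood in the sense of Caratheodory, i.e. \<open>t \<mapsto> \<integral>\<phi> d\<mu>(t)\<close> is
  absolutely continuous and the derivative has the stated value almost everywhere.\<close>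

definition limit_solution :: "(real^'d \<Rightarrow> real^'d) \<Rightarrow> ('d \<Rightarrow> real^'d \<Rightarrow> real^'d) \<Rightarrow> real \<Rightarrow>
    (real \<Rightarrow> real^'d^'m) \<Rightarrow> (real \<Rightarrow> real^'d^'m) \<Rightarrow> (real \<Rightarrow> (real^'d) measure) \<Rightarrow> bool" where
  "limit_solution H G T u Y \<mu> \<longleftrightarrow>
     (\<exists>R'>0. \<forall>t\<in>{0..T}. supp (\<mu> t) \<subseteq> cball 0 R') \<and>
     (\<lambda>t. (Y t, \<mu> t)) \<in> C0_chi T \<and>
     (\<forall>k. caratheodory T (\<lambda>t. Y t $ k) (\<lambda>t. u t $ k)) \<and>
     (\<forall>\<phi>. test_function \<phi> \<longrightarrow>
        caratheodory T (\<lambda>t. \<integral>x. \<phi> x \<partial>\<mu> t)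
          (\<lambda>t. \<integral>x. grad \<phi> x \<bullet> velocity H G (u t) (Y t) (\<mu> t) x \<partial>\<mu> t))"


section \<open>The hypothesis on the interaction kernels\<close>

text \<open>The constants depend only on the data in their indices \<open>\<rho>, R, H\<close> and \<open>\<rho>, R, M, G\<^sup>l\<close>: they are
  uniform in the measures, and in the controls bounded by \<open>M\<close> and the trajectories in \<open>B(0,R)\<close>.
  Both families of atoms carry the weights of one fixed control \<open>u\<close>.
  With two independent controls the second estimate would force \<open>G = 0\<close>
  (take \<open>Y = Y'\<close> and \<open>u \<noteq> u'\<close>).\<close>

definition hypothesis_A :: "'m::finite itself \<Rightarrow> real \<Rightarrow> (real^'d \<Rightarrow> real^'d) \<Rightarrow>
    ('d \<Rightarrow> real^'d \<Rightarrow> real^'d) \<Rightarrow> bool" where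
  "hypothesis_A _ T H G \<longleftrightarrow>
     locally_lipschitz H \<and> sublinear_growth H \<and>
     (\<forall>l. locally_lipschitz (G l) \<and> sublinear_growth (G l)) \<and>
     (\<forall>R>0. \<forall>\<rho>>0. \<exists>L. \<forall>\<mu> \<nu>.
        W1_continuous T \<mu> \<and> W1_continuous T \<nu> \<and>
        (\<forall>t\<in>{0..T}. supp (\<mu> t) \<subseteq> cball 0 R \<and> supp (\<nu> t) \<subseteq> cball 0 R) \<longrightarrow>
        (\<forall>t\<in>{0..T}. Linf_norm (lebesgue_on (cball 0 \<rho>)) (\<lambda>x. conv H (\<mu> t) x - conv H (\<nu> t) x)
           \<le> ereal (L * W1 (\<mu> t) (\<nu> t)))) \<and>
     (\<forall>R>0. \<forall>M. \<forall>\<rho>>0. \<forall>l. \<exists>L. \<forall>(u :: real \<Rightarrow> real^'d^'m) \<in> Linf T UNIV. \<forall>Y Y' :: real \<Rightarrow> real^'d^'m.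
        (\<forall>k. Linf_norm (lebesgue_on {0..T}) (\<lambda>t. u t $ k) \<le> ereal M) \<and>
        (\<forall>k. abs_cont_on 0 T (\<lambda>t. Y t $ k) \<and> abs_cont_on 0 T (\<lambda>t. Y' t $ k)) \<and>
        (\<forall>t\<in>{0..T}. \<forall>k. Y t $ k \<in> cball 0 R \<and> Y' t $ k \<in> cball 0 R) \<longrightarrow>
        (AE t in lebesgue_on {0..T}.
           Linf_norm (lebesgue_on (cball 0 \<rho>))
             (\<lambda>x. conv_atoms (G l) (\<lambda>k. u t $ k $ l) (\<lambda>k. Y t $ k) x
                - conv_atoms (G l) (\<lambda>k. u t $ k $ l) (\<lambda>k. Y' t $ k) x)
           \<le> ereal (L * mean_dist (Y t) (Y' t))))"

end

theory Submission
  imports Defs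
begin

text \<open>The limit measure is carried along by a flow on the support of \<open>\<mu>0\<close>, and this flow is the limit of the
particle trajectories. Everything follows from one quantitative comparison of two particle systems.

All facts about Caratheodory solutions come from a mean value inequality
(\<open>caratheodory_mean_value\<close>): an absolutely continuous function whose derivative is bounded by \<open>\<phi>'\<close>
almost everywhere varies no more than \<open>\<phi>\<close>. With \<open>\<phi>\<close> an exponential it gives Gronwall's inequality; with
\<open>\<phi>\<close> linear it shows that Caratheodory solutions are stable under convergence of the derivatives in
\<open>L\<^sup>\<infinity>\<close> (\<open>caratheodory_limit\<close>).

Bounded controls confine the agents, and sublinear growth with Gronwall confines the particles
(\<open>particle_confinement\<close>), for all \<open>N\<close> and all times, to one ball. On this ball the kernels are Lipschitz with one constant. The core is then
\<open>particle_stability\<close>: the distance at time \<open>t\<close> of particle \<open>i\<close> of the \<open>N\<close>-system and particle \<open>j\<close> of the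
\<open>K\<close>-system is bounded by a constant times their initial distance plus errors \<open>data_error N\<close>, \<open>data_error K\<close>
that tend to \<open>0\<close>. The two empirical measures are compared by integrating \<open>1\<close>-Lipschitz functions. At
time \<open>0\<close> this comparison passes through the integral over \<open>\<mu>0\<close>, by the triangle inequality for
numbers; to go from time \<open>t\<close> back to time \<open>0\<close>, a Lipschitz function of the positions
at time \<open>t\<close> is replaced by a Lipschitz function of the initial positions, obtained by the McShane
extension formula (\<open>dual_distance_step\<close>).

For \<open>y\<close> in the support of \<open>\<mu>0\<close> the trajectories of the atoms nearest to \<open>y\<close> therefore form a Cauchy sequence.
Their limit \<open>Phi t y\<close> is Lipschitz in \<open>y\<close>, and \<open>\<mu>\<^sup>*(t)\<close> is the image of \<open>\<mu>0\<close> under \<open>Phi t\<close>. A nearly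
optimal coupling of \<open>\<mu>\<^sub>N\<^sup>0\<close> and \<open>\<mu>0\<close>, transported by the particle motion in one variable and by
\<open>Phi t\<close> in the other, shows that \<open>W1 (\<mu>\<^sub>N(t)) (\<mu>\<^sup>*(t))\<close> tends to \<open>0\<close> uniformly in \<open>t\<close>
(\<open>emp_to_mus\<close>). Finally \<open>t \<mapsto> \<integral>\<phi> d\<mu>\<^sub>N(t)\<close> has a derivative that converges in \<open>L\<^sup>\<infinity>\<close>, and
\<open>caratheodory_limit\<close> gives the weak equation for \<open>\<mu>\<^sup>*\<close> (\<open>limit_weak_equation\<close>).\<close>

section \<open>Absolutely continuous functions and the mean value inequality\<close>

lemma abs_cont_on_lipschitz:
  assumes "\<And>s t. \<lbrakk>a \<le> s; s \<le> t; t \<le> b\<rbrakk> \<Longrightarrow> dist (f s) (f t) \<le> C * (t - s)"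
  shows "abs_cont_on a b f"
  unfolding abs_cont_on_def
proof (intro allI impI)
  fix e :: real assume "e > 0"
  define D where "D = max 1 C"
  have D: "D > 0" "C \<le> D" by (auto simp: D_def)
  show "\<exists>d>0. \<forall>(n::nat) l r.
        (\<forall>i<n. a \<le> l i \<and> l i \<le> r i \<and> r i \<le> b) \<and>
        (\<forall>i<n. \<forall>j<n. i \<noteq> j \<longrightarrow> {l i<..<r i} \<inter> {l j<..<r j} = {}) \<and>
        (\<Sum>i<n. r i - l i) < d \<longrightarrow> (\<Sum>i<n. dist (f (l i)) (f (r i))) < e"
  proof (intro exI[of _ "e / D"] conjI allI impI)
    show "e / D > 0" using \<open>e > 0\<close> D by simp
    fix n :: nat and l r
    assume *: "(\<forall>i<n. a \<le> l i \<and> l i \<le> r i \<and> r i \<le> b) \<and>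
        (\<forall>i<n. \<forall>j<n. i \<noteq> j \<longrightarrow> {l i<..<r i} \<inter> {l j<..<r j} = {}) \<and>
        (\<Sum>i<n. r i - l i) < e / D"
    have "(\<Sum>i<n. dist (f (l i)) (f (r i))) \<le> (\<Sum>i<n. D * (r i - l i))"
    proof (rule sum_mono)
      fix i assume "i \<in> {..<n}"
      then have i: "a \<le> l i" "l i \<le> r i" "r i \<le> b" using * by auto
      have "dist (f (l i)) (f (r i)) \<le> C * (r i - l i)" using assms[OF i] .
      also have "\<dots> \<le> D * (r i - l i)" using D i by (intro mult_right_mono) auto
      finally show "dist (f (l i)) (f (r i)) \<le> D * (r i - l i)" .
    qed
    also have "\<dots> = D * (\<Sum>i<n. r i - l i)" by (simp add: sum_distrib_left)
    also have "\<dots> < e" using * D by (simp add: field_simps)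
    finally show "(\<Sum>i<n. dist (f (l i)) (f (r i))) < e" .
  qed
qed

lemma abs_cont_onE:
  assumes "abs_cont_on a b f" "e > 0"
  obtains d where "d > 0" and "\<forall>(n::nat) l r.
        (\<forall>i<n. a \<le> l i \<and> l i \<le> r i \<and> r i \<le> b) \<and>
        (\<forall>i<n. \<forall>j<n. i \<noteq> j \<longrightarrow> {l i<..<r i} \<inter> {l j<..<r j} = {}) \<and>
        (\<Sum>i<n. r i - l i) < d \<longrightarrow> (\<Sum>i<n. dist (f (l i)) (f (r i))) < e"
proof -
  from assms(1)[unfolded abs_cont_on_def, THEN spec, THEN mp, OF assms(2)]
  show thesis
    by (elim exE conjE) (rule that)
qed

lemma abs_cont_on_imp_continuous_on:
  assumes "abs_cont_on a b f"
  shows "continuous_on {a..b} f"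
  unfolding continuous_on_iff
proof (intro ballI allI impI)
  fix x e :: real assume x: "x \<in> {a..b}" and "e > 0"
  obtain d where d: "d > 0" and D': "\<forall>(n::nat) l r.
        (\<forall>i<n. a \<le> l i \<and> l i \<le> r i \<and> r i \<le> b) \<and>
        (\<forall>i<n. \<forall>j<n. i \<noteq> j \<longrightarrow> {l i<..<r i} \<inter> {l j<..<r j} = {}) \<and>
        (\<Sum>i<n. r i - l i) < d \<longrightarrow> (\<Sum>i<n. dist (f (l i)) (f (r i))) < e"
    by (rule abs_cont_onE[OF assms \<open>e > 0\<close>])
  note D = D'[THEN spec, THEN spec, THEN spec, THEN mp]
  show "\<exists>d>0. \<forall>x'\<in>{a..b}. dist x' x < d \<longrightarrow> dist (f x') (f x) < e"
  proof (intro exI[of _ d] conjI ballI impI d)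
    fix y assume y: "y \<in> {a..b}" "dist y x < d"
    have "(\<Sum>i<(1::nat). dist (f (min x y)) (f (max x y))) < e"
      by (rule D) (use x y in \<open>auto simp: dist_real_def\<close>)
    then show "dist (f y) (f x) < e"
      by (auto simp: min_def max_def dist_commute split: if_splits)
  qed
qed

text \<open>Absolute continuity speaks of finite sequences of intervals; a tagged division is a finite set
  of them.\<close>

lemma sum_dist_abs_cont_family:
  fixes f :: "real \<Rightarrow> 'a::metric_space" and P :: "'i set"
  assumes AC: "\<And>(n::nat) l r.
        (\<forall>i<n. a \<le> l i \<and> l i \<le> r i \<and> r i \<le> b) \<and>
        (\<forall>i<n. \<forall>j<n. i \<noteq> j \<longrightarrow> {l i<..<r i} \<inter> {l j<..<r j} = {}) \<and>
        (\<Sum>i<n. r i - l i) < d \<Longrightarrow> (\<Sum>i<n. dist (f (l i)) (f (r i))) < e"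
    and "finite P"
    and lr: "\<And>p. p \<in> P \<Longrightarrow> a \<le> l p \<and> l p \<le> r p \<and> r p \<le> b"
    and disj: "\<And>p q. \<lbrakk>p \<in> P; q \<in> P; p \<noteq> q\<rbrakk> \<Longrightarrow> {l p<..<r p} \<inter> {l q<..<r q} = {}"
    and len: "(\<Sum>p\<in>P. r p - l p) < d"
  shows "(\<Sum>p\<in>P. dist (f (l p)) (f (r p))) < e"
proof -
  obtain h where h: "bij_betw h {..<card P} P"
    using ex_bij_betw_nat_finite[OF \<open>finite P\<close>] by (auto simp: atLeast0LessThan)
  have hP: "h i \<in> P" if "i < card P" for i
    using h that by (auto simp: bij_betw_def)
  have hne: "h i \<noteq> h j" if "i < card P" "j < card P" "i \<noteq> j" for i j
    using h that by (auto simp: bij_betw_def inj_on_def)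
  have "(\<Sum>i<card P. dist (f (l (h i))) (f (r (h i)))) < e"
    by (rule AC[of "card P" "\<lambda>i. l (h i)" "\<lambda>i. r (h i)"])
      (use lr disj hP hne len sum.reindex_bij_betw[OF h, of "\<lambda>p. r p - l p"] in auto)
  then show ?thesis
    using sum.reindex_bij_betw[OF h, of "\<lambda>p. dist (f (l p)) (f (r p))"] by simp
qed

lemma norm_add3_le:
  assumes "x = u + v + w" "norm u \<le> a" "norm v \<le> b" "norm w \<le> c"
  shows "norm x \<le> a + b + c"
proof -
  have "norm x \<le> norm u + norm v + norm w"
    unfolding assms(1) by (meson norm_triangle_ineq add_right_mono order_trans)
  then show ?thesis using assms(2-4) by linarith
qed

text \<open>Every point has a neighbourhood on which the increment of \<open>f\<close> is under control: off the exceptional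
  null set by differentiability, and on the null set because it has an open cover of measure so small
  that absolute continuity makes the total increment there less than \<open>e\<close>. By Cousin's lemma a tagged
  division of \<open>[s,t]\<close> subordinate to these neighbourhoods exists, and the increments are added.\<close>

theorem caratheodory_mean_value:
  fixes f :: "real \<Rightarrow> 'a::real_normed_vector"
  assumes car: "caratheodory T f g"
    and bd: "AE t in lebesgue_on {0..T}. norm (g t) \<le> \<phi>' t"
    and der: "\<And>t. (\<phi> has_real_derivative \<phi>' t) (at t)"
    and nonneg: "\<And>t. 0 \<le> \<phi>' t"
    and st: "0 \<le> s" "s \<le> t" "t \<le> T"
  shows "norm (f t - f s) \<le> \<phi> t - \<phi> s"
proof (rule field_le_epsilon)
  fix e0 :: real assume "e0 > 0"
  define e where "e = e0 / (1 + 2 * (t - s))"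
  have e: "e > 0" and e0: "e * (1 + 2 * (t - s)) = e0"
    using \<open>e0 > 0\<close> st by (auto simp: e_def)
  have mono: "\<phi> x \<le> \<phi> y" if "x \<le> y" for x y
    using DERIV_nonneg_imp_nondecreasing[OF that] der nonneg by blast
  have AC: "abs_cont_on 0 T f"
    and AEg: "AE t in lebesgue_on {0..T}. (f has_vector_derivative g t) (at t within {0..T}) \<and> norm (g t) \<le> \<phi>' t"
    using car bd by (auto simp: caratheodory_def)
  obtain d where "d > 0" and d': "\<forall>(n::nat) l r.
        (\<forall>i<n. 0 \<le> l i \<and> l i \<le> r i \<and> r i \<le> T) \<and>
        (\<forall>i<n. \<forall>j<n. i \<noteq> j \<longrightarrow> {l i<..<r i} \<inter> {l j<..<r j} = {}) \<and>
        (\<Sum>i<n. r i - l i) < d \<longrightarrow> (\<Sum>i<n. dist (f (l i)) (f (r i))) < e"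
    by (rule abs_cont_onE[OF AC e])
  note d = d'[THEN spec, THEN spec, THEN spec, THEN mp]
  from AEg have "AE t in lebesgue. t \<in> {0..T} \<longrightarrow>
      (f has_vector_derivative g t) (at t within {0..T}) \<and> norm (g t) \<le> \<phi>' t"
    by (subst (asm) AE_restrict_space_iff) auto
  then obtain E where E: "E \<in> null_sets lebesgue" and
    good: "\<And>x. \<lbrakk>x \<in> {0..T}; x \<notin> E\<rbrakk> \<Longrightarrow> (f has_vector_derivative g x) (at x within {0..T}) \<and> norm (g x) \<le> \<phi>' x"
    by (auto simp: eventually_ae_filter)
  have Eset: "E \<in> sets lebesgue" using E by (rule null_setsD2)
  \<comment> \<open>The open cover of the exceptional set, with measure below the threshold of absolute continuity.\<close>
  obtain W where W: "open W" "E \<subseteq> W" "emeasure lebesgue (W - E) < ennreal d"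
    using sets_lebesgue_outer_open[OF Eset \<open>d > 0\<close>] by metis
  have Wset: "W \<in> sets lebesgue" using W(1) by simp
  have "emeasure lebesgue ((W - E) \<union> E) = emeasure lebesgue (W - E)"
    using E Wset Eset by (intro emeasure_Un_null_set) auto
  moreover have "(W - E) \<union> E = W" using W by auto
  ultimately have Wd: "emeasure lebesgue W < ennreal d" using W by simp
  then have Wm: "W \<in> lmeasurable"
    using Wset by (intro fmeasurableI) (auto intro: less_trans)
  have Wd': "measure lebesgue W < d"
    using Wd emeasure_eq_measure2[OF Wm] \<open>d > 0\<close> by (simp add: ennreal_less_iff)
  have "\<exists>r>0. (x \<in> E \<longrightarrow> ball x r \<subseteq> W) \<and> (x \<in> {0..T} - E \<longrightarrow>
       (\<forall>y\<in>{0..T}. dist y x < r \<longrightarrow> norm (f y - f x - (y - x) *\<^sub>R g x) \<le> e * \<bar>y - x\<bar> \<and>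
          \<bar>\<phi> y - \<phi> x - (y - x) * \<phi>' x\<bar> \<le> e * \<bar>y - x\<bar>))" for x
  proof (cases "x \<in> {0..T} - E")
    case True
    then have "(f has_derivative (\<lambda>h. h *\<^sub>R g x)) (at x within {0..T})"
      using good by (auto simp: has_vector_derivative_def)
    then obtain r1 where r1: "r1 > 0"
        "\<And>y. \<lbrakk>y\<in>{0..T}; norm (y - x) < r1\<rbrakk> \<Longrightarrow> norm (f y - f x - (y - x) *\<^sub>R g x) \<le> e * norm (y - x)"
      using e unfolding has_derivative_within_alt by meson
    have "(\<phi> has_derivative (\<lambda>h. \<phi>' x * h)) (at x)"
      using der[of x] by (simp add: has_field_derivative_def)
    then obtain r2 where r2: "r2 > 0"
        "\<And>y. norm (y - x) < r2 \<Longrightarrow> norm (\<phi> y - \<phi> x - \<phi>' x * (y - x)) \<le> e * norm (y - x)"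
      using e unfolding has_derivative_at_alt by meson
    show ?thesis
      using True r1 r2 by (intro exI[of _ "min r1 r2"]) (auto simp: dist_norm mult.commute)
  next
    case False
    show ?thesis
    proof (cases "x \<in> E")
      case True
      then obtain r where "r > 0" "ball x r \<subseteq> W" using W by (meson open_contains_ball subsetD)
      then show ?thesis using True by auto
    next
      case False2: False
      with False show ?thesis by (intro exI[of _ 1]) auto
    qed
  qed
  then obtain r where r: "\<And>x. r x > 0" and rE: "\<And>x. x \<in> E \<Longrightarrow> ball x (r x) \<subseteq> W"
    and rG: "\<And>x y. \<lbrakk>x \<in> {0..T} - E; y \<in> {0..T}; dist y x < r x\<rbrakk> \<Longrightarrow>
        norm (f y - f x - (y - x) *\<^sub>R g x) \<le> e * \<bar>y - x\<bar> \<and>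
          \<bar>\<phi> y - \<phi> x - (y - x) * \<phi>' x\<bar> \<le> e * \<bar>y - x\<bar>"
    by metis
  have "gauge (\<lambda>x. ball x (r x))" using r by (auto simp: gauge_def)
  then obtain p where p: "p tagged_division_of {s..t}" and fine: "(\<lambda>x. ball x (r x)) fine p"
    using fine_division_exists_real by blast
  have finp: "finite p" using p by blast
  define l where "l = (\<lambda>q::real \<times> real set. Inf (snd q))"
  define h where "h = (\<lambda>q::real \<times> real set. Sup (snd q))"
  have pc: "snd q = {l q..h q}" "s \<le> l q" "l q \<le> h q" "h q \<le> t" "l q \<le> fst q" "fst q \<le> h q"
    "dist (l q) (fst q) < r (fst q)" "dist (h q) (fst q) < r (fst q)" "{l q..h q} \<subseteq> ball (fst q) (r (fst q))"
    if q: "q \<in> p" for q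
  proof -
    obtain x K where qq: "q = (x,K)" by force
    have K: "x \<in> K" "K \<subseteq> {s..t}" "\<exists>a b. K = {a..b}"
      using tagged_division_ofD(2-4)[OF p q[unfolded qq]] by auto
    have F: "K \<subseteq> ball x (r x)" using fine q qq by (auto simp: fine_def)
    obtain a b where ab: "K = {a..b}" using K by blast
    have "a \<le> b" using K ab by auto
    then show "snd q = {l q..h q}" "s \<le> l q" "l q \<le> h q" "h q \<le> t" "l q \<le> fst q" "fst q \<le> h q"
      "{l q..h q} \<subseteq> ball (fst q) (r (fst q))"
      using K F by (auto simp: l_def h_def qq ab)
    then have "l q \<in> ball (fst q) (r (fst q))" "h q \<in> ball (fst q) (r (fst q))"
      by (meson atLeastAtMost_iff order_refl subsetD)+
    then show "dist (l q) (fst q) < r (fst q)" "dist (h q) (fst q) < r (fst q)"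
      by (auto simp: dist_commute)
  qed
  \<comment> \<open>Used for \<open>f\<close>, for \<open>\<phi>\<close> and for the identity, which have different types.\<close>
  have tele: "(\<Sum>q\<in>p. F (h q) - F (l q)) = F t - F s" for F :: "real \<Rightarrow> 'b::real_normed_vector"
    using additive_tagged_division_1[OF st(2) p, of F] by (simp add: l_def h_def case_prod_beta)
  define B where "B = {q\<in>p. fst q \<in> E}"
  have disj: "{l q<..<h q} \<inter> {l q'<..<h q'} = {}" if "q \<in> p" "q' \<in> p" "q \<noteq> q'" for q q'
  proof -
    have "interior (snd q) \<inter> interior (snd q') = {}"
      using tagged_division_ofD(5)[OF p, of "fst q" "snd q" "fst q'" "snd q'"] that by auto
    then show ?thesis using pc(1) that by auto
  qed
  have len_fin: "emeasure lborel {l q<..<h q} \<noteq> \<top>" if "q \<in> p" for q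
    using pc(3)[OF that] by simp
  have finB: "finite B" using finp by (auto simp: B_def)
  have "(\<Sum>q\<in>B. h q - l q) = (\<Sum>q\<in>B. measure lebesgue {l q<..<h q})"
    using pc by (intro sum.cong) (auto simp: B_def)
  also have "\<dots> = measure lebesgue (\<Union>q\<in>B. {l q<..<h q})"
    using disj finB len_fin by (intro measure_finite_Union[symmetric])
      (auto simp: disjoint_family_on_def B_def)
  also have "\<dots> \<le> measure lebesgue W"
  proof (rule measure_mono_fmeasurable)
    show "(\<Union>q\<in>B. {l q<..<h q}) \<subseteq> W"
    proof
      fix y assume "y \<in> (\<Union>q\<in>B. {l q<..<h q})"
      then obtain q where q: "q \<in> p" "fst q \<in> E" "y \<in> {l q..h q}" by (auto simp: B_def)
      then show "y \<in> W" using pc(9)[OF q(1)] rE[OF q(2)] by blast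
    qed
    show "(\<Union>q\<in>B. {l q<..<h q}) \<in> sets lebesgue" using finB by auto
  qed (rule Wm)
  also have "\<dots> < d" by (rule Wd')
  finally have lenB: "(\<Sum>q\<in>B. h q - l q) < d" .
  have sumB: "(\<Sum>q\<in>B. dist (f (l q)) (f (h q))) < e"
  proof (rule sum_dist_abs_cont_family[OF d finB _ _ lenB])
    fix q assume "q \<in> B"
    then have "q \<in> p" by (simp add: B_def)
    from pc(2-4)[OF this] st show "0 \<le> l q \<and> l q \<le> h q \<and> h q \<le> T" by linarith
  next
    fix q q' assume "q \<in> B" "q' \<in> B" "q \<noteq> q'"
    then show "{l q<..<h q} \<inter> {l q'<..<h q'} = {}" using disj by (simp add: B_def)
  qed
  have goodq: "norm (f (h q) - f (l q)) \<le> (\<phi> (h q) - \<phi> (l q)) + 2 * e * (h q - l q)"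
    if q: "q \<in> p - B" for q
  proof -
    let ?x = "fst q" let ?a = "l q" let ?b = "h q"
    have x: "?x \<in> {0..T} - E" "?a \<in> {0..T}" "?b \<in> {0..T}"
      using q pc(2-6)[of q] st by (auto simp: B_def)
    have qp: "q \<in> p" using q by simp
    note A = rG[OF x(1,2) pc(7)[OF qp]] note Bb = rG[OF x(1,3) pc(8)[OF qp]]
    have ng: "norm (g ?x) \<le> \<phi>' ?x" using good x by auto
    have split: "f ?b - f ?a = (f ?b - f ?x - (?b - ?x) *\<^sub>R g ?x)
        + - (f ?a - f ?x - (?a - ?x) *\<^sub>R g ?x) + (?b - ?a) *\<^sub>R g ?x"
      by (simp add: algebra_simps)
    have "norm (- (f ?a - f ?x - (?a - ?x) *\<^sub>R g ?x)) \<le> e * (?x - ?a)"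
      unfolding norm_minus_cancel using A pc(5)[OF qp] by simp
    then have "norm (f ?b - f ?a) \<le> e * (?b - ?x) + e * (?x - ?a) + (?b - ?a) * \<phi>' ?x"
      by (rule norm_add3_le[OF split, rotated])
        (use Bb pc(3,6)[OF qp] ng in \<open>auto simp: mult_left_mono\<close>)
    moreover have "(?b - ?x) * \<phi>' ?x \<le> \<phi> ?b - \<phi> ?x + e * (?b - ?x)"
      using Bb pc(6)[OF qp] by (simp add: abs_le_iff)
    moreover have "\<phi> ?a - \<phi> ?x - e * (?x - ?a) \<le> (?a - ?x) * \<phi>' ?x"
      using A pc(5)[OF qp] by (simp add: abs_le_iff)
    moreover have "(?b - ?a) * \<phi>' ?x = (?b - ?x) * \<phi>' ?x - (?a - ?x) * \<phi>' ?x"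
      by (simp add: algebra_simps)
    moreover have "e * (?b - ?x) + e * (?x - ?a) = e * (?b - ?a)"
      by (simp add: algebra_simps)
    ultimately show ?thesis by linarith
  qed
  have "norm (f t - f s) = norm (\<Sum>q\<in>p. f (h q) - f (l q))" by (simp add: tele)
  also have "\<dots> \<le> (\<Sum>q\<in>p. norm (f (h q) - f (l q)))" by (rule norm_sum)
  also have "\<dots> = (\<Sum>q\<in>p - B. norm (f (h q) - f (l q))) + (\<Sum>q\<in>B. norm (f (h q) - f (l q)))"
    using finp by (intro sum.subset_diff) (auto simp: B_def)
  finally have "norm (f t - f s) \<le> (\<Sum>q\<in>p - B. norm (f (h q) - f (l q))) + (\<Sum>q\<in>B. norm (f (h q) - f (l q)))" .
  moreover have "(\<Sum>q\<in>p - B. norm (f (h q) - f (l q))) \<le> (\<Sum>q\<in>p - B. (\<phi> (h q) - \<phi> (l q)) + 2 * e * (h q - l q))"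
    by (intro sum_mono goodq)
  moreover have "(\<Sum>q\<in>p - B. (\<phi> (h q) - \<phi> (l q)) + 2 * e * (h q - l q))
      \<le> (\<Sum>q\<in>p. (\<phi> (h q) - \<phi> (l q)) + 2 * e * (h q - l q))"
    using finp e pc(3) mono by (intro sum_mono2) auto
  moreover have "(\<Sum>q\<in>p. (\<phi> (h q) - \<phi> (l q)) + 2 * e * (h q - l q)) = (\<phi> t - \<phi> s) + 2 * e * (t - s)"
    using tele[of \<phi>] tele[of "\<lambda>x. x"] by (simp add: sum.distrib sum_distrib_left[symmetric])
  moreover have "(\<Sum>q\<in>B. norm (f (h q) - f (l q))) \<le> e"
    using sumB by (simp add: dist_norm norm_minus_commute)
  moreover have "e + 2 * e * (t - s) = e0" using e0 by (simp add: algebra_simps)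
  ultimately show "norm (f t - f s) \<le> \<phi> t - \<phi> s + e0" by linarith
qed

section \<open>Gronwall estimates and limits of Caratheodory solutions\<close>

lemma abs_cont_on_diff:
  fixes f g :: "real \<Rightarrow> 'a::real_normed_vector"
  assumes "abs_cont_on a b f" "abs_cont_on a b g"
  shows "abs_cont_on a b (\<lambda>t. f t - g t)"
  unfolding abs_cont_on_def
proof (intro allI impI)
  fix e :: real assume "e > 0"
  then have e2: "e / 2 > 0" by simp
  obtain d1 where "d1 > 0" and d1: "\<forall>(n::nat) l r.
        (\<forall>i<n. a \<le> l i \<and> l i \<le> r i \<and> r i \<le> b) \<and>
        (\<forall>i<n. \<forall>j<n. i \<noteq> j \<longrightarrow> {l i<..<r i} \<inter> {l j<..<r j} = {}) \<and>
        (\<Sum>i<n. r i - l i) < d1 \<longrightarrow> (\<Sum>i<n. dist (f (l i)) (f (r i))) < e / 2"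
    by (rule abs_cont_onE[OF assms(1) e2])
  obtain d2 where "d2 > 0" and d2: "\<forall>(n::nat) l r.
        (\<forall>i<n. a \<le> l i \<and> l i \<le> r i \<and> r i \<le> b) \<and>
        (\<forall>i<n. \<forall>j<n. i \<noteq> j \<longrightarrow> {l i<..<r i} \<inter> {l j<..<r j} = {}) \<and>
        (\<Sum>i<n. r i - l i) < d2 \<longrightarrow> (\<Sum>i<n. dist (g (l i)) (g (r i))) < e / 2"
    by (rule abs_cont_onE[OF assms(2) e2])
  show "\<exists>d>0. \<forall>(n::nat) l r.
        (\<forall>i<n. a \<le> l i \<and> l i \<le> r i \<and> r i \<le> b) \<and>
        (\<forall>i<n. \<forall>j<n. i \<noteq> j \<longrightarrow> {l i<..<r i} \<inter> {l j<..<r j} = {}) \<and>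
        (\<Sum>i<n. r i - l i) < d \<longrightarrow> (\<Sum>i<n. dist (f (l i) - g (l i)) (f (r i) - g (r i))) < e"
  proof (intro exI[of _ "min d1 d2"] conjI allI impI)
    show "min d1 d2 > 0" using \<open>d1 > 0\<close> \<open>d2 > 0\<close> by simp
    fix n :: nat and l r
    assume *: "(\<forall>i<n. a \<le> l i \<and> l i \<le> r i \<and> r i \<le> b) \<and>
        (\<forall>i<n. \<forall>j<n. i \<noteq> j \<longrightarrow> {l i<..<r i} \<inter> {l j<..<r j} = {}) \<and>
        (\<Sum>i<n. r i - l i) < min d1 d2"
    have "(\<Sum>i<n. dist (f (l i) - g (l i)) (f (r i) - g (r i)))
        \<le> (\<Sum>i<n. dist (f (l i)) (f (r i)) + dist (g (l i)) (g (r i)))"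
    proof (rule sum_mono)
      fix i
      show "dist (f (l i) - g (l i)) (f (r i) - g (r i)) \<le> dist (f (l i)) (f (r i)) + dist (g (l i)) (g (r i))"
        using norm_triangle_ineq4[of "f (l i) - f (r i)" "g (l i) - g (r i)"]
        by (simp add: dist_norm algebra_simps)
    qed
    also have "\<dots> < e / 2 + e / 2"
      unfolding sum.distrib
      using d1[THEN spec, THEN spec, THEN spec, THEN mp, of n l r]
        d2[THEN spec, THEN spec, THEN spec, THEN mp, of n l r] * by (intro add_strict_mono) auto
    finally show "(\<Sum>i<n. dist (f (l i) - g (l i)) (f (r i) - g (r i))) < e" by simp
  qed
qed

lemma caratheodory_diff:
  assumes "caratheodory T f f'" "caratheodory T g g'"
  shows "caratheodory T (\<lambda>t. f t - g t) (\<lambda>t. f' t - g' t)"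
  using assms unfolding caratheodory_def
  by (auto intro: abs_cont_on_diff has_vector_derivative_diff elim: eventually_elim2)

lemma caratheodory_lipschitz:
  fixes f :: "real \<Rightarrow> 'a::real_normed_vector"
  assumes "caratheodory T f g" and "AE t in lebesgue_on {0..T}. norm (g t) \<le> C" and "C \<ge> 0"
    and st: "s \<in> {0..T}" "t \<in> {0..T}"
  shows "norm (f t - f s) \<le> C * \<bar>t - s\<bar>"
proof -
  have *: "norm (f t - f s) \<le> C * t - C * s" if "0 \<le> s" "s \<le> t" "t \<le> T" for s t
    by (rule caratheodory_mean_value[where \<phi>' = "\<lambda>_. C", OF assms(1,2) _ _ that])
      (use assms(3) in \<open>auto intro!: derivative_eq_intros\<close>)
  show ?thesis
    using *[of s t] *[of t s] st by (cases "s \<le> t") (auto simp: norm_minus_commute algebra_simps)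
qed

text \<open>A bound that improves itself up to half of its size can be iterated away. Boundedness is what
  makes the supremum a number that can be subtracted.\<close>

lemma half_self_bound:
  fixes V :: "real set"
  assumes "bdd_above V"
    and step: "\<And>S v. \<lbrakk>\<And>w. w \<in> V \<Longrightarrow> w \<le> S; v \<in> V\<rbrakk> \<Longrightarrow> v \<le> c + S / 2"
    and "v \<in> V"
  shows "v \<le> 2 * c"
proof -
  have le: "w \<le> Sup V" if "w \<in> V" for w using that assms(1) by (rule cSup_upper)
  have "Sup V \<le> c + Sup V / 2"
    using step[OF le] \<open>v \<in> V\<close> by (intro cSup_least) auto
  then show ?thesis using le[OF \<open>v \<in> V\<close>] by simp
qed

text \<open>In the norm weighted by \<open>exp (- l t)\<close> the feedback of \<open>f\<close> on itself has strength \<open>b / l\<close>, at most one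
  half, and is absorbed by \<open>half_self_bound\<close>.\<close>

lemma caratheodory_gronwall:
  fixes f :: "real \<Rightarrow> 'a::real_normed_vector"
  assumes car: "caratheodory T f g"
    and bd: "AE t in lebesgue_on {0..T}. norm (g t) \<le> b * norm (f t) + c * exp (l * t)"
    and "0 \<le> b" "0 \<le> c" "0 < l" "2 * b \<le> l" and t: "t \<in> {0..T}"
  shows "norm (f t) \<le> (2 * norm (f 0) + 2 * c / l) * exp (l * t)"
proof -
  define V where "V = (\<lambda>t. norm (f t) * exp (- l * t)) ` {0..T}"
  have "continuous_on {0..T} f"
    using car by (auto simp: caratheodory_def intro: abs_cont_on_imp_continuous_on)
  then have "compact V"
    unfolding V_def by (intro compact_continuous_image continuous_intros) auto
  then have "bdd_above V" by (simp add: bounded_imp_bdd_above compact_imp_bounded)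
  moreover have "v \<le> (norm (f 0) + c / l) + S / 2" if S: "\<And>w. w \<in> V \<Longrightarrow> w \<le> S" and "v \<in> V" for S v
  proof -
    obtain r where r: "r \<in> {0..T}" and v: "v = norm (f r) * exp (- l * r)"
      using \<open>v \<in> V\<close> by (auto simp: V_def)
    have fS: "norm (f x) \<le> S * exp (l * x)" if "x \<in> {0..T}" for x
    proof -
      have "norm (f x) * exp (- l * x) \<le> S" using S that by (auto simp: V_def)
      then show ?thesis by (simp add: exp_minus field_simps)
    qed
    have "0 \<le> norm (f r) * exp (- l * r)" by simp
    also have "\<dots> \<le> S" using S \<open>v \<in> V\<close> v by blast
    finally have "S \<ge> 0" .
    have "norm (f r - f 0) \<le> (b * S + c) / l * exp (l * r) - (b * S + c) / l * exp (l * 0)"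
    proof (rule caratheodory_mean_value[OF car])
      have "AE t in lebesgue_on {0..T}. t \<in> {0..T}"
        using AE_space[of "lebesgue_on {0..T}"] by simp
      then show "AE t in lebesgue_on {0..T}. norm (g t) \<le> (b * S + c) * exp (l * t)"
        using bd
      proof eventually_elim
        case (elim t)
        have "b * norm (f t) \<le> b * (S * exp (l * t))"
          using fS elim \<open>0 \<le> b\<close> by (intro mult_left_mono) auto
        then show ?case using elim by (simp add: algebra_simps)
      qed
      show "((\<lambda>a. (b * S + c) / l * exp (l * a)) has_real_derivative (b * S + c) * exp (l * t)) (at t)" for t
        using \<open>0 < l\<close> by (auto intro!: derivative_eq_intros)
      show "0 \<le> (b * S + c) * exp (l * t)" for t
        using \<open>0 \<le> S\<close> \<open>0 \<le> b\<close> \<open>0 \<le> c\<close> by simp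
    qed (use r in auto)
    also have "\<dots> \<le> (b * S + c) / l * exp (l * r)"
      using \<open>0 \<le> S\<close> \<open>0 \<le> b\<close> \<open>0 \<le> c\<close> \<open>0 < l\<close> by simp
    finally have "norm (f r) \<le> norm (f 0) + (b * S + c) / l * exp (l * r)"
      using norm_triangle_sub[of "f r" "f 0"] by linarith
    moreover have "exp (l * r) \<ge> 1" using \<open>0 < l\<close> r by simp
    then have "norm (f 0) \<le> norm (f 0) * exp (l * r)" by (simp add: mult_le_cancel_left1)
    ultimately have "norm (f r) \<le> (norm (f 0) + (b * S + c) / l) * exp (l * r)"
      by (simp add: algebra_simps)
    then have "v \<le> norm (f 0) + (b * S + c) / l"
      by (simp add: v exp_minus field_simps)
    moreover have "b * S \<le> l / 2 * S"
      using \<open>2 * b \<le> l\<close> \<open>0 \<le> S\<close> by (intro mult_right_mono) auto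
    then have "b * S / l \<le> S / 2" using \<open>0 < l\<close> by (simp add: pos_divide_le_eq mult.commute)
    then have "(b * S + c) / l \<le> c / l + S / 2" by (simp add: add_divide_distrib)
    ultimately show ?thesis by simp
  qed
  ultimately have "norm (f t) * exp (- l * t) \<le> 2 * (norm (f 0) + c / l)"
    using t by (intro half_self_bound) (auto simp: V_def)
  then show ?thesis by (simp add: exp_minus field_simps)
qed

text \<open>By the mean value inequality \<open>F - f n\<close> is Lipschitz with constant \<open>e n\<close>, so at a point where
  all \<open>f n\<close> have their derivatives the difference quotients of \<open>F\<close> are, up to an arbitrarily
  small error, within \<open>2 * e n\<close> of \<open>G\<close>. Differentiability almost everywhere is thus inherited.\<close>

theorem caratheodory_limit:
  fixes f :: "nat \<Rightarrow> real \<Rightarrow> 'a::real_normed_vector"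
  assumes car: "\<And>n. n \<ge> 1 \<Longrightarrow> caratheodory T (f n) (g n)"
    and lim: "\<And>t. t \<in> {0..T} \<Longrightarrow> (\<lambda>n. f n t) \<longlonglongrightarrow> F t"
    and near: "\<And>n. n \<ge> 1 \<Longrightarrow> AE t in lebesgue_on {0..T}. norm (g n t - G t) \<le> e n"
    and e: "e \<longlonglongrightarrow> 0" "\<And>n. n \<ge> 1 \<Longrightarrow> 0 \<le> e n"
    and bd: "\<And>n. n \<ge> 1 \<Longrightarrow> AE t in lebesgue_on {0..T}. norm (g n t) \<le> C" and "C \<ge> 0"
  shows "caratheodory T F G"
proof -
  have lip: "norm (F t - F s) \<le> C * \<bar>t - s\<bar>" if st: "s \<in> {0..T}" "t \<in> {0..T}" for s t
  proof (rule LIMSEQ_le_const2)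
    show "(\<lambda>n. norm (f n t - f n s)) \<longlonglongrightarrow> norm (F t - F s)"
      using lim st by (intro tendsto_intros)
    show "\<exists>N. \<forall>n\<ge>N. norm (f n t - f n s) \<le> C * \<bar>t - s\<bar>"
      using caratheodory_lipschitz[OF car bd \<open>C \<ge> 0\<close> st] by blast
  qed
  have diff: "norm ((F t - f n t) - (F s - f n s)) \<le> e n * \<bar>t - s\<bar>"
    if n: "n \<ge> 1" and st: "s \<in> {0..T}" "t \<in> {0..T}" for s t n
  proof (rule LIMSEQ_le)
    show "(\<lambda>k. norm ((f k t - f n t) - (f k s - f n s))) \<longlonglongrightarrow> norm ((F t - f n t) - (F s - f n s))"
      using lim st by (intro tendsto_intros)
    show "(\<lambda>k. (e k + e n) * \<bar>t - s\<bar>) \<longlonglongrightarrow> e n * \<bar>t - s\<bar>"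
      using e by (auto intro!: tendsto_eq_intros)
    have "norm ((f k t - f n t) - (f k s - f n s)) \<le> (e k + e n) * \<bar>t - s\<bar>" if k: "k \<ge> 1" for k
    proof (rule caratheodory_lipschitz[OF caratheodory_diff[OF car[OF k] car[OF n]] _ _ st])
      show "AE t in lebesgue_on {0..T}. norm (g k t - g n t) \<le> e k + e n"
        using near[OF k] near[OF n]
      proof eventually_elim
        case (elim t)
        then show ?case using norm_triangle_ineq4[of "g k t - G t" "g n t - G t"] by simp
      qed
    qed (use e(2)[OF n] e(2)[OF k] in auto)
    then show "\<exists>N. \<forall>k\<ge>N. norm ((f k t - f n t) - (f k s - f n s)) \<le> (e k + e n) * \<bar>t - s\<bar>"
      by blast
  qed
  have "AE t in lebesgue_on {0..T}. \<forall>n. n \<ge> 1 \<longrightarrow>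
      (f n has_vector_derivative g n t) (at t within {0..T}) \<and> norm (g n t - G t) \<le> e n"
    unfolding AE_all_countable
  proof
    fix n
    show "AE t in lebesgue_on {0..T}. n \<ge> 1 \<longrightarrow>
      (f n has_vector_derivative g n t) (at t within {0..T}) \<and> norm (g n t - G t) \<le> e n"
      using car[of n] near[of n] by (cases "n \<ge> 1") (auto simp: caratheodory_def)
  qed
  moreover have "AE t in lebesgue_on {0..T}. t \<in> {0..T}"
    using AE_space[of "lebesgue_on {0..T}"] by simp
  ultimately have "AE t in lebesgue_on {0..T}. (F has_vector_derivative G t) (at t within {0..T})"
  proof eventually_elim
    case (elim t)
    show ?case
      unfolding has_vector_derivative_def has_derivative_within_alt
    proof (intro conjI allI impI)
      show "bounded_linear (\<lambda>x. x *\<^sub>R G t)" by (rule bounded_linear_scaleR_left)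
      fix r :: real assume "r > 0"
      then have "\<forall>\<^sub>F n in sequentially. e n < r / 3" by (intro order_tendstoD(2)[OF e(1)]) auto
      then obtain n where n: "n \<ge> 1" "e n < r / 3"
        by (metis eventually_sequentially linorder_linear)
      have "(f n has_derivative (\<lambda>x. x *\<^sub>R g n t)) (at t within {0..T})"
        using elim n by (auto simp: has_vector_derivative_def)
      moreover have "r / 3 > 0" using \<open>r > 0\<close> by simp
      ultimately obtain d where d: "d > 0"
        "\<And>y. \<lbrakk>y\<in>{0..T}; norm (y - t) < d\<rbrakk> \<Longrightarrow> norm (f n y - f n t - (y - t) *\<^sub>R g n t) \<le> r / 3 * norm (y - t)"
        unfolding has_derivative_within_alt by meson
      show "\<exists>d>0. \<forall>y\<in>{0..T}. norm (y - t) < d \<longrightarrow> norm (F y - F t - (y - t) *\<^sub>R G t) \<le> r * norm (y - t)"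
      proof (intro exI[of _ d] conjI ballI impI d(1))
        fix y assume y: "y \<in> {0..T}" "norm (y - t) < d"
        have split: "F y - F t - (y - t) *\<^sub>R G t = ((F y - f n y) - (F t - f n t))
            + (f n y - f n t - (y - t) *\<^sub>R g n t) + (y - t) *\<^sub>R (g n t - G t)"
          by (simp add: algebra_simps)
        have "norm (F y - F t - (y - t) *\<^sub>R G t)
            \<le> e n * \<bar>y - t\<bar> + r / 3 * \<bar>y - t\<bar> + \<bar>y - t\<bar> * e n"
          by (rule norm_add3_le[OF split])
            (use diff[OF n(1), of t y] d(2)[OF y] elim n y in \<open>auto intro!: mult_left_mono\<close>)
        moreover have "e n * \<bar>y - t\<bar> \<le> r / 3 * \<bar>y - t\<bar>"
          using n by (intro mult_right_mono) auto
        ultimately show "norm (F y - F t - (y - t) *\<^sub>R G t) \<le> r * norm (y - t)"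
          by (simp add: mult.commute)
      qed
    qed
  qed
  moreover have "abs_cont_on 0 T F"
  proof (rule abs_cont_on_lipschitz[where C = C])
    fix s t assume "0 \<le> s" "s \<le> t" "t \<le> T"
    then show "dist (F s) (F t) \<le> C * (t - s)"
      using lip[of s t] by (simp add: dist_norm norm_minus_commute)
  qed
  ultimately show ?thesis by (simp add: caratheodory_def)
qed

section \<open>Concentrated probability measures, couplings and \<open>W1\<close>\<close>

definition prob_on :: "'a::euclidean_space set \<Rightarrow> 'a measure set" where
  "prob_on S = {\<mu>. prob_space \<mu> \<and> sets \<mu> = sets borel \<and> (AE x in \<mu>. x \<in> S)}"

lemma prob_onD:
  assumes "\<mu> \<in> prob_on S"
  shows "prob_space \<mu>" "sets \<mu> = sets borel" "AE x in \<mu>. x \<in> S" "space \<mu> = UNIV"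
  using assms sets_eq_imp_space_eq[of \<mu> borel] by (auto simp: prob_on_def)

lemma integrable_prob_on:
  fixes h :: "'a::euclidean_space \<Rightarrow> 'b::euclidean_space"
  assumes "\<mu> \<in> prob_on S" "h \<in> borel_measurable borel" "bounded (h ` S)"
  shows "integrable \<mu> h"
proof -
  interpret prob_space \<mu> using assms by (auto simp: prob_on_def)
  obtain B where B: "\<And>x. x \<in> S \<Longrightarrow> norm (h x) \<le> B"
    using assms(3) by (auto simp: bounded_iff)
  have "AE x in \<mu>. norm (h x) \<le> B" using prob_onD(3)[OF assms(1)] by eventually_elim (rule B)
  moreover have "h \<in> borel_measurable \<mu>"
    using assms(2) measurable_cong_sets[OF prob_onD(2)[OF assms(1)] refl] by blast
  ultimately show ?thesis by (rule integrable_const_bound)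
qed

lemma prob_on_subset_P1:
  assumes "bounded S"
  shows "prob_on S \<subseteq> P1"
proof
  fix \<mu> assume \<mu>: "\<mu> \<in> prob_on S"
  have "bounded (norm ` S)" using assms by (auto simp: bounded_iff)
  then have "integrable \<mu> norm" by (intro integrable_prob_on[OF \<mu>]) auto
  then show "\<mu> \<in> P1" using prob_onD[OF \<mu>] by (auto simp: P1_def)
qed

text \<open>By the Lindelof property the complement of the support is a countable union of open null sets.\<close>

lemma AE_supp:
  fixes \<mu> :: "'a::euclidean_space measure"
  assumes "sets \<mu> = sets borel"
  shows "AE x in \<mu>. x \<in> supp \<mu>"
proof -
  define F where "F = {S. open S \<and> emeasure \<mu> S = 0}"
  obtain F' where F': "F' \<subseteq> F" "countable F'" "\<Union>F' = \<Union>F"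
    using Lindelof[of F] by (auto simp: F_def)
  have "(\<Union>S\<in>F'. S) \<in> null_sets \<mu>"
    using F' assms by (intro null_sets_UN') (auto simp: F_def null_sets_def)
  moreover have "{x \<in> space \<mu>. x \<notin> supp \<mu>} \<subseteq> (\<Union>S\<in>F'. S)"
    using F'(3) by (auto simp: supp_def F_def)
  ultimately show ?thesis by (rule AE_I')
qed

lemma supp_subset_closed:
  fixes \<mu> :: "'a::euclidean_space measure"
  assumes "\<mu> \<in> prob_on S" "closed S"
  shows "supp \<mu> \<subseteq> S"
proof
  fix x assume x: "x \<in> supp \<mu>"
  show "x \<in> S"
  proof (rule ccontr)
    assume "x \<notin> S"
    have "open (- S)" using assms(2) by (simp add: open_Compl)
    then have "emeasure \<mu> (- S) > 0" using x \<open>x \<notin> S\<close> by (simp add: supp_def)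
    moreover have "AE y in \<mu>. y \<notin> - S" using prob_onD(3)[OF assms(1)] by simp
    then have "- S \<in> null_sets \<mu>"
      using \<open>open (- S)\<close> prob_onD(2)[OF assms(1)] by (subst AE_iff_null_sets) auto
    then have "emeasure \<mu> (- S) = 0" by (rule null_setsD1)
    ultimately show False by simp
  qed
qed

lemma closed_supp: "closed (supp \<mu>)"
proof -
  have "open (- supp \<mu>)"
    by (subst open_subopen) (force simp: supp_def)
  then show ?thesis by (simp add: closed_def)
qed

lemma prob_on_supp:
  assumes "\<mu> \<in> P1" "supp \<mu> \<subseteq> S"
  shows "\<mu> \<in> prob_on S"
  using AE_supp[of \<mu>] assms by (auto simp: P1_def prob_on_def)

lemma measurable_uniform_count_measure [simp]:
  "x \<in> measurable (uniform_count_measure A) M \<longleftrightarrow> x \<in> A \<rightarrow> space M"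
  by (auto simp: measurable_def sets_uniform_count_measure space_uniform_count_measure)

lemma prob_space_uniform_count_indices:
  assumes "N \<ge> (1::nat)" shows "prob_space (uniform_count_measure {1..N})"
  using assms by (intro prob_space_uniform_count_measure) auto

lemma integral_uniform_count_indices:
  fixes f :: "nat \<Rightarrow> 'b::euclidean_space"
  shows "(\<integral>i. f i \<partial>uniform_count_measure {1..N}) = (1 / real N) *\<^sub>R (\<Sum>i=1..N. f i)"
  unfolding uniform_count_measure_def
  by (subst lebesgue_integral_point_measure_finite) (auto simp: scaleR_sum_right)

lemma integral_empirical:
  fixes f :: "'a::euclidean_space \<Rightarrow> 'b::euclidean_space"
  assumes "f \<in> borel_measurable borel"
  shows "(\<integral>y. f y \<partial>empirical N x) = (1 / real N) *\<^sub>R (\<Sum>i=1..N. f (x i))"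
  unfolding empirical_def
  by (subst integral_distr) (use assms integral_uniform_count_indices[of N "\<lambda>i. f (x i)"] in auto)

lemma empirical_prob_on:
  assumes "N \<ge> 1" "\<And>i. \<lbrakk>1 \<le> i; i \<le> N\<rbrakk> \<Longrightarrow> x i \<in> S" "S \<in> sets borel"
  shows "empirical N x \<in> prob_on S"
proof -
  interpret prob_space "uniform_count_measure {1..N}" by (rule prob_space_uniform_count_indices[OF assms(1)])
  have "AE y in empirical N x. y \<in> S"
    unfolding empirical_def
    by (subst AE_distr_iff) (use assms in \<open>auto intro!: AE_I2 simp: space_uniform_count_measure\<close>)
  moreover have "prob_space (empirical N x)"
    unfolding empirical_def by (rule prob_space_distr) simp
  moreover have "sets (empirical N x) = sets borel" by (simp add: empirical_def)
  ultimately show ?thesis by (simp add: prob_on_def)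
qed

lemma atom_in_supp_empirical:
  assumes "1 \<le> i" "i \<le> N"
  shows "x i \<in> supp (empirical N x)"
  unfolding supp_def
proof safe
  fix S :: "'a set" assume S: "open S" "x i \<in> S"
  have "emeasure (empirical N x) S = emeasure (uniform_count_measure {1..N}) (x -` S \<inter> {1..N})"
    unfolding empirical_def using S by (subst emeasure_distr) (auto simp: space_uniform_count_measure)
  also have "\<dots> \<ge> emeasure (uniform_count_measure {1..N}) {i}"
    using S assms by (intro emeasure_mono) (auto simp: sets_uniform_count_measure)
  moreover have "emeasure (uniform_count_measure {1..N}) {i} > 0"
    using assms by (subst emeasure_uniform_count_measure) auto
  ultimately show "emeasure (empirical N x) S > 0" by (metis order_less_le_trans)
qed

lemma couplingD:
  assumes "\<pi> \<in> couplings \<mu> \<nu>"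
  shows "sets \<pi> = sets (borel \<Otimes>\<^sub>M borel)" "distr \<pi> borel fst = \<mu>" "distr \<pi> borel snd = \<nu>"
    "fst \<in> borel_measurable \<pi>" "snd \<in> borel_measurable \<pi>"
proof -
  show s: "sets \<pi> = sets (borel \<Otimes>\<^sub>M borel)" and "distr \<pi> borel fst = \<mu>" "distr \<pi> borel snd = \<nu>"
    using assms by (auto simp: couplings_def)
  show "fst \<in> borel_measurable \<pi>" "snd \<in> borel_measurable \<pi>"
    using measurable_cong_sets[OF s refl] by auto
qed

lemma coupling_prob_space:
  assumes "\<pi> \<in> couplings \<mu> \<nu>" "prob_space \<mu>"
  shows "prob_space \<pi>"
  using prob_space_distrD[of fst \<pi> borel] couplingD[OF assms(1)] assms(2) by simp

lemma AE_coupling: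
  assumes "\<pi> \<in> couplings \<mu> \<nu>" "AE x in \<mu>. P x" "AE y in \<nu>. Q y"
  shows "AE p in \<pi>. P (fst p) \<and> Q (snd p)"
proof -
  note c = couplingD[OF assms(1)]
  have "AE p in \<pi>. P (fst p)" using AE_distrD[OF c(4), of P] assms(2) unfolding c(2) by blast
  moreover have "AE p in \<pi>. Q (snd p)" using AE_distrD[OF c(5), of Q] assms(3) unfolding c(3) by blast
  ultimately show ?thesis by auto
qed

lemma couplings_nonempty:
  assumes "prob_space \<mu>" "prob_space \<nu>" "sets \<mu> = sets borel" "sets \<nu> = sets borel"
  shows "\<mu> \<Otimes>\<^sub>M \<nu> \<in> couplings \<mu> \<nu>"
proof -
  interpret M: prob_space \<mu> by fact
  interpret N: prob_space \<nu> by fact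
  interpret P: pair_prob_space \<mu> \<nu> ..
  have "distr (\<mu> \<Otimes>\<^sub>M \<nu>) \<mu> fst = \<mu>" by (rule N.distr_pair_fst)
  moreover have "distr (\<mu> \<Otimes>\<^sub>M \<nu>) \<nu> snd = \<nu>" 
  proof (rule measure_eqI)
    fix A assume "A \<in> sets (distr (\<mu> \<Otimes>\<^sub>M \<nu>) \<nu> snd)"
    then have A: "A \<in> sets \<nu>" by simp
    then have "snd -` A \<inter> space (\<mu> \<Otimes>\<^sub>M \<nu>) = space \<mu> \<times> A"
      by (auto simp: space_pair_measure dest: sets.sets_into_space)
    then show "emeasure (distr (\<mu> \<Otimes>\<^sub>M \<nu>) \<nu> snd) A = emeasure \<nu> A"
      using A by (simp add: emeasure_distr N.emeasure_pair_measure_Times M.emeasure_space_1)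
  qed simp
  moreover have "distr (\<mu> \<Otimes>\<^sub>M \<nu>) borel fst = distr (\<mu> \<Otimes>\<^sub>M \<nu>) \<mu> fst"
     "distr (\<mu> \<Otimes>\<^sub>M \<nu>) borel snd = distr (\<mu> \<Otimes>\<^sub>M \<nu>) \<nu> snd"
    using assms by (auto intro!: distr_cong)
  moreover have "sets (\<mu> \<Otimes>\<^sub>M \<nu>) = sets (borel \<Otimes>\<^sub>M borel)"
    using assms by (intro sets_pair_measure_cong)
  ultimately show ?thesis by (simp add: couplings_def)
qed

lemma bdd_below_coupling_costs:
  "bdd_below ((\<lambda>\<pi>. \<integral>p. dist (fst p) (snd p) \<partial>\<pi>) ` couplings \<mu> \<nu>)"
  by (rule bdd_belowI[of _ 0]) (auto intro!: integral_nonneg_AE)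

lemma W1_le_coupling:
  assumes "\<pi> \<in> couplings \<mu> \<nu>"
  shows "W1 \<mu> \<nu> \<le> (\<integral>p. dist (fst p) (snd p) \<partial>\<pi>)"
  unfolding W1_def by (rule cINF_lower[OF bdd_below_coupling_costs assms])

lemma near_optimal_coupling:
  assumes "\<mu> \<in> prob_on S" "\<nu> \<in> prob_on S'" "e > 0"
  obtains \<pi> where "\<pi> \<in> couplings \<mu> \<nu>" "(\<integral>p. dist (fst p) (snd p) \<partial>\<pi>) < W1 \<mu> \<nu> + e"
proof -
  have ne: "couplings \<mu> \<nu> \<noteq> {}"
    using couplings_nonempty prob_onD[OF assms(1)] prob_onD[OF assms(2)] by blast
  have "(INF \<pi>\<in>couplings \<mu> \<nu>. \<integral>p. dist (fst p) (snd p) \<partial>\<pi>) < W1 \<mu> \<nu> + e"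
    using \<open>e > 0\<close> by (simp add: W1_def)
  then show thesis
    using that cINF_less_iff[OF ne bdd_below_coupling_costs] by blast
qed

lemma W1_nonneg:
  assumes "\<mu> \<in> prob_on S" "\<nu> \<in> prob_on S'"
  shows "0 \<le> W1 \<mu> \<nu>"
proof -
  have ne: "couplings \<mu> \<nu> \<noteq> {}"
    using couplings_nonempty prob_onD[OF assms(1)] prob_onD[OF assms(2)] by blast
  show ?thesis unfolding W1_def by (intro cINF_greatest ne integral_nonneg_AE) auto
qed

text \<open>The joint image of \<open>M\<close> under \<open>f\<close> and \<open>g\<close> is a coupling.\<close>

lemma W1_distr_le:
  fixes f g :: "'x \<Rightarrow> 'a::euclidean_space"
  assumes [measurable]: "f \<in> borel_measurable M" "g \<in> borel_measurable M"
  shows "W1 (distr M borel f) (distr M borel g) \<le> (\<integral>x. dist (f x) (g x) \<partial>M)"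
proof -
  let ?\<pi> = "distr M (borel \<Otimes>\<^sub>M borel) (\<lambda>x. (f x, g x))"
  have "?\<pi> \<in> couplings (distr M borel f) (distr M borel g)"
    by (auto simp: couplings_def distr_distr comp_def)
  then have "W1 (distr M borel f) (distr M borel g) \<le> (\<integral>p. dist (fst p) (snd p) \<partial>?\<pi>)"
    by (rule W1_le_coupling)
  also have "\<dots> = (\<integral>x. dist (f x) (g x) \<partial>M)"
    by (subst integral_distr) auto
  finally show ?thesis .
qed

text \<open>The easy half of Kantorovich duality. The Lipschitz condition is required on \<open>S\<close> only, because
  the kernels and the gradients of test functions are controlled on balls.\<close>

theorem integral_diff_le_W1:
  fixes h :: "'a::euclidean_space \<Rightarrow> 'b::euclidean_space"
  assumes \<mu>: "\<mu> \<in> prob_on S" and \<nu>: "\<nu> \<in> prob_on S"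
    and S: "bounded S" and h[measurable]: "h \<in> borel_measurable borel" and lip: "L-lipschitz_on S h"
  shows "norm ((\<integral>x. h x \<partial>\<mu>) - (\<integral>x. h x \<partial>\<nu>)) \<le> L * W1 \<mu> \<nu>"
proof -
  have "L \<ge> 0" using lip by (rule lipschitz_on_nonneg)
  have bh: "bounded (h ` S)"
    using lipschitz_on_uniformly_continuous[OF lip] S by (rule bounded_uniformly_continuous_image)
  have *: "norm ((\<integral>x. h x \<partial>\<mu>) - (\<integral>x. h x \<partial>\<nu>)) \<le> L * (W1 \<mu> \<nu> + e)" if "e > 0" for e
  proof -
    obtain \<pi> where \<pi>: "\<pi> \<in> couplings \<mu> \<nu>" and cost: "(\<integral>p. dist (fst p) (snd p) \<partial>\<pi>) < W1 \<mu> \<nu> + e"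
      using near_optimal_coupling[OF \<mu> \<nu> \<open>e > 0\<close>] by metis
    note c = couplingD[OF \<pi>]
    note [measurable] = c(4,5)
    interpret prob_space \<pi> by (rule coupling_prob_space[OF \<pi> prob_onD(1)[OF \<mu>]])
    have I: "integrable \<pi> (\<lambda>p. h (fst p))" "integrable \<pi> (\<lambda>p. h (snd p))"
      using integrable_prob_on[OF \<mu> h bh] integrable_prob_on[OF \<nu> h bh]
        integrable_distr[OF c(4), of h] integrable_distr[OF c(5), of h] c(2,3) by auto
    have AES: "AE p in \<pi>. fst p \<in> S \<and> snd p \<in> S"
      by (rule AE_coupling[OF \<pi> prob_onD(3)[OF \<mu>] prob_onD(3)[OF \<nu>]])
    obtain B where B: "\<And>x. x \<in> S \<Longrightarrow> norm x \<le> B" using S by (auto simp: bounded_iff)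
    have Id: "integrable \<pi> (\<lambda>p. dist (fst p) (snd p))"
    proof (rule integrable_const_bound[of _ "B + B"])
      show "AE p in \<pi>. norm (dist (fst p) (snd p)) \<le> B + B"
        using AES
      proof eventually_elim
        case (elim p)
        then show ?case
          using norm_triangle_ineq4[of "fst p" "snd p"] B[of "fst p"] B[of "snd p"] by (simp add: dist_norm)
      qed
    qed measurable
    have "(\<integral>x. h x \<partial>\<mu>) = (\<integral>p. h (fst p) \<partial>\<pi>)" "(\<integral>x. h x \<partial>\<nu>) = (\<integral>p. h (snd p) \<partial>\<pi>)"
      using integral_distr[OF c(4) h] integral_distr[OF c(5) h] c(2,3) by auto
    then have "norm ((\<integral>x. h x \<partial>\<mu>) - (\<integral>x. h x \<partial>\<nu>)) = norm (\<integral>p. h (fst p) - h (snd p) \<partial>\<pi>)"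
      using I by simp
    also have "\<dots> \<le> (\<integral>p. norm (h (fst p) - h (snd p)) \<partial>\<pi>)"
      by (rule integral_norm_bound)
    also have "\<dots> \<le> (\<integral>p. L * dist (fst p) (snd p) \<partial>\<pi>)"
    proof (rule integral_mono_AE)
      show "AE p in \<pi>. norm (h (fst p) - h (snd p)) \<le> L * dist (fst p) (snd p)"
        using AES
      proof eventually_elim
        case (elim p)
        then show ?case using lipschitz_onD[OF lip, of "fst p" "snd p"] by (simp add: dist_norm)
      qed
    qed (use I Id in auto)
    also have "\<dots> \<le> L * (W1 \<mu> \<nu> + e)"
      using cost \<open>L \<ge> 0\<close> by (simp add: mult_left_mono)
    finally show ?thesis .
  qed
  show ?thesis
  proof (rule field_le_epsilon)
    fix e :: real assume "e > 0"
    then have "L * (e / (L + 1)) \<le> e" using \<open>L \<ge> 0\<close> by (simp add: field_simps)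
    then show "norm ((\<integral>x. h x \<partial>\<mu>) - (\<integral>x. h x \<partial>\<nu>)) \<le> L * W1 \<mu> \<nu> + e"
      using *[of "e / (L + 1)"] \<open>e > 0\<close> \<open>L \<ge> 0\<close> by (simp add: distrib_left)
  qed
qed

section \<open>Velocity fields of locally Lipschitz kernels\<close>

lemma locally_lipschitz_imp_continuous:
  fixes F :: "'a::euclidean_space \<Rightarrow> 'b::euclidean_space"
  assumes "locally_lipschitz F"
  shows "continuous_on UNIV F"
proof -
  have "isCont F x" for x
  proof -
    obtain r L where "r > 0" "L-lipschitz_on (cball x r) F"
      using assms unfolding locally_lipschitz_def by blast
    then have "continuous_on (cball x r) F" by (auto intro: lipschitz_on_continuous_on)
    then show ?thesis
      using \<open>r > 0\<close> by (intro continuous_on_interior[of "cball x r"]) auto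
  qed
  then show ?thesis by (simp add: continuous_at_imp_continuous_on)
qed

lemma locally_lipschitz_on_compact:
  fixes F :: "'a::euclidean_space \<Rightarrow> 'b::euclidean_space"
  assumes "locally_lipschitz F" "compact S"
  obtains L where "L-lipschitz_on S F"
proof -
  have "local_lipschitz {0::real} S (\<lambda>_. F)"
    unfolding local_lipschitz_def
  proof safe
    fix x assume "x \<in> S"
    obtain r L where "r > 0" "L-lipschitz_on (cball x r) F"
      using assms(1) unfolding locally_lipschitz_def by blast
    then show "\<exists>u>0. \<exists>L. \<forall>t\<in>cball 0 u \<inter> {0::real}. L-lipschitz_on (cball x u \<inter> S) F"
      by (metis Int_lower1 lipschitz_on_subset)
  qed
  then obtain L where "\<And>t. t \<in> {0::real} \<Longrightarrow> L-lipschitz_on S F"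
    by (rule local_lipschitz_compact_implies_lipschitz[OF _ assms(2) compact_sing]) auto
  then have "L-lipschitz_on S F" by simp
  then show thesis by (rule that)
qed

lemma norm_average_le:
  fixes v :: "'i \<Rightarrow> 'a::real_normed_vector"
  assumes "finite A" "A \<noteq> {}" "\<And>i. i \<in> A \<Longrightarrow> norm (v i) \<le> c"
  shows "norm ((1 / real (card A)) *\<^sub>R (\<Sum>i\<in>A. v i)) \<le> c"
proof -
  have "norm (\<Sum>i\<in>A. v i) \<le> (\<Sum>i\<in>A. c)"
    by (rule order_trans[OF norm_sum]) (intro sum_mono assms(3))
  then have "norm (\<Sum>i\<in>A. v i) \<le> real (card A) * c" by simp
  moreover have "real (card A) > 0" using assms by (simp add: card_gt_0_iff)
  ultimately show ?thesis by (simp add: field_simps)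
qed

lemma norm_component_le: "norm ((y::real^'d^'m) $ k) \<le> norm y"
  by (rule Finite_Cartesian_Product.norm_nth_le)

lemma AE_norm_component_le:
  fixes v :: "'a \<Rightarrow> real^'d^'m"
  assumes "AE t in S. norm (v t) \<le> c"
  shows "AE t in S. norm (v t $ k) \<le> c"
  using assms
proof eventually_elim
  case (elim t)
  then show ?case using norm_component_le[of "v t" k] by linarith
qed

lemma abs_component2_le: "\<bar>(u::real^'d^'m) $ k $ l\<bar> \<le> norm u"
  using component_le_norm_cart[of "u $ k" l] norm_component_le[of u k] by linarith

lemma norm_le_sum_components: "norm (y::real^'d^'m) \<le> (\<Sum>k\<in>UNIV. norm (y $ k))"
  unfolding norm_vec_def by (rule L2_set_le_sum) simp

definition control_field :: "('d \<Rightarrow> real^'d \<Rightarrow> real^'d) \<Rightarrow> real^'d^'m \<Rightarrow> real^'d^'m \<Rightarrow> real^'d \<Rightarrow> real^'d" where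
  "control_field G u y x = (\<Sum>l\<in>UNIV. conv_atoms (G l) (\<lambda>k. u $ k $ l) (\<lambda>k. y $ k) x)"

lemma velocity_eq: "velocity H G u y \<mu> x = conv H \<mu> x + control_field G u y x"
  by (simp add: velocity_def control_field_def)

lemma control_field_zero [simp]: "control_field G 0 y x = 0"
  by (simp add: control_field_def conv_atoms_def)

lemma control_field_lipschitz:
  fixes G :: "'d::finite \<Rightarrow> real^'d \<Rightarrow> real^'d"
  assumes G: "\<And>l. locally_lipschitz (G l)"
  obtains b where "b \<ge> 0" and
    "\<And>(u::real^'d^'m) u' y y' x x'. \<lbrakk>norm u \<le> M; norm u' \<le> M; norm x \<le> \<rho>; norm x' \<le> \<rho>;
       \<And>k. norm (y $ k) \<le> \<rho>; \<And>k. norm (y' $ k) \<le> \<rho>\<rbrakk> \<Longrightarrow>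
       norm (control_field G u y x - control_field G u' y' x')
         \<le> b * (norm (u - u') + norm (x - x') + norm (y - y'))"
proof -
  have "\<exists>L B. L-lipschitz_on (cball 0 (2 * \<rho>)) (G l) \<and> (\<forall>z\<in>cball 0 (2 * \<rho>). norm (G l z) \<le> B)" for l
  proof -
    obtain L where L: "L-lipschitz_on (cball 0 (2 * \<rho>)) (G l)"
      using locally_lipschitz_on_compact[OF G compact_cball] by metis
    have "bounded (G l ` cball 0 (2 * \<rho>))"
      using lipschitz_on_uniformly_continuous[OF L] bounded_cball by (rule bounded_uniformly_continuous_image)
    then show ?thesis using L by (auto simp: bounded_iff)
  qed
  then obtain L B where L: "\<And>l. (L l)-lipschitz_on (cball 0 (2 * \<rho>)) (G l)"
    and B: "\<And>l z. z \<in> cball 0 (2 * \<rho>) \<Longrightarrow> norm (G l z) \<le> B l"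
    by metis
  define c where "c l = \<bar>B l\<bar> + \<bar>M\<bar> * L l" for l
  have L0: "L l \<ge> 0" for l using L[of l] by (rule lipschitz_on_nonneg)
  have c0: "c l \<ge> 0" for l using L0 by (simp add: c_def)
  show thesis
  proof (rule that[of "\<Sum>l\<in>UNIV. c l"])
    show "0 \<le> (\<Sum>l\<in>UNIV. c l)" using c0 by (intro sum_nonneg) auto
    fix u u' y y' :: "real^'d^'m" and x x' :: "real^'d"
    assume u: "norm u \<le> M" "norm u' \<le> M" and x: "norm x \<le> \<rho>" "norm x' \<le> \<rho>"
      and y: "\<And>k. norm (y $ k) \<le> \<rho>" "\<And>k. norm (y' $ k) \<le> \<rho>"
    define D where "D = norm (u - u') + norm (x - x') + norm (y - y')"
    have D: "D \<ge> 0" by (simp add: D_def)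
    have "norm (conv_atoms (G l) (\<lambda>k. u $ k $ l) (\<lambda>k. y $ k) x
        - conv_atoms (G l) (\<lambda>k. u' $ k $ l) (\<lambda>k. y' $ k) x') \<le> c l * D" for l
    proof -
      have "conv_atoms (G l) (\<lambda>k. u $ k $ l) (\<lambda>k. y $ k) x
        - conv_atoms (G l) (\<lambda>k. u' $ k $ l) (\<lambda>k. y' $ k) x'
        = (1 / real (card (UNIV::'m set))) *\<^sub>R (\<Sum>k\<in>UNIV. u $ k $ l *\<^sub>R G l (x - y $ k) - u' $ k $ l *\<^sub>R G l (x' - y' $ k))"
        by (simp add: conv_atoms_def sum_subtractf scaleR_diff_right)
      also have "norm \<dots> \<le> c l * D"
      proof (rule norm_average_le)
        fix k :: 'm
        let ?a = "x - y $ k" let ?a' = "x' - y' $ k"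
        have a: "?a \<in> cball 0 (2 * \<rho>)" "?a' \<in> cball 0 (2 * \<rho>)"
          using norm_triangle_ineq4[of x "y $ k"] norm_triangle_ineq4[of x' "y' $ k"] x y(1)[of k] y(2)[of k]
          by auto
        have "u $ k $ l *\<^sub>R G l ?a - u' $ k $ l *\<^sub>R G l ?a'
            = (u - u') $ k $ l *\<^sub>R G l ?a + u' $ k $ l *\<^sub>R (G l ?a - G l ?a')"
          by (simp add: algebra_simps)
        then have "norm (u $ k $ l *\<^sub>R G l ?a - u' $ k $ l *\<^sub>R G l ?a')
            \<le> \<bar>(u - u') $ k $ l\<bar> * norm (G l ?a) + \<bar>u' $ k $ l\<bar> * norm (G l ?a - G l ?a')"
          using norm_triangle_ineq[of "(u - u') $ k $ l *\<^sub>R G l ?a" "u' $ k $ l *\<^sub>R (G l ?a - G l ?a')"] by simp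
        moreover have "\<bar>(u - u') $ k $ l\<bar> * norm (G l ?a) \<le> D * \<bar>B l\<bar>"
        proof (rule mult_mono)
          show "\<bar>(u - u') $ k $ l\<bar> \<le> D"
            using abs_component2_le[of "u - u'" k l] norm_ge_zero[of "x - x'"] norm_ge_zero[of "y - y'"]
            unfolding D_def by linarith
          show "norm (G l ?a) \<le> \<bar>B l\<bar>" using B[OF a(1), of l] by linarith
        qed (use D in auto)
        moreover have "\<bar>u' $ k $ l\<bar> * norm (G l ?a - G l ?a') \<le> \<bar>M\<bar> * (L l * D)"
        proof (rule mult_mono)
          show "\<bar>u' $ k $ l\<bar> \<le> \<bar>M\<bar>" using abs_component2_le[of u' k l] u by linarith
          have "norm (G l ?a - G l ?a') \<le> L l * norm (?a - ?a')"
            using lipschitz_onD[OF L a, of l] by (simp add: dist_norm)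
          also have "norm (?a - ?a') \<le> norm (x - x') + norm ((y - y') $ k)"
            using norm_triangle_ineq4[of "x - x'" "(y - y') $ k"] by (simp add: algebra_simps)
          then have "norm (?a - ?a') \<le> D"
            using norm_component_le[of "y - y'" k] norm_ge_zero[of "u - u'"] unfolding D_def by linarith
          then have "L l * norm (?a - ?a') \<le> L l * D" using L0 by (intro mult_left_mono)
          finally show "norm (G l ?a - G l ?a') \<le> L l * D" .
        qed auto
        ultimately show "norm (u $ k $ l *\<^sub>R G l ?a - u' $ k $ l *\<^sub>R G l ?a') \<le> c l * D"
          by (simp add: c_def algebra_simps)
      qed auto
      finally show ?thesis .
    qed
    then have "norm (control_field G u y x - control_field G u' y' x') \<le> (\<Sum>l\<in>UNIV. c l * D)"
      unfolding control_field_def sum_subtractf[symmetric]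
      by (intro order_trans[OF norm_sum] sum_mono) auto
    then show "norm (control_field G u y x - control_field G u' y' x')
        \<le> (\<Sum>l\<in>UNIV. c l) * (norm (u - u') + norm (x - x') + norm (y - y'))"
      by (simp add: D_def sum_distrib_right)
  qed
qed

text \<open>The factor \<open>1 + norm x\<close>, linear in \<open>x\<close>, is what Gronwall's inequality can absorb.\<close>

lemma control_field_growth:
  fixes G :: "'d::finite \<Rightarrow> real^'d \<Rightarrow> real^'d"
  assumes G: "\<And>l. sublinear_growth (G l)"
  obtains C where "C \<ge> 0" and
    "\<And>(u::real^'d^'m) y x. \<lbrakk>norm u \<le> M; \<And>k. norm (y $ k) \<le> \<rho>\<rbrakk> \<Longrightarrow>
       norm (control_field G u y x) \<le> C * (1 + norm x)"
proof -
  obtain c where c: "\<And>l z. norm (G l z) \<le> c l * (1 + norm z)"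
    using G unfolding sublinear_growth_def by metis
  have c0: "c l \<ge> 0" for l using order_trans[OF norm_ge_zero c[of l 0]] by simp
  define C where "C l = \<bar>M\<bar> * (c l * (1 + \<bar>\<rho>\<bar>))" for l
  show thesis
  proof (rule that[of "\<Sum>l\<in>UNIV. C l"])
    show "0 \<le> (\<Sum>l\<in>UNIV. C l)" using c0 by (intro sum_nonneg) (auto simp: C_def)
    fix u y :: "real^'d^'m" and x :: "real^'d"
    assume u: "norm u \<le> M" and y: "\<And>k. norm (y $ k) \<le> \<rho>"
    have "norm (conv_atoms (G l) (\<lambda>k. u $ k $ l) (\<lambda>k. y $ k) x) \<le> C l * (1 + norm x)" for l
      unfolding conv_atoms_def
    proof (rule norm_average_le)
      fix k :: 'm
      have "norm (x - y $ k) \<le> norm x + \<bar>\<rho>\<bar>" using norm_triangle_ineq4[of x "y $ k"] y[of k] by linarith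
      also have "1 + (norm x + \<bar>\<rho>\<bar>) \<le> (1 + \<bar>\<rho>\<bar>) * (1 + norm x)" by (simp add: algebra_simps)
      finally have "1 + norm (x - y $ k) \<le> (1 + \<bar>\<rho>\<bar>) * (1 + norm x)" by simp
      then have "c l * (1 + norm (x - y $ k)) \<le> c l * ((1 + \<bar>\<rho>\<bar>) * (1 + norm x))"
        using c0 by (intro mult_left_mono)
      then have "norm (G l (x - y $ k)) \<le> c l * ((1 + \<bar>\<rho>\<bar>) * (1 + norm x))"
        using c[of l "x - y $ k"] by linarith
      moreover have "\<bar>u $ k $ l\<bar> \<le> \<bar>M\<bar>" using abs_component2_le[of u k l] u by linarith
      ultimately have "\<bar>u $ k $ l\<bar> * norm (G l (x - y $ k)) \<le> \<bar>M\<bar> * (c l * ((1 + \<bar>\<rho>\<bar>) * (1 + norm x)))"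
        by (intro mult_mono) auto
      then show "norm (u $ k $ l *\<^sub>R G l (x - y $ k)) \<le> C l * (1 + norm x)"
        by (simp add: C_def mult.assoc)
    qed auto
    then have "norm (control_field G u y x) \<le> (\<Sum>l\<in>UNIV. C l * (1 + norm x))"
      unfolding control_field_def by (intro order_trans[OF norm_sum] sum_mono) auto
    then show "norm (control_field G u y x) \<le> (\<Sum>l\<in>UNIV. C l) * (1 + norm x)"
      by (simp add: sum_distrib_right)
  qed
qed

lemma conv_empirical:
  fixes H :: "'a::euclidean_space \<Rightarrow> 'b::euclidean_space"
  assumes "continuous_on UNIV H"
  shows "conv H (empirical N x) z = (1 / real N) *\<^sub>R (\<Sum>i=1..N. H (z - x i))"
proof -
  have "continuous_on UNIV (\<lambda>\<xi>. H (z - \<xi>))"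
    by (intro continuous_on_compose2[OF assms] continuous_intros) auto
  then show ?thesis
    unfolding conv_def by (intro integral_empirical borel_measurable_continuous_onI)
qed

lemma lipschitz_on_translate:
  fixes H :: "'a::euclidean_space \<Rightarrow> 'b::euclidean_space"
  assumes "L-lipschitz_on (cball 0 (2 * \<rho>)) H" "norm x \<le> \<rho>"
  shows "L-lipschitz_on (cball 0 \<rho>) (\<lambda>\<xi>. H (x - \<xi>))"
proof (rule lipschitz_onI)
  fix a b :: 'a assume ab: "a \<in> cball 0 \<rho>" "b \<in> cball 0 \<rho>"
  then have "x - a \<in> cball 0 (2 * \<rho>)" "x - b \<in> cball 0 (2 * \<rho>)"
    using norm_triangle_ineq4[of x a] norm_triangle_ineq4[of x b] assms(2) by auto
  from lipschitz_onD[OF assms(1) this] show "dist (H (x - a)) (H (x - b)) \<le> L * dist a b"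
    by (simp add: dist_norm norm_minus_commute)
qed (rule lipschitz_on_nonneg[OF assms(1)])

lemma conv_lipschitz:
  fixes H :: "'a::euclidean_space \<Rightarrow> 'b::euclidean_space"
  assumes H: "continuous_on UNIV H" "L-lipschitz_on (cball 0 (2 * \<rho>)) H"
    and \<mu>: "\<mu> \<in> prob_on (cball 0 \<rho>)"
  shows "L-lipschitz_on (cball 0 \<rho>) (conv H \<mu>)"
proof (rule lipschitz_onI)
  interpret prob_space \<mu> using \<mu> by (rule prob_onD)
  fix x x' :: 'a assume x: "x \<in> cball 0 \<rho>" "x' \<in> cball 0 \<rho>"
  have I: "integrable \<mu> (\<lambda>\<xi>. H (z - \<xi>))" if "z \<in> cball 0 \<rho>" for z
  proof -
    have c: "continuous_on UNIV (\<lambda>\<xi>. H (z - \<xi>))"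
      by (intro continuous_on_compose2[OF H(1)] continuous_intros) auto
    then have "compact ((\<lambda>\<xi>. H (z - \<xi>)) ` cball 0 \<rho>)"
      by (intro compact_continuous_image) (auto intro: continuous_on_subset)
    then show ?thesis
      using c by (intro integrable_prob_on[OF \<mu>] borel_measurable_continuous_onI) (auto intro: compact_imp_bounded)
  qed
  have "norm (\<integral>\<xi>. H (x - \<xi>) - H (x' - \<xi>) \<partial>\<mu>) \<le> (\<integral>\<xi>. norm (H (x - \<xi>) - H (x' - \<xi>)) \<partial>\<mu>)"
    by (rule integral_norm_bound)
  also have "\<dots> \<le> (\<integral>\<xi>. L * dist x x' \<partial>\<mu>)"
  proof (rule integral_mono_AE)
    show "AE \<xi> in \<mu>. norm (H (x - \<xi>) - H (x' - \<xi>)) \<le> L * dist x x'"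
      using prob_onD(3)[OF \<mu>]
    proof eventually_elim
      case (elim \<xi>)
      have "x - \<xi> \<in> cball 0 (2 * \<rho>)" "x' - \<xi> \<in> cball 0 (2 * \<rho>)"
        using norm_triangle_ineq4[of x \<xi>] norm_triangle_ineq4[of x' \<xi>] x elim by auto
      from lipschitz_onD[OF H(2) this] show ?case by (simp add: dist_norm)
    qed
  qed (use I x in auto)
  finally show "dist (conv H \<mu> x) (conv H \<mu> x') \<le> L * dist x x'"
    using I x by (simp add: conv_def dist_norm prob_space)
qed (rule lipschitz_on_nonneg[OF H(2)])

lemma conv_diff_le_W1:
  fixes H :: "'a::euclidean_space \<Rightarrow> 'b::euclidean_space"
  assumes H: "continuous_on UNIV H" "L-lipschitz_on (cball 0 (2 * \<rho>)) H"
    and \<mu>: "\<mu> \<in> prob_on (cball 0 \<rho>)" "\<nu> \<in> prob_on (cball 0 \<rho>)" and x: "norm x \<le> \<rho>"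
  shows "norm (conv H \<mu> x - conv H \<nu> x) \<le> L * W1 \<mu> \<nu>"
  unfolding conv_def
proof (rule integral_diff_le_W1[OF \<mu> bounded_cball _ lipschitz_on_translate[OF H(2) x]])
  show "(\<lambda>\<xi>. H (x - \<xi>)) \<in> borel_measurable borel"
    by (intro borel_measurable_continuous_onI continuous_on_compose2[OF H(1)] continuous_intros) auto
qed

section \<open>Confinement of the particles\<close>

text \<open>The force on one particle is bounded in terms of its own norm and the average of the norms of all
  particles. The largest of these norms over all particles and times, weighted by \<open>exp (- 4 C t)\<close>, bounds
  the average, so Gronwall for each particle bounds this maximum by a constant, which does not depend on \<open>N\<close>,
  plus one half of itself.\<close>

lemma particle_confinement:
  fixes H :: "real^'d \<Rightarrow> real^'d" and u Y :: "real \<Rightarrow> real^'d^'m"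
  assumes sol: "finite_solution H G T u N Y X" and "N \<ge> 1" and H: "continuous_on UNIV H"
    and Hg: "\<And>\<xi>. norm (H \<xi>) \<le> C * (1 + norm \<xi>)"
    and Gg: "AE t in lebesgue_on {0..T}. \<forall>x. norm (control_field G (u t) (Y t) x) \<le> C * (1 + norm x)"
    and "C > 0" and init: "\<And>i. \<lbrakk>1 \<le> i; i \<le> N\<rbrakk> \<Longrightarrow> norm (X i 0) \<le> R"
    and it: "1 \<le> i" "i \<le> N" "t \<in> {0..T}"
  shows "norm (X i t) \<le> (4 * R + 2) * exp (4 * C * t)"
proof -
  \<comment> \<open>Twice the constant \<open>2 * C\<close> that multiplies the norm of the particle itself.\<close>
  define l where "l = 4 * C"
  define V where "V = (\<Union>i\<in>{1..N}. (\<lambda>t. norm (X i t) * exp (- l * t)) ` {0..T})"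
  have car: "caratheodory T (X i) (\<lambda>t. velocity H G (u t) (Y t) (empirical N (\<lambda>j. X j t)) (X i t))"
    if "1 \<le> i" "i \<le> N" for i
    using sol that by (auto simp: finite_solution_def)
  have "compact ((\<lambda>t. norm (X i t) * exp (- l * t)) ` {0..T})" if "i \<in> {1..N}" for i
  proof -
    have "continuous_on {0..T} (X i)"
      using car[of i] that by (auto simp: caratheodory_def intro: abs_cont_on_imp_continuous_on)
    then show ?thesis by (intro compact_continuous_image continuous_intros) auto
  qed
  then have "compact V" unfolding V_def by (intro compact_UN) auto
  then have "bdd_above V" by (simp add: bounded_imp_bdd_above compact_imp_bounded)
  moreover have "v \<le> (2 * R + 1) + S / 2" if S: "\<And>w. w \<in> V \<Longrightarrow> w \<le> S" and "v \<in> V" for S v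
  proof -
    obtain i r where i: "1 \<le> i" "i \<le> N" and r: "r \<in> {0..T}" and v: "v = norm (X i r) * exp (- l * r)"
      using \<open>v \<in> V\<close> by (auto simp: V_def)
    have XS: "norm (X j t) \<le> S * exp (l * t)" if "1 \<le> j" "j \<le> N" "t \<in> {0..T}" for j t
    proof -
      have "norm (X j t) * exp (- l * t) \<le> S" using S that by (force simp: V_def)
      then show ?thesis by (simp add: exp_minus field_simps)
    qed
    have "0 \<le> norm (X i r) * exp (- l * r)" by simp
    also have "\<dots> \<le> S" using S \<open>v \<in> V\<close> v by blast
    finally have "S \<ge> 0" .
    have "norm (X i r) \<le> (2 * norm (X i 0) + 2 * (2 * C + C * S) / l) * exp (l * r)"
    proof (rule caratheodory_gronwall[OF car[OF i], where b = "2 * C"])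
      have "AE t in lebesgue_on {0..T}. t \<in> {0..T}"
        using AE_space[of "lebesgue_on {0..T}"] by simp
      then show "AE t in lebesgue_on {0..T}. norm (velocity H G (u t) (Y t) (empirical N (\<lambda>j. X j t)) (X i t))
          \<le> 2 * C * norm (X i t) + (2 * C + C * S) * exp (l * t)"
        using Gg
      proof eventually_elim
        case (elim t)
        let ?x = "X i t"
        have "norm ((1 / real (card {1..N})) *\<^sub>R (\<Sum>j\<in>{1..N}. H (?x - X j t)))
            \<le> C * (1 + norm ?x + S * exp (l * t))"
        proof (rule norm_average_le)
          fix j assume j: "j \<in> {1..N}"
          have "norm (H (?x - X j t)) \<le> C * (1 + norm (?x - X j t))" by (rule Hg)
          also have "\<dots> \<le> C * (1 + norm ?x + S * exp (l * t))"
            using XS[of j t] j elim(1) norm_triangle_ineq4[of ?x "X j t"] \<open>C > 0\<close>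
            by (intro mult_left_mono) auto
          finally show "norm (H (?x - X j t)) \<le> C * (1 + norm ?x + S * exp (l * t))" .
        qed (use \<open>N \<ge> 1\<close> in auto)
        then have "norm (conv H (empirical N (\<lambda>j. X j t)) ?x) \<le> C * (1 + norm ?x + S * exp (l * t))"
          by (simp add: conv_empirical[OF H])
        moreover have "norm (control_field G (u t) (Y t) ?x) \<le> C * (1 + norm ?x)" using elim by blast
        moreover have "norm (velocity H G (u t) (Y t) (empirical N (\<lambda>j. X j t)) ?x)
            \<le> norm (conv H (empirical N (\<lambda>j. X j t)) ?x) + norm (control_field G (u t) (Y t) ?x)"
          unfolding velocity_eq by (rule norm_triangle_ineq)
        ultimately have "norm (velocity H G (u t) (Y t) (empirical N (\<lambda>j. X j t)) ?x)
            \<le> C * (1 + norm ?x + S * exp (l * t)) + C * (1 + norm ?x)" by linarith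
        moreover have "2 * C * 1 \<le> 2 * C * exp (l * t)"
          using \<open>C > 0\<close> elim(1) by (intro mult_left_mono) (auto simp: l_def)
        ultimately show ?case by (simp add: algebra_simps)
      qed
    qed (use \<open>C > 0\<close> \<open>S \<ge> 0\<close> r in \<open>auto simp: l_def\<close>)
    also have "2 * (2 * C + C * S) / l = 1 + S / 2" using \<open>C > 0\<close> by (simp add: l_def field_simps)
    also have "(2 * norm (X i 0) + (1 + S / 2)) * exp (l * r) \<le> (2 * R + (1 + S / 2)) * exp (l * r)"
      using init[OF i] by (intro mult_right_mono) auto
    finally have "norm (X i r) \<le> (2 * R + (1 + S / 2)) * exp (l * r)" .
    then show ?thesis by (simp add: v exp_minus field_simps)
  qed
  moreover have "norm (X i t) * exp (- l * t) \<in> V"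
    unfolding V_def using it by (intro UN_I[of i] image_eqI[of _ _ t]) auto
  ultimately have "norm (X i t) * exp (- l * t) \<le> 2 * (2 * R + 1)"
    by (rule half_self_bound)
  then show ?thesis by (simp add: l_def exp_minus field_simps)
qed

section \<open>Stability of confined particle systems\<close>

text \<open>The situation after confinement: one ball of radius \<open>\<rho>\<close> contains all agents and particles, and on the
  relevant sets one constant \<open>b\<close> bounds the Lipschitz constants of \<open>H\<close> and of the control term. The numbers
  \<open>\<eta> N\<close> stand for the distances of the controls in \<open>L\<^sup>\<infinity>\<close>. The other constants do not depend
  on \<open>N\<close>, and neither do those of the estimates below.\<close>

locale confined_systems =
  fixes H :: "real^'d \<Rightarrow> real^'d" and G :: "'d \<Rightarrow> real^'d \<Rightarrow> real^'d"
    and T \<rho> M b :: real and \<mu>0 :: "(real^'d) measure" and X0 :: "nat \<Rightarrow> nat \<Rightarrow> real^'d"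
    and Y0 :: "real^'d^'m" and u :: "nat \<Rightarrow> real \<Rightarrow> real^'d^'m" and us :: "real \<Rightarrow> real^'d^'m"
    and Y :: "nat \<Rightarrow> real \<Rightarrow> real^'d^'m" and X :: "nat \<Rightarrow> nat \<Rightarrow> real \<Rightarrow> real^'d"
    and \<eta> :: "nat \<Rightarrow> real"
  assumes T: "0 < T" and \<rho>: "0 < \<rho>" and b: "0 < b" and M: "0 \<le> M"
    and H_cont: "continuous_on UNIV H" and H_lip: "b-lipschitz_on (cball 0 (2 * \<rho>)) H"
    and G_cont: "\<And>l. continuous_on UNIV (G l)"
    and control_lip: "\<And>(v::real^'d^'m) v' y y' x x'.
       \<lbrakk>norm v \<le> M; norm v' \<le> M; norm x \<le> \<rho>; norm x' \<le> \<rho>;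
        \<And>k. norm (y $ k) \<le> \<rho>; \<And>k. norm (y' $ k) \<le> \<rho>\<rbrakk> \<Longrightarrow>
       norm (control_field G v y x - control_field G v' y' x')
         \<le> b * (norm (v - v') + norm (x - x') + norm (y - y'))"
    and \<mu>0: "\<mu>0 \<in> prob_on (cball 0 \<rho>)"
    and init_conv: "(\<lambda>N. W1 (empirical N (X0 N)) \<mu>0) \<longlonglongrightarrow> 0"
    and sol: "\<And>N. 1 \<le> N \<Longrightarrow> finite_solution H G T (u N) N (Y N) (X N)"
    and Y_init: "\<And>N. 1 \<le> N \<Longrightarrow> Y N 0 = Y0"
    and X_init: "\<And>N i. \<lbrakk>1 \<le> i; i \<le> N\<rbrakk> \<Longrightarrow> X N i 0 = X0 N i"
    and X_ball: "\<And>N i t. \<lbrakk>1 \<le> i; i \<le> N; t \<in> {0..T}\<rbrakk> \<Longrightarrow> norm (X N i t) \<le> \<rho>"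
    and Y_ball: "\<And>N t k. \<lbrakk>1 \<le> N; t \<in> {0..T}\<rbrakk> \<Longrightarrow> norm (Y N t $ k) \<le> \<rho>"
    and u_bound: "\<And>N. 1 \<le> N \<Longrightarrow> AE t in lebesgue_on {0..T}. norm (u N t) \<le> M"
    and us_bound: "AE t in lebesgue_on {0..T}. norm (us t) \<le> M"
    and u_conv: "\<And>N. 1 \<le> N \<Longrightarrow> AE t in lebesgue_on {0..T}. norm (u N t - us t) \<le> \<eta> N"
    and \<eta>_nonneg: "\<And>N. 0 \<le> \<eta> N" and \<eta>_lim: "\<eta> \<longlonglongrightarrow> 0"
begin

abbreviation "emp N t \<equiv> empirical N (\<lambda>i. X N i t)"

definition "mT = real CARD('m) * T"

lemma mT_nonneg: "0 \<le> mT"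
  using T by (simp add: mT_def)

definition "init_dist N = W1 (empirical N (X0 N)) \<mu>0"

text \<open>Collects the two sources of error, the initial measure and the control; the second enters directly
  and through the agents, whose displacement is at most \<open>CARD('m) * T\<close> times the distance of the controls.\<close>

definition "data_error N = 2 * init_dist N + (1 + mT) * \<eta> N"

lemma AE_time: "AE t in lebesgue_on {0..T}. t \<in> {0..T}"
  using AE_space[of "lebesgue_on {0..T}"] by simp

lemma X_caratheodory:
  assumes "1 \<le> i" "i \<le> N"
  shows "caratheodory T (X N i) (\<lambda>t. velocity H G (u N t) (Y N t) (emp N t) (X N i t))"
  using sol[of N] assms by (auto simp: finite_solution_def)

lemma Y_caratheodory:
  assumes "1 \<le> N"
  shows "caratheodory T (\<lambda>t. Y N t $ k) (\<lambda>t. u N t $ k)"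
  using sol[of N] assms by (auto simp: finite_solution_def)

lemma emp_prob:
  assumes "1 \<le> N" "t \<in> {0..T}"
  shows "emp N t \<in> prob_on (cball 0 \<rho>)"
  using assms X_ball by (intro empirical_prob_on) auto

lemma emp_init: "empirical N (X0 N) = emp N 0"
  unfolding empirical_def
  by (rule distr_cong) (auto simp: space_uniform_count_measure X_init)

lemma emp0_prob:
  assumes "1 \<le> N"
  shows "empirical N (X0 N) \<in> prob_on (cball 0 \<rho>)"
  using emp_prob[OF assms, of 0] T by (simp add: emp_init)

lemma init_dist_nonneg: "1 \<le> N \<Longrightarrow> 0 \<le> init_dist N"
  unfolding init_dist_def by (rule W1_nonneg[OF emp0_prob \<mu>0])

lemma data_error_nonneg: "1 \<le> N \<Longrightarrow> 0 \<le> data_error N"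
  using init_dist_nonneg[of N] \<eta>_nonneg[of N] mT_nonneg by (simp add: data_error_def)

lemma data_error_lim: "data_error \<longlonglongrightarrow> 0"
  unfolding data_error_def init_dist_def using init_conv \<eta>_lim by (auto intro!: tendsto_eq_intros)

lemma AE_control_gap:
  assumes "1 \<le> N" "1 \<le> K"
  shows "AE t in lebesgue_on {0..T}. norm (u N t - u K t) \<le> \<eta> N + \<eta> K"
  using u_conv[OF assms(1)] u_conv[OF assms(2)]
proof eventually_elim
  case (elim t)
  then show ?case using norm_triangle_ineq4[of "u N t - us t" "u K t - us t"] by simp
qed

lemma Y_gap:
  assumes "1 \<le> N" "1 \<le> K" and t: "t \<in> {0..T}"
  shows "norm (Y N t - Y K t) \<le> mT * (\<eta> N + \<eta> K)"
proof -
  have "norm ((Y N t - Y K t) $ k) \<le> T * (\<eta> N + \<eta> K)" for k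
  proof -
    have "norm ((Y N t $ k - Y K t $ k) - (Y N 0 $ k - Y K 0 $ k)) \<le> (\<eta> N + \<eta> K) * \<bar>t - 0\<bar>"
    proof (rule caratheodory_lipschitz[OF caratheodory_diff[OF Y_caratheodory Y_caratheodory]])
      show "AE t in lebesgue_on {0..T}. norm (u N t $ k - u K t $ k) \<le> \<eta> N + \<eta> K"
        using AE_control_gap[OF assms(1,2)]
      proof eventually_elim
        case (elim t)
        then show ?case using norm_component_le[of "u N t - u K t" k] by simp
      qed
    qed (use assms T \<eta>_nonneg in auto)
    also have "\<dots> \<le> (\<eta> N + \<eta> K) * T"
      using t \<eta>_nonneg[of N] \<eta>_nonneg[of K] by (intro mult_left_mono) auto
    finally show ?thesis using Y_init assms by (simp add: mult.commute)
  qed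
  then have "(\<Sum>k\<in>UNIV. norm ((Y N t - Y K t) $ k)) \<le> (\<Sum>k\<in>(UNIV::'m set). T * (\<eta> N + \<eta> K))"
    by (intro sum_mono)
  then show ?thesis using norm_le_sum_components[of "Y N t - Y K t"] by (simp add: mT_def mult.assoc)
qed

text \<open>The difference of the convolutions is left as it is: in the comparison of two particle systems it
  is estimated by duality, in the comparison with the limit by \<open>W1\<close>.\<close>

lemma velocity_diff:
  fixes v v' y y' :: "real^'d^'m"
  assumes "norm v \<le> M" "norm v' \<le> M" "norm x \<le> \<rho>" "norm x' \<le> \<rho>"
    "\<And>k. norm (y $ k) \<le> \<rho>" "\<And>k. norm (y' $ k) \<le> \<rho>" "\<mu> \<in> prob_on (cball 0 \<rho>)"
  shows "norm (velocity H G v y \<mu> x - velocity H G v' y' \<nu> x')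
    \<le> b * (norm (v - v') + 2 * norm (x - x') + norm (y - y')) + norm (conv H \<mu> x' - conv H \<nu> x')"
proof -
  have eq: "velocity H G v y \<mu> x - velocity H G v' y' \<nu> x' =
      (conv H \<mu> x - conv H \<mu> x') + (conv H \<mu> x' - conv H \<nu> x')
      + (control_field G v y x - control_field G v' y' x')"
    by (simp add: velocity_eq)
  have "norm (conv H \<mu> x - conv H \<mu> x') \<le> b * norm (x - x')"
    using lipschitz_onD[OF conv_lipschitz[OF H_cont H_lip assms(7)], of x x'] assms(3,4)
    by (simp add: dist_norm)
  from norm_add3_le[OF eq this order_refl control_lip[OF assms(1-6)]]
  show ?thesis by (simp add: algebra_simps)
qed

definition "speed_bound = norm (H 0) + 2 * b * \<rho> + b * M"

lemma speed_nonneg: "0 \<le> speed_bound"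
  using b \<rho> M by (simp add: speed_bound_def)

lemma velocity_bound:
  fixes v y :: "real^'d^'m"
  assumes "norm v \<le> M" "norm x \<le> \<rho>" "\<And>k. norm (y $ k) \<le> \<rho>" and \<mu>: "\<mu> \<in> prob_on (cball 0 \<rho>)"
  shows "norm (velocity H G v y \<mu> x) \<le> speed_bound"
proof -
  interpret prob_space \<mu> using \<mu> by (rule prob_onD)
  have "norm (conv H \<mu> x) \<le> norm (H 0) + 2 * b * \<rho>"
  proof -
    have "norm (conv H \<mu> x) \<le> (\<integral>\<xi>. norm (H (x - \<xi>)) \<partial>\<mu>)"
      unfolding conv_def by (rule integral_norm_bound)
    also have "\<dots> \<le> (\<integral>\<xi>. norm (H 0) + 2 * b * \<rho> \<partial>\<mu>)"
    proof (rule integral_mono_AE')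
      show "AE \<xi> in \<mu>. norm (H (x - \<xi>)) \<le> norm (H 0) + 2 * b * \<rho>"
        using prob_onD(3)[OF \<mu>]
      proof eventually_elim
        case (elim \<xi>)
        have z: "norm (x - \<xi>) \<le> 2 * \<rho>" using norm_triangle_ineq4[of x \<xi>] assms(2) elim by simp
        have "norm (H (x - \<xi>) - H 0) \<le> b * norm (x - \<xi>)"
          using lipschitz_onD[OF H_lip, of "x - \<xi>" 0] z \<rho>
          by (simp add: dist_norm norm_minus_commute[of \<xi> x])
        also have "\<dots> \<le> b * (2 * \<rho>)" using z b by (intro mult_left_mono) auto
        finally show ?case using norm_triangle_sub[of "H (x - \<xi>)" "H 0"] by simp
      qed
    qed (use b \<rho> in auto)
    finally show ?thesis by (simp add: prob_space)
  qed
  moreover have "norm (control_field G v y x) \<le> b * M"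
  proof -
    have "norm (control_field G v y x - control_field G 0 y x) \<le> b * (norm (v - 0) + norm (x - x) + norm (y - y))"
      using assms M by (intro control_lip) auto
    also have "\<dots> \<le> b * M" using assms b by simp
    finally show ?thesis by simp
  qed
  ultimately show ?thesis
    unfolding velocity_eq speed_bound_def using norm_triangle_ineq[of "conv H \<mu> x" "control_field G v y x"] by linarith
qed

text \<open>Gronwall for the difference of two trajectories, when the interaction terms of their systems
  differ by at most \<open>e * exp (8 b t)\<close>. The exponential rate \<open>8 b\<close> makes \<open>e\<close> enter
  with the factor \<open>1 / (4 b)\<close>: when \<open>e\<close> is \<open>b\<close> times the distance of the two systems, as it will be, less than
  half of this distance comes back, and it can be absorbed.\<close>

lemma particle_pair_gap:
  assumes i: "1 \<le> i" "i \<le> N" and j: "1 \<le> j" "j \<le> K"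
    and d: "AE t in lebesgue_on {0..T}. norm (u N t - u K t) \<le> d" "0 \<le> d"
    and D: "\<And>t. t \<in> {0..T} \<Longrightarrow> norm (Y N t - Y K t) \<le> D"
    and e: "\<And>t x. \<lbrakk>t \<in> {0..T}; norm x \<le> \<rho>\<rbrakk> \<Longrightarrow>
        norm (conv H (emp N t) x - conv H (emp K t) x) \<le> e * exp (8 * b * t)" "0 \<le> e"
    and t: "t \<in> {0..T}"
  shows "norm (X N i t - X K j t) \<le> (2 * norm (X0 N i - X0 K j) + (b * (d + D) + e) / (4 * b)) * exp (8 * b * t)"
proof -
  have D0: "0 \<le> D" using order_trans[OF norm_ge_zero D[OF t]] .
  have "norm (X N i t - X K j t)
      \<le> (2 * norm (X N i 0 - X K j 0) + 2 * (b * (d + D) + e) / (8 * b)) * exp (8 * b * t)"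
  proof (rule caratheodory_gronwall[OF caratheodory_diff[OF X_caratheodory[OF i] X_caratheodory[OF j]],
        where b = "2 * b"])
    have N: "1 \<le> N" "1 \<le> K" using i j by auto
    show "AE t in lebesgue_on {0..T}. norm (velocity H G (u N t) (Y N t) (emp N t) (X N i t)
          - velocity H G (u K t) (Y K t) (emp K t) (X K j t))
        \<le> 2 * b * norm (X N i t - X K j t) + (b * (d + D) + e) * exp (8 * b * t)"
      using AE_time d(1) u_bound[OF N(1)] u_bound[OF N(2)]
    proof eventually_elim
      case (elim t)
      have "norm (velocity H G (u N t) (Y N t) (emp N t) (X N i t)
          - velocity H G (u K t) (Y K t) (emp K t) (X K j t))
        \<le> b * (norm (u N t - u K t) + 2 * norm (X N i t - X K j t) + norm (Y N t - Y K t))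
          + norm (conv H (emp N t) (X K j t) - conv H (emp K t) (X K j t))"
        using elim i j N by (intro velocity_diff X_ball Y_ball emp_prob)
      also have "\<dots> \<le> b * (d + 2 * norm (X N i t - X K j t) + D) + e * exp (8 * b * t)"
        using elim b D[of t] e(1)[of t "X K j t"] X_ball[OF j elim(1)]
        by (intro add_mono mult_left_mono) auto
      finally have "norm (velocity H G (u N t) (Y N t) (emp N t) (X N i t)
          - velocity H G (u K t) (Y K t) (emp K t) (X K j t))
          \<le> b * (d + 2 * norm (X N i t - X K j t) + D) + e * exp (8 * b * t)" .
      moreover have "b * (d + D) * 1 \<le> b * (d + D) * exp (8 * b * t)"
        using b d(2) D0 elim(1) by (intro mult_left_mono) auto
      ultimately show ?case by (simp add: algebra_simps)
    qed
  qed (use b d(2) D0 e(2) t in auto)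
  moreover have "2 * (b * (d + D) + e) / (8 * b) = (b * (d + D) + e) / (4 * b)"
    using b by (simp add: field_simps)
  ultimately show ?thesis using X_init[OF i] X_init[OF j] by simp
qed

definition "avg N h t = (1 / real N) * (\<Sum>i=1..N. h (X N i t))" for h :: "real^'d \<Rightarrow> real"

lemma avg_eq_integral: "h \<in> borel_measurable borel \<Longrightarrow> avg N h t = (\<integral>x. h x \<partial>emp N t)"
  by (simp add: avg_def integral_empirical)

lemma avg_bounds:
  assumes "1 \<le> N" "\<And>i. \<lbrakk>1 \<le> i; i \<le> N\<rbrakk> \<Longrightarrow> l \<le> h (X N i t) \<and> h (X N i t) \<le> r"
  shows "l \<le> avg N h t \<and> avg N h t \<le> r"
proof -
  have "(\<Sum>i=1..N. l) \<le> (\<Sum>i=1..N. h (X N i t))" "(\<Sum>i=1..N. h (X N i t)) \<le> (\<Sum>i=1..N. r)"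
    using assms(2) by (intro sum_mono; auto)+
  then show ?thesis using assms(1) by (simp add: avg_def field_simps)
qed

text \<open>Test the two measures with the component of \<open>H (x - \<xi>)\<close> in the direction of the difference of the
  convolutions, divided by its Lipschitz constant \<open>b\<close>.\<close>

lemma conv_gap_le_duality:
  assumes N: "1 \<le> N" "1 \<le> K" and t: "t \<in> {0..T}" and x: "norm x \<le> \<rho>"
    and S: "\<And>h. 1-lipschitz_on (cball 0 \<rho>) h \<Longrightarrow> avg K h t - avg N h t \<le> s"
  shows "norm (conv H (emp N t) x - conv H (emp K t) x) \<le> b * s"
proof -
  define a where "a = conv H (emp K t) x - conv H (emp N t) x"
  define h where "h \<xi> = (sgn a \<bullet> H (x - \<xi>)) / b" for \<xi>
  have "1-lipschitz_on (cball 0 \<rho>) h"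
  proof (rule lipschitz_onI)
    fix p q :: "real^'d" assume "p \<in> cball 0 \<rho>" "q \<in> cball 0 \<rho>"
    then have "norm (H (x - p) - H (x - q)) \<le> b * dist p q"
      using lipschitz_onD[OF lipschitz_on_translate[OF H_lip x], of p q] by (simp add: dist_norm)
    moreover have "\<bar>sgn a \<bullet> (H (x - p) - H (x - q))\<bar> \<le> norm (sgn a) * norm (H (x - p) - H (x - q))"
      by (rule Cauchy_Schwarz_ineq2)
    moreover have "\<dots> \<le> 1 * norm (H (x - p) - H (x - q))"
      by (intro mult_right_mono) (auto simp: norm_sgn)
    ultimately have "\<bar>sgn a \<bullet> (H (x - p) - H (x - q))\<bar> \<le> b * dist p q" by linarith
    moreover have "h p - h q = (sgn a \<bullet> (H (x - p) - H (x - q))) / b"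
      by (simp add: h_def inner_diff_right diff_divide_distrib)
    then have "dist (h p) (h q) = \<bar>sgn a \<bullet> (H (x - p) - H (x - q))\<bar> / b"
      using b by (simp add: dist_real_def)
    ultimately show "dist (h p) (h q) \<le> 1 * dist p q"
      using b by (simp add: pos_divide_le_eq mult.commute)
  qed simp
  then have "avg K h t - avg N h t \<le> s" by (rule S)
  moreover have "avg N' h t = (sgn a \<bullet> conv H (emp N' t) x) / b" for N'
    by (simp add: avg_def h_def conv_empirical[OF H_cont] inner_sum_right sum_divide_distrib[symmetric])
  then have "avg K h t - avg N h t = (sgn a \<bullet> a) / b"
    by (simp add: a_def inner_diff_right diff_divide_distrib)
  moreover have "sgn a \<bullet> a = norm a"
    by (cases "a = 0") (simp_all add: sgn_div_norm power2_norm_eq_inner[symmetric] power2_eq_square)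
  ultimately have "norm a \<le> b * s" using b by (simp add: field_simps)
  then show ?thesis by (simp add: a_def norm_minus_commute)
qed

text \<open>In particular, particles of one system that start at the same point never separate.\<close>

lemma same_system_gap:
  assumes "1 \<le> i" "i \<le> N" "1 \<le> j" "j \<le> N" "t \<in> {0..T}"
  shows "norm (X N i t - X N j t) \<le> 2 * norm (X0 N i - X0 N j) * exp (8 * b * t)"
  using particle_pair_gap[of i N j N 0 0 0 t] assms by simp

text \<open>Let \<open>F\<close> be the McShane formula for \<open>h\<close> at the positions at time \<open>t\<close>, as a function of the initial positions
  in the \<open>N\<close>-system, with the Lipschitz constant \<open>2 exp (8 b t)\<close>. Then \<open>F\<close> is at most \<open>h\<close> at the particles of the
  \<open>N\<close>-system, and by the pair estimate at least \<open>h\<close>, up to \<open>q * exp (8 b t)\<close>, at those of the \<open>K\<close>-system. The averages of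
  \<open>F\<close> over the two initial measures are both close to its integral over \<open>\<mu>0\<close>.\<close>

lemma dual_distance_step:
  assumes N: "1 \<le> N" "1 \<le> K" and t: "t \<in> {0..T}"
    and h: "1-lipschitz_on (cball 0 \<rho>) h"
    and pair: "\<And>i j. \<lbrakk>1 \<le> i; i \<le> N; 1 \<le> j; j \<le> K\<rbrakk> \<Longrightarrow>
        norm (X N i t - X K j t) \<le> (2 * norm (X0 N i - X0 K j) + q) * exp (8 * b * t)"
  shows "avg K h t - avg N h t \<le> (2 * (init_dist N + init_dist K) + q) * exp (8 * b * t)"
proof -
  define E where "E = exp (8 * b * t)"
  have E: "E > 0" by (simp add: E_def)
  define F where "F x = Min ((\<lambda>i. h (X N i t) + 2 * E * norm (x - X0 N i)) ` {1..N})" for x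
  have F_le: "F x \<le> h (X N i t) + 2 * E * norm (x - X0 N i)" if "1 \<le> i" "i \<le> N" for x i
    unfolding F_def using that by (intro Min_le) auto
  have F_ge: "z \<le> F x" if "\<And>i. \<lbrakk>1 \<le> i; i \<le> N\<rbrakk> \<Longrightarrow> z \<le> h (X N i t) + 2 * E * norm (x - X0 N i)" for x z
    unfolding F_def using that N by (subst Min_ge_iff) auto
  have F_diff: "F x \<le> F y + 2 * E * norm (x - y)" for x y
  proof -
    have "F x - 2 * E * norm (x - y) \<le> F y"
    proof (rule F_ge)
      fix i assume i: "1 \<le> i" "i \<le> N"
      have "norm (x - X0 N i) \<le> norm (x - y) + norm (y - X0 N i)"
        using norm_triangle_ineq[of "x - y" "y - X0 N i"] by simp
      then have "2 * E * norm (x - X0 N i) \<le> 2 * E * (norm (x - y) + norm (y - X0 N i))"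
        using E by (intro mult_left_mono) auto
      then show "F x - 2 * E * norm (x - y) \<le> h (X N i t) + 2 * E * norm (y - X0 N i)"
        using F_le[OF i, of x] by (simp add: algebra_simps)
    qed
    then show ?thesis by simp
  qed
  have F_lip: "(2 * E)-lipschitz_on S F" for S
  proof (rule lipschitz_onI)
    fix x y show "dist (F x) (F y) \<le> 2 * E * dist x y"
      using F_diff[of x y] F_diff[of y x] by (simp add: dist_norm abs_le_iff norm_minus_commute)
  qed (use E in simp)
  have F_meas: "F \<in> borel_measurable borel"
    using lipschitz_on_continuous_on[OF F_lip] by (rule borel_measurable_continuous_onI)
  have int0: "avg n F 0 = (\<integral>x. F x \<partial>empirical n (X0 n))" for n
    using avg_eq_integral[OF F_meas, of n 0] by (simp add: emp_init)
  have to_\<mu>0: "\<bar>avg n F 0 - (\<integral>x. F x \<partial>\<mu>0)\<bar> \<le> 2 * E * init_dist n" if "1 \<le> n" for n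
    using integral_diff_le_W1[OF emp0_prob[OF that] \<mu>0 bounded_cball F_meas F_lip] by (simp add: int0 init_dist_def)
  have "avg K h t \<le> avg K F 0 + q * E"
  proof -
    have "h (X K j t) \<le> F (X0 K j) + q * E" if j: "1 \<le> j" "j \<le> K" for j
    proof -
      have "h (X K j t) - q * E \<le> F (X0 K j)"
      proof (rule F_ge)
        fix i assume i: "1 \<le> i" "i \<le> N"
        have "h (X K j t) - h (X N i t) \<le> norm (X N i t - X K j t)"
          using lipschitz_onD[OF h, of "X K j t" "X N i t"] X_ball[OF i t] X_ball[OF j t]
          by (simp add: dist_norm norm_minus_commute)
        also have "\<dots> \<le> (2 * norm (X0 N i - X0 K j) + q) * E"
          unfolding E_def by (rule pair[OF i j])
        finally show "h (X K j t) - q * E \<le> h (X N i t) + 2 * E * norm (X0 K j - X0 N i)"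
          by (simp add: algebra_simps norm_minus_commute)
      qed
      then show ?thesis by simp
    qed
    then have "(\<Sum>j=1..K. h (X K j t)) \<le> (\<Sum>j=1..K. F (X0 K j) + q * E)"
      by (intro sum_mono) auto
    also have "\<dots> = (\<Sum>j=1..K. F (X K j 0)) + real K * (q * E)"
      by (simp add: sum.distrib X_init)
    finally show ?thesis using N by (simp add: avg_def field_simps)
  qed
  moreover have "avg N F 0 \<le> avg N h t"
    unfolding avg_def
  proof (intro mult_left_mono sum_mono)
    fix i assume "i \<in> {1..N}"
    then show "F (X N i 0) \<le> h (X N i t)" using F_le[of i "X0 N i"] by (simp add: X_init)
  qed simp
  ultimately have "avg K h t - avg N h t \<le> (2 * (init_dist N + init_dist K) + q) * E"
    using to_\<mu>0[OF N(1)] to_\<mu>0[OF N(2)] by (simp add: algebra_simps abs_le_iff)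
  then show ?thesis by (simp add: E_def)
qed

text \<open>The dual distance of the two systems controls the interaction terms, hence the pairs of
  trajectories, hence itself; with the weight \<open>exp (- 8 b t)\<close> it comes back with factor at most one half.\<close>

lemma dual_distance:
  assumes N: "1 \<le> N" "1 \<le> K" and t: "t \<in> {0..T}" and h: "1-lipschitz_on (cball 0 \<rho>) h"
  shows "avg K h t - avg N h t
    \<le> 2 * (2 * (init_dist N + init_dist K) + (1 + mT) * (\<eta> N + \<eta> K)) * exp (8 * b * t)"
proof -
  let ?c = "2 * (init_dist N + init_dist K) + (1 + mT) * (\<eta> N + \<eta> K)"
  define Z where "Z = {(avg K h t - avg N h t) * exp (- (8 * b * t)) | h t.
      t \<in> {0..T} \<and> 1-lipschitz_on (cball 0 \<rho>) h}"
  \<comment> \<open>Testing with \<open>h = 0\<close> shows that every upper bound \<open>S\<close> of \<open>Z\<close> is nonnegative.\<close>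
  have zero: "0 \<in> Z"
  proof -
    have "(avg K (\<lambda>_. 0) 0 - avg N (\<lambda>_. 0) 0) * exp (- (8 * b * 0)) \<in> Z"
      unfolding Z_def by (rule CollectI, rule exI[of _ "\<lambda>_. 0"], rule exI[of _ 0])
        (use T in \<open>auto simp: lipschitz_on_def\<close>)
    then show ?thesis by (simp add: avg_def)
  qed
  have "bdd_above Z"
  proof (rule bdd_aboveI)
    fix z assume "z \<in> Z"
    then obtain h t where t: "t \<in> {0..T}" and h: "1-lipschitz_on (cball 0 \<rho>) h"
      and z: "z = (avg K h t - avg N h t) * exp (- (8 * b * t))" by (auto simp: Z_def)
    have "h 0 - \<rho> \<le> h p \<and> h p \<le> h 0 + \<rho>" if "norm p \<le> \<rho>" for p
      using lipschitz_onD[OF h, of p 0] that \<rho> by (simp add: dist_real_def abs_le_iff)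
    then have "h 0 - \<rho> \<le> avg n h t \<and> avg n h t \<le> h 0 + \<rho>" if "1 \<le> n" for n
      using that X_ball t by (intro avg_bounds) auto
    from this[OF N(1)] this[OF N(2)] have "avg K h t - avg N h t \<le> 2 * \<rho>" by linarith
    then have "z \<le> 2 * \<rho> * exp (- (8 * b * t))" unfolding z by (intro mult_right_mono) auto
    also have "\<dots> \<le> 2 * \<rho> * 1" using b t \<rho> by (intro mult_left_mono) auto
    finally show "z \<le> 2 * \<rho>" by simp
  qed
  moreover have "z \<le> ?c + S / 2" if S: "\<And>z. z \<in> Z \<Longrightarrow> z \<le> S" and "z \<in> Z" for S z
  proof -
    have S0: "0 \<le> S" using S zero by blast
    have dual: "avg K h t - avg N h t \<le> S * exp (8 * b * t)"
      if "t \<in> {0..T}" "1-lipschitz_on (cball 0 \<rho>) h" for t h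
    proof -
      have "(avg K h t - avg N h t) * exp (- (8 * b * t)) \<le> S"
        using that by (intro S) (auto simp: Z_def)
      then show ?thesis by (simp add: exp_minus field_simps)
    qed
    obtain h t where t: "t \<in> {0..T}" and h: "1-lipschitz_on (cball 0 \<rho>) h"
      and z: "z = (avg K h t - avg N h t) * exp (- (8 * b * t))" using \<open>z \<in> Z\<close> by (auto simp: Z_def)
    let ?q = "(b * ((\<eta> N + \<eta> K) + mT * (\<eta> N + \<eta> K)) + b * S) / (4 * b)"
    have "avg K h t - avg N h t \<le> (2 * (init_dist N + init_dist K) + ?q) * exp (8 * b * t)"
    proof (rule dual_distance_step[OF N t h])
      fix i j assume "1 \<le> i" "i \<le> N" "1 \<le> j" "j \<le> K"
      then show "norm (X N i t - X K j t) \<le> (2 * norm (X0 N i - X0 K j) + ?q) * exp (8 * b * t)"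
      proof (rule particle_pair_gap[OF _ _ _ _ AE_control_gap[OF N] _ Y_gap[OF N] _ _ t])
        fix t x assume "t \<in> {0..T}" "norm (x::real^'d) \<le> \<rho>"
        then show "norm (conv H (emp N t) x - conv H (emp K t) x) \<le> b * S * exp (8 * b * t)"
          using conv_gap_le_duality[OF N, of t x "S * exp (8 * b * t)"] dual by (simp add: mult.assoc)
      qed (use \<eta>_nonneg mT_nonneg b S0 in auto)
    qed
    then have "z \<le> 2 * (init_dist N + init_dist K) + ?q" unfolding z by (simp add: exp_minus field_simps)
    also have "?q = ((1 + mT) * (\<eta> N + \<eta> K)) / 4 + S / 4"
      using b by (simp add: field_simps)
    also have "((1 + mT) * (\<eta> N + \<eta> K)) / 4 \<le> (1 + mT) * (\<eta> N + \<eta> K)"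
      using mT_nonneg \<eta>_nonneg[of N] \<eta>_nonneg[of K] by simp
    also have "S / 4 \<le> S / 2" using S0 by simp
    finally show ?thesis by simp
  qed
  moreover have "(avg K h t - avg N h t) * exp (- (8 * b * t)) \<in> Z"
    using t h by (auto simp: Z_def)
  ultimately have "(avg K h t - avg N h t) * exp (- (8 * b * t)) \<le> 2 * ?c"
    by (rule half_self_bound)
  then show ?thesis by (simp add: exp_minus field_simps)
qed

definition "stability_const = 2 * exp (8 * b * T)"

lemma stability_const_pos: "stability_const > 0"
  by (simp add: stability_const_def)

text \<open>The bound of the dual distance turns the pair estimate into one in terms of the data alone.\<close>

theorem particle_stability:
  assumes i: "1 \<le> i" "i \<le> N" and j: "1 \<le> j" "j \<le> K" and t: "t \<in> {0..T}"
  shows "norm (X N i t - X K j t) \<le> stability_const * (norm (X0 N i - X0 K j) + data_error N + data_error K)"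
proof -
  have N: "1 \<le> N" "1 \<le> K" using i j by auto
  define s where "s = 2 * (data_error N + data_error K)"
  have data_error0: "0 \<le> data_error N" "0 \<le> data_error K" using data_error_nonneg N by auto
  let ?g = "(1 + mT) * (\<eta> N + \<eta> K)"
  have g: "?g \<le> data_error N + data_error K"
    using init_dist_nonneg N by (simp add: data_error_def algebra_simps)
  have "norm (X N i t - X K j t) \<le> (2 * norm (X0 N i - X0 K j)
      + (b * ((\<eta> N + \<eta> K) + mT * (\<eta> N + \<eta> K)) + b * s) / (4 * b)) * exp (8 * b * t)"
  proof (rule particle_pair_gap[OF i j AE_control_gap[OF N] _ Y_gap[OF N] _ _ t])
    fix t x assume t: "t \<in> {0..T}" and "norm (x::real^'d) \<le> \<rho>"
    moreover have "avg K h t - avg N h t \<le> s * exp (8 * b * t)" if "1-lipschitz_on (cball 0 \<rho>) h" for h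
      using dual_distance[OF N t that] by (simp add: s_def data_error_def algebra_simps)
    ultimately show "norm (conv H (emp N t) x - conv H (emp K t) x) \<le> b * s * exp (8 * b * t)"
      using conv_gap_le_duality[OF N, of t x "s * exp (8 * b * t)"] by (simp add: mult.assoc)
  qed (use \<eta>_nonneg b data_error0 in \<open>auto simp: s_def\<close>)
  also have "(b * ((\<eta> N + \<eta> K) + mT * (\<eta> N + \<eta> K)) + b * s) / (4 * b) = (?g + s) / 4"
    using b by (simp add: field_simps)
  also have "(2 * norm (X0 N i - X0 K j) + (?g + s) / 4) * exp (8 * b * t)
      \<le> (2 * (norm (X0 N i - X0 K j) + data_error N + data_error K)) * exp (8 * b * T)"
  proof (rule mult_mono)
    show "2 * norm (X0 N i - X0 K j) + (?g + s) / 4 \<le> 2 * (norm (X0 N i - X0 K j) + data_error N + data_error K)"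
      using g data_error0 by (simp add: s_def)
    show "exp (8 * b * t) \<le> exp (8 * b * T)" using b t by simp
  qed (use data_error0 in auto)
  finally show ?thesis by (simp add: stability_const_def algebra_simps)
qed

end

section \<open>Criteria for convergence\<close>

lemma mean_dist_le:
  fixes y y' :: "real^'d^'m"
  assumes "\<And>k. norm (y $ k - y' $ k) \<le> c"
  shows "mean_dist y y' \<le> c"
proof -
  have "(\<Sum>k\<in>UNIV. norm (y $ k - y' $ k)) \<le> (\<Sum>k\<in>(UNIV::'m set). c)"
    using assms by (intro sum_mono)
  then show ?thesis by (simp add: mean_dist_def field_simps)
qed

lemma chi_dist_nonneg:
  assumes "\<mu> \<in> prob_on S" "\<nu> \<in> prob_on S'"
  shows "0 \<le> chi_dist (y, \<mu>) (y', \<nu>)"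
  using W1_nonneg[OF assms] by (simp add: chi_dist_def mean_dist_def sum_nonneg)

text \<open>The lower bound \<open>0\<close> of \<open>chi_dist\<close> is not automatic, since \<open>W1\<close> is an infimum of real numbers over
  a set of couplings that has to be nonempty.\<close>

lemma C0_chi_lipschitzI:
  assumes \<mu>: "\<And>t. t \<in> {0..T} \<Longrightarrow> \<mu> t \<in> prob_on (cball 0 r)"
    and lip: "\<And>s t. \<lbrakk>s \<in> {0..T}; t \<in> {0..T}\<rbrakk> \<Longrightarrow> chi_dist (y s, \<mu> s) (y t, \<mu> t) \<le> L * \<bar>s - t\<bar>"
  shows "(\<lambda>t. (y t, \<mu> t)) \<in> C0_chi T"
  unfolding C0_chi_def
proof (intro CollectI conjI ballI)
  fix t assume t: "t \<in> {0..T}"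
  show "(y t, \<mu> t) \<in> chi_space"
    using \<mu>[OF t] prob_on_subset_P1[of "cball 0 r"] by (auto simp: chi_space_def)
  show "((\<lambda>s. chi_dist (y s, \<mu> s) (y t, \<mu> t)) \<longlongrightarrow> 0) (at t within {0..T})"
  proof (rule tendsto_sandwich[of "\<lambda>_. 0" _ _ "\<lambda>s. L * \<bar>s - t\<bar>"])
    show "((\<lambda>s. L * \<bar>s - t\<bar>) \<longlongrightarrow> 0) (at t within {0..T})"
      by (auto intro!: tendsto_eq_intros)
    show "\<forall>\<^sub>F s in at t within {0..T}. 0 \<le> chi_dist (y s, \<mu> s) (y t, \<mu> t)"
      using chi_dist_nonneg[OF \<mu> \<mu>] t by (auto simp: eventually_at_filter intro!: always_eventually)
    show "\<forall>\<^sub>F s in at t within {0..T}. chi_dist (y s, \<mu> s) (y t, \<mu> t) \<le> L * \<bar>s - t\<bar>"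
      using lip t by (auto simp: eventually_at_filter intro!: always_eventually)
  qed simp
qed

lemma tendsto_lim_rate:
  fixes x :: "nat \<Rightarrow> 'a::banach"
  assumes "\<And>n k. \<lbrakk>1 \<le> n; 1 \<le> k\<rbrakk> \<Longrightarrow> norm (x n - x k) \<le> e n + e k" "e \<longlonglongrightarrow> 0"
  shows "x \<longlonglongrightarrow> lim x"
proof -
  have "Cauchy x"
  proof (rule CauchyI)
    fix r :: real assume "0 < r"
    then have "\<forall>\<^sub>F n in sequentially. e n < r / 2"
      by (intro order_tendstoD(2)[OF assms(2)]) auto
    then obtain n0 where n0: "\<And>n. n \<ge> n0 \<Longrightarrow> e n < r / 2"
      by (auto simp: eventually_sequentially)
    have "norm (x m - x n) < r" if "m \<ge> max 1 n0" "n \<ge> max 1 n0" for m n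
      using assms(1)[of m n] n0[of m] n0[of n] that by auto
    then show "\<exists>M. \<forall>m\<ge>M. \<forall>n\<ge>M. norm (x m - x n) < r" by blast
  qed
  then show ?thesis by (simp add: Cauchy_convergent_iff convergent_LIMSEQ_iff)
qed

section \<open>The limit flow and convergence to its image measures\<close>

context confined_systems
begin

lemma init_dist_lim: "init_dist \<longlonglongrightarrow> 0"
  using init_conv by (simp add: init_dist_def[abs_def])

definition "Ys t = lim (\<lambda>N. Y N t)"

lemma Y_tendsto:
  assumes "t \<in> {0..T}"
  shows "(\<lambda>N. Y N t) \<longlonglongrightarrow> Ys t"
  unfolding Ys_def
proof (rule tendsto_lim_rate)
  show "norm (Y n t - Y k t) \<le> mT * \<eta> n + mT * \<eta> k" if "1 \<le> n" "1 \<le> k" for n k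
    using Y_gap[OF that assms] by (simp add: distrib_left)
  show "(\<lambda>n. mT * \<eta> n) \<longlonglongrightarrow> 0" using \<eta>_lim by (auto intro!: tendsto_eq_intros)
qed

lemma Ys_gap:
  assumes "1 \<le> N" "t \<in> {0..T}"
  shows "norm (Y N t - Ys t) \<le> mT * \<eta> N"
proof (rule LIMSEQ_le)
  show "(\<lambda>K. norm (Y N t - Y K t)) \<longlonglongrightarrow> norm (Y N t - Ys t)"
    using Y_tendsto[OF assms(2)] by (intro tendsto_intros)
  show "(\<lambda>K. mT * (\<eta> N + \<eta> K)) \<longlonglongrightarrow> mT * \<eta> N"
    using \<eta>_lim by (auto intro!: tendsto_eq_intros)
  show "\<exists>k. \<forall>n\<ge>k. norm (Y N t - Y n t) \<le> mT * (\<eta> N + \<eta> n)"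
    using Y_gap[OF assms(1) _ assms(2)] by blast
qed

lemma Ys_init: "Ys 0 = Y0"
proof (rule LIMSEQ_unique)
  show "(\<lambda>N. Y N 0) \<longlonglongrightarrow> Ys 0" using Y_tendsto T by simp
  show "(\<lambda>N. Y N 0) \<longlonglongrightarrow> Y0"
    by (rule tendsto_eventually) (auto simp: eventually_sequentially intro!: exI[of _ 1] Y_init)
qed

lemma Ys_ball:
  assumes "t \<in> {0..T}"
  shows "norm (Ys t $ k) \<le> \<rho>"
proof (rule LIMSEQ_le_const2)
  show "(\<lambda>N. norm (Y N t $ k)) \<longlonglongrightarrow> norm (Ys t $ k)"
    using Y_tendsto[OF assms] by (intro tendsto_intros)
  show "\<exists>N. \<forall>n\<ge>N. norm (Y n t $ k) \<le> \<rho>" using Y_ball assms by blast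
qed

lemma Ys_caratheodory: "caratheodory T (\<lambda>t. Ys t $ k) (\<lambda>t. us t $ k)"
proof (rule caratheodory_limit[where C = M and e = \<eta>])
  show "caratheodory T (\<lambda>t. Y n t $ k) (\<lambda>t. u n t $ k)" if "1 \<le> n" for n
    by (rule Y_caratheodory[OF that])
  show "(\<lambda>n. Y n t $ k) \<longlonglongrightarrow> Ys t $ k" if "t \<in> {0..T}" for t
    using Y_tendsto[OF that] by (intro tendsto_intros)
  show "AE t in lebesgue_on {0..T}. norm (u n t $ k - us t $ k) \<le> \<eta> n" if "1 \<le> n" for n
    using u_conv[OF that]
  proof eventually_elim
    case (elim t)
    then show ?case using norm_component_le[of "u n t - us t" k] by simp
  qed
  show "AE t in lebesgue_on {0..T}. norm (u n t $ k) \<le> M" if "1 \<le> n" for n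
    by (rule AE_norm_component_le[OF u_bound[OF that]])
qed (use \<eta>_lim \<eta>_nonneg M in auto)

lemma Y_time_lipschitz:
  assumes "1 \<le> N" "s \<in> {0..T}" "t \<in> {0..T}"
  shows "mean_dist (Y N s) (Y N t) \<le> M * \<bar>s - t\<bar>"
proof (rule mean_dist_le)
  fix k
  have "AE t in lebesgue_on {0..T}. norm (u N t $ k) \<le> M"
    by (rule AE_norm_component_le[OF u_bound[OF assms(1)]])
  from caratheodory_lipschitz[OF Y_caratheodory[OF assms(1)] this M assms(3,2)]
  show "norm (Y N s $ k - Y N t $ k) \<le> M * \<bar>s - t\<bar>" .
qed

lemma Ys_time_lipschitz:
  assumes "s \<in> {0..T}" "t \<in> {0..T}"
  shows "mean_dist (Ys s) (Ys t) \<le> M * \<bar>s - t\<bar>"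
proof (rule mean_dist_le)
  fix k
  have "AE t in lebesgue_on {0..T}. norm (us t $ k) \<le> M"
    by (rule AE_norm_component_le[OF us_bound])
  from caratheodory_lipschitz[OF Ys_caratheodory this M assms(2,1)]
  show "norm (Ys s $ k - Ys t $ k) \<le> M * \<bar>s - t\<bar>" .
qed

lemma X_time_lipschitz:
  assumes "1 \<le> i" "i \<le> N" "s \<in> {0..T}" "t \<in> {0..T}"
  shows "norm (X N i s - X N i t) \<le> speed_bound * \<bar>s - t\<bar>"
proof (rule caratheodory_lipschitz[OF X_caratheodory[OF assms(1,2)] _ speed_nonneg assms(4,3)])
  have N: "1 \<le> N" using assms by simp
  show "AE t in lebesgue_on {0..T}. norm (velocity H G (u N t) (Y N t) (emp N t) (X N i t)) \<le> speed_bound"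
    using AE_time u_bound[OF N]
  proof eventually_elim
    case (elim t)
    then show ?case using assms N by (intro velocity_bound X_ball Y_ball emp_prob)
  qed
qed

definition "nearest N y = arg_min_on (\<lambda>i. norm (X0 N i - y)) {1..N}"

lemma nearest:
  assumes "1 \<le> N"
  shows "1 \<le> nearest N y" "nearest N y \<le> N"
    "\<And>i. \<lbrakk>1 \<le> i; i \<le> N\<rbrakk> \<Longrightarrow> norm (X0 N (nearest N y) - y) \<le> norm (X0 N i - y)"
proof -
  have *: "finite {1..N}" "{1..N} \<noteq> {}" using assms by auto
  from arg_min_if_finite[OF *, of "\<lambda>i. norm (X0 N i - y)"]
  show "1 \<le> nearest N y" "nearest N y \<le> N"
    "\<And>i. \<lbrakk>1 \<le> i; i \<le> N\<rbrakk> \<Longrightarrow> norm (X0 N (nearest N y) - y) \<le> norm (X0 N i - y)"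
    unfolding nearest_def by (auto simp: not_less)
qed

text \<open>A tent function at \<open>y\<close> has positive integral over \<open>\<mu>0\<close>, hence eventually over the initial empirical
  measures; so some atom lies below the tent.\<close>

lemma nearest_tendsto:
  assumes y: "y \<in> supp \<mu>0"
  shows "(\<lambda>N. X0 N (nearest N y)) \<longlonglongrightarrow> y"
proof (rule tendstoI)
  fix e :: real assume "e > 0"
  define f where "f x = max 0 (e - dist x y)" for x
  have f_lip: "1-lipschitz_on S f" for S
  proof (rule lipschitz_onI)
    fix a c show "dist (f a) (f c) \<le> 1 * dist a c"
      using dist_triangle[of a y c] dist_triangle[of c y a] by (simp add: f_def dist_real_def dist_commute)
  qed simp
  have f_meas: "f \<in> borel_measurable borel"
    unfolding f_def by measurable
  have "bounded (f ` cball 0 \<rho>)"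
    using lipschitz_on_uniformly_continuous[OF f_lip] bounded_cball by (rule bounded_uniformly_continuous_image)
  then have f_int: "integrable \<mu>0 f" by (rule integrable_prob_on[OF \<mu>0 f_meas])
  have "0 < (\<integral>x. f x \<partial>\<mu>0)"
  proof (rule ccontr)
    assume "\<not> 0 < (\<integral>x. f x \<partial>\<mu>0)"
    moreover have f0: "0 \<le> f x" for x by (simp add: f_def)
    then have "0 \<le> (\<integral>x. f x \<partial>\<mu>0)" by (intro integral_nonneg_AE) simp
    ultimately have "(\<integral>x. f x \<partial>\<mu>0) = 0" by linarith
    then have "AE x in \<mu>0. f x = 0"
      using integral_nonneg_eq_0_iff_AE[OF f_int] f0 by simp
    then have "AE x in \<mu>0. x \<notin> ball y e"
      by eventually_elim (auto simp: f_def dist_commute)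
    then have "ball y e \<in> null_sets \<mu>0"
      using prob_onD(2)[OF \<mu>0] by (subst AE_iff_null_sets) auto
    then have "emeasure \<mu>0 (ball y e) = 0" by (rule null_setsD1)
    moreover have "emeasure \<mu>0 (ball y e) > 0" using y \<open>e > 0\<close> by (auto simp: supp_def)
    ultimately show False by simp
  qed
  then have "\<forall>\<^sub>F N in sequentially. init_dist N < (\<integral>x. f x \<partial>\<mu>0)"
    by (rule order_tendstoD(2)[OF init_dist_lim])
  moreover have "\<forall>\<^sub>F N in sequentially. 1 \<le> N" by (rule eventually_ge_at_top)
  ultimately show "\<forall>\<^sub>F N in sequentially. dist (X0 N (nearest N y)) y < e"
  proof eventually_elim
    case (elim N)
    have "norm ((\<integral>x. f x \<partial>empirical N (X0 N)) - (\<integral>x. f x \<partial>\<mu>0)) \<le> 1 * init_dist N"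
      unfolding init_dist_def by (rule integral_diff_le_W1[OF emp0_prob[OF elim(2)] \<mu>0 bounded_cball f_meas f_lip])
    then have pos: "0 < (\<integral>x. f x \<partial>empirical N (X0 N))" using elim by (simp add: abs_le_iff)
    have "\<exists>i\<in>{1..N}. 0 < f (X0 N i)"
    proof (rule ccontr)
      assume "\<not> (\<exists>i\<in>{1..N}. 0 < f (X0 N i))"
      then have "(\<Sum>i=1..N. f (X0 N i)) \<le> 0" by (intro sum_nonpos) (force simp: not_less)
      then have "(1 / real N) * (\<Sum>i=1..N. f (X0 N i)) \<le> 0"
        by (intro mult_nonneg_nonpos) auto
      then show False using pos by (simp add: integral_empirical[OF f_meas])
    qed
    then obtain i where "1 \<le> i" "i \<le> N" "norm (X0 N i - y) < e"
      by (auto simp: f_def dist_norm)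
    then show ?case using nearest(3)[OF elim(2), of i y] by (simp add: dist_norm)
  qed
qed

definition "Phi t y = lim (\<lambda>N. X N (nearest N y) t)"

lemma Phi_tendsto:
  assumes y: "y \<in> supp \<mu>0" and t: "t \<in> {0..T}"
  shows "(\<lambda>N. X N (nearest N y) t) \<longlonglongrightarrow> Phi t y"
  unfolding Phi_def
proof (rule tendsto_lim_rate)
  let ?e = "\<lambda>N. stability_const * (norm (X0 N (nearest N y) - y) + data_error N)"
  fix n k :: nat assume nk: "1 \<le> n" "1 \<le> k"
  have "norm (X n (nearest n y) t - X k (nearest k y) t)
      \<le> stability_const * (norm (X0 n (nearest n y) - X0 k (nearest k y)) + data_error n + data_error k)"
    using nearest nk t by (intro particle_stability)
  also have "\<dots> \<le> stability_const * ((norm (X0 n (nearest n y) - y) + norm (X0 k (nearest k y) - y)) + data_error n + data_error k)"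
    using stability_const_pos norm_triangle_ineq4[of "X0 n (nearest n y) - y" "X0 k (nearest k y) - y"]
    by (intro mult_left_mono add_right_mono) auto
  finally show "norm (X n (nearest n y) t - X k (nearest k y) t) \<le> ?e n + ?e k"
    by (simp add: algebra_simps)
next
  have "(\<lambda>N. norm (X0 N (nearest N y) - y)) \<longlonglongrightarrow> 0"
    using nearest_tendsto[OF y] by (intro tendsto_norm_zero LIM_zero)
  then show "(\<lambda>N. stability_const * (norm (X0 N (nearest N y) - y) + data_error N)) \<longlonglongrightarrow> 0"
    using data_error_lim by (intro tendsto_mult_right_zero tendsto_add_zero)
qed

text \<open>The limit \<open>K \<rightarrow> \<infinity>\<close> of the stability estimate.\<close>

lemma Phi_gap:
  assumes y: "y \<in> supp \<mu>0" and t: "t \<in> {0..T}" and i: "1 \<le> i" "i \<le> N"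
  shows "norm (X N i t - Phi t y) \<le> stability_const * (norm (X0 N i - y) + data_error N)"
proof (rule LIMSEQ_le)
  show "(\<lambda>K. norm (X N i t - X K (nearest K y) t)) \<longlonglongrightarrow> norm (X N i t - Phi t y)"
    using Phi_tendsto[OF y t] by (intro tendsto_intros)
  show "(\<lambda>K. stability_const * (norm (X0 N i - X0 K (nearest K y)) + data_error N + data_error K)) \<longlonglongrightarrow> stability_const * (norm (X0 N i - y) + data_error N)"
    using nearest_tendsto[OF y] data_error_lim by (auto intro!: tendsto_eq_intros)
  show "\<exists>k. \<forall>n\<ge>k. norm (X N i t - X n (nearest n y) t) \<le> stability_const * (norm (X0 N i - X0 n (nearest n y)) + data_error N + data_error n)"
    using particle_stability[OF i nearest(1,2) t] by blast
qed

lemma Phi_lipschitz: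
  assumes t: "t \<in> {0..T}"
  shows "stability_const-lipschitz_on (supp \<mu>0) (Phi t)"
proof (rule lipschitz_onI)
  fix y z assume y: "y \<in> supp \<mu>0" and z: "z \<in> supp \<mu>0"
  have "norm (Phi t y - Phi t z) \<le> stability_const * norm (y - z)"
  proof (rule LIMSEQ_le)
    show "(\<lambda>N. norm (X N (nearest N y) t - X N (nearest N z) t)) \<longlonglongrightarrow> norm (Phi t y - Phi t z)"
      using Phi_tendsto y z t by (intro tendsto_intros)
    show "(\<lambda>N. stability_const * (norm (X0 N (nearest N y) - X0 N (nearest N z)) + data_error N + data_error N)) \<longlonglongrightarrow> stability_const * norm (y - z)"
      using nearest_tendsto[OF y] nearest_tendsto[OF z] data_error_lim by (auto intro!: tendsto_eq_intros)
    show "\<exists>N. \<forall>n\<ge>N. norm (X n (nearest n y) t - X n (nearest n z) t)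
        \<le> stability_const * (norm (X0 n (nearest n y) - X0 n (nearest n z)) + data_error n + data_error n)"
      using particle_stability[OF nearest(1,2) nearest(1,2) t] by blast
  qed
  then show "dist (Phi t y) (Phi t z) \<le> stability_const * dist y z" by (simp add: dist_norm)
qed (use stability_const_pos in simp)

lemma Phi_ball:
  assumes y: "y \<in> supp \<mu>0" and t: "t \<in> {0..T}"
  shows "norm (Phi t y) \<le> \<rho>"
proof (rule LIMSEQ_le_const2)
  show "(\<lambda>N. norm (X N (nearest N y) t)) \<longlonglongrightarrow> norm (Phi t y)"
    using Phi_tendsto[OF y t] by (intro tendsto_intros)
  show "\<exists>N. \<forall>n\<ge>N. norm (X n (nearest n y) t) \<le> \<rho>"
    using X_ball[OF nearest(1,2) t] by blast
qed

lemma Phi_time_lipschitz: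
  assumes y: "y \<in> supp \<mu>0" and st: "s \<in> {0..T}" "t \<in> {0..T}"
  shows "norm (Phi s y - Phi t y) \<le> speed_bound * \<bar>s - t\<bar>"
proof (rule LIMSEQ_le_const2)
  show "(\<lambda>N. norm (X N (nearest N y) s - X N (nearest N y) t)) \<longlonglongrightarrow> norm (Phi s y - Phi t y)"
    using Phi_tendsto y st by (intro tendsto_intros)
  show "\<exists>N. \<forall>n\<ge>N. norm (X n (nearest n y) s - X n (nearest n y) t) \<le> speed_bound * \<bar>s - t\<bar>"
    using X_time_lipschitz[OF nearest(1,2) st] by blast
qed

lemma Phi_init:
  assumes y: "y \<in> supp \<mu>0"
  shows "Phi 0 y = y"
proof (rule LIMSEQ_unique)
  show "(\<lambda>N. X N (nearest N y) 0) \<longlonglongrightarrow> Phi 0 y" using Phi_tendsto[OF y] T by simp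
  show "(\<lambda>N. X N (nearest N y) 0) \<longlonglongrightarrow> y"
  proof (rule Lim_transform_eventually[OF nearest_tendsto[OF y]])
    show "\<forall>\<^sub>F N in sequentially. X0 N (nearest N y) = X N (nearest N y) 0"
      using eventually_ge_at_top[of 1] 
    proof eventually_elim
      case (elim N)
      show ?case using X_init[OF nearest(1)[OF elim] nearest(2)[OF elim]] by simp
    qed
  qed
qed

text \<open>The limit \<open>Phi t y\<close> is meaningful on the support of \<open>\<mu>0\<close> only; the extension by \<open>0\<close> is Borel
  measurable.\<close>

definition "flow t y = indicator (supp \<mu>0) y *\<^sub>R Phi t y"

lemma flow_eq: "y \<in> supp \<mu>0 \<Longrightarrow> flow t y = Phi t y"
  by (simp add: flow_def)

lemma AE_supp_\<mu>0: "AE y in \<mu>0. y \<in> supp \<mu>0"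
  by (rule AE_supp[OF prob_onD(2)[OF \<mu>0]])

lemma borel_measurable_flow:
  assumes "t \<in> {0..T}"
  shows "flow t \<in> borel_measurable borel"
  unfolding flow_def
  by (rule borel_measurable_continuous_on_indicator)
    (use borel_closed[OF closed_supp] lipschitz_on_continuous_on[OF Phi_lipschitz[OF assms]] in auto)

lemma flow_measurable:
  assumes "t \<in> {0..T}"
  shows "flow t \<in> borel_measurable \<mu>0"
  using borel_measurable_flow[OF assms] measurable_cong_sets[OF prob_onD(2)[OF \<mu>0] refl] by blast

definition "mus t = distr \<mu>0 borel (flow t)"

lemma mus_prob:
  assumes t: "t \<in> {0..T}"
  shows "mus t \<in> prob_on (cball 0 \<rho>)"
proof -
  interpret prob_space \<mu>0 by (rule prob_onD(1)[OF \<mu>0])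
  have "AE y in \<mu>0. flow t y \<in> cball 0 \<rho>"
    using AE_supp_\<mu>0
  proof eventually_elim
    case (elim y)
    then show ?case using Phi_ball[OF elim t] by (simp add: flow_eq)
  qed
  then have "AE x in mus t. x \<in> cball 0 \<rho>"
    unfolding mus_def using flow_measurable[OF t] by (subst AE_distr_iff) auto
  moreover have "prob_space (mus t)" "sets (mus t) = sets borel"
    using prob_space_distr[OF flow_measurable[OF t]] by (simp_all add: mus_def)
  ultimately show ?thesis by (simp add: prob_on_def)
qed

lemma mus_init: "mus 0 = \<mu>0"
proof -
  have "mus 0 = distr \<mu>0 borel (\<lambda>x. x)"
    unfolding mus_def
  proof (rule distr_cong_AE)
    show "AE x in \<mu>0. flow 0 x = x"
      using AE_supp_\<mu>0 by eventually_elim (simp add: flow_eq Phi_init)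
    show "flow 0 \<in> borel_measurable \<mu>0" using flow_measurable T by simp
    show "(\<lambda>x. x) \<in> borel_measurable \<mu>0"
      by (rule measurable_ident_sets[OF prob_onD(2)[OF \<mu>0]])
  qed auto
  also have "\<dots> = \<mu>0" by (rule distr_id2[OF prob_onD(2)[OF \<mu>0, symmetric]])
  finally show ?thesis .
qed

lemma emp_time_lipschitz:
  assumes "1 \<le> N" "s \<in> {0..T}" "t \<in> {0..T}"
  shows "W1 (emp N s) (emp N t) \<le> speed_bound * \<bar>s - t\<bar>"
proof -
  have "W1 (emp N s) (emp N t) \<le> (\<integral>i. dist (X N i s) (X N i t) \<partial>uniform_count_measure {1..N})"
    unfolding empirical_def by (rule W1_distr_le) auto
  also have "\<dots> = (1 / real (card {1..N})) *\<^sub>R (\<Sum>i=1..N. dist (X N i s) (X N i t))"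
    by (subst integral_uniform_count_indices) simp
  also have "\<dots> \<le> norm \<dots>" unfolding real_norm_def by (rule abs_ge_self)
  also have "\<dots> \<le> speed_bound * \<bar>s - t\<bar>"
    by (rule norm_average_le) (use assms X_time_lipschitz in \<open>auto simp: dist_norm\<close>)
  finally show ?thesis .
qed

lemma mus_time_lipschitz:
  assumes st: "s \<in> {0..T}" "t \<in> {0..T}"
  shows "W1 (mus s) (mus t) \<le> speed_bound * \<bar>s - t\<bar>"
proof -
  interpret prob_space \<mu>0 by (rule prob_onD(1)[OF \<mu>0])
  have "W1 (mus s) (mus t) \<le> (\<integral>y. dist (flow s y) (flow t y) \<partial>\<mu>0)"
    unfolding mus_def by (rule W1_distr_le[OF flow_measurable[OF st(1)] flow_measurable[OF st(2)]])
  also have "\<dots> \<le> (\<integral>y. speed_bound * \<bar>s - t\<bar> \<partial>\<mu>0)"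
  proof (rule integral_mono_AE')
    show "AE y in \<mu>0. dist (flow s y) (flow t y) \<le> speed_bound * \<bar>s - t\<bar>"
      using AE_supp_\<mu>0
    proof eventually_elim
      case (elim y)
      then show ?case using Phi_time_lipschitz[OF elim st] by (simp add: flow_eq dist_norm)
    qed
  qed (use speed_nonneg in auto)
  finally show ?thesis by (simp add: prob_space)
qed

text \<open>A nearly optimal coupling of the initial measures is a measure on pairs of initial positions.
  Moving the first component with the particles and the second with the limit flow gives a
  coupling at time \<open>t\<close>, and \<open>Phi_gap\<close> bounds its cost by that of the initial coupling.\<close>

theorem emp_to_mus:
  assumes N: "1 \<le> N" and t: "t \<in> {0..T}"
  shows "W1 (emp N t) (mus t) \<le> stability_const * (init_dist N + data_error N)"
proof -
  \<comment> \<open>Several particles may start at the same point. \<open>J\<close> selects one of them; by \<open>same_system_gap\<close> they move together.\<close>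
  define J where "J x = (LEAST i. 1 \<le> i \<and> X0 N i = x)" for x
  have J: "1 \<le> J (X0 N i) \<and> J (X0 N i) \<le> i \<and> X0 N (J (X0 N i)) = X0 N i" if "1 \<le> i" for i
    unfolding J_def using that LeastI[of "\<lambda>j. 1 \<le> j \<and> X0 N j = X0 N i" i]
      Least_le[of "\<lambda>j. 1 \<le> j \<and> X0 N j = X0 N i" i] by auto
  have XJ: "X N (J (X0 N i)) t = X N i t" if "1 \<le> i" "i \<le> N" for i
    using same_system_gap[of "J (X0 N i)" N i t] J[OF that(1)] that t by simp
  define f where "f x = X N (J x) t" for x
  have "J \<in> measurable borel (count_space UNIV)"
    unfolding J_def by measurable
  then have f_meas: "f \<in> borel_measurable borel"
    unfolding f_def by (rule measurable_compose) simp
  have emp_distr: "distr (empirical N (X0 N)) borel f = emp N t"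
    unfolding empirical_def
    by (subst distr_distr) (auto simp: f_meas f_def XJ space_uniform_count_measure intro!: distr_cong)
  have *: "W1 (emp N t) (mus t) \<le> stability_const * (init_dist N + e + data_error N)" if "e > 0" for e
  proof -
    obtain \<pi> where \<pi>: "\<pi> \<in> couplings (empirical N (X0 N)) \<mu>0"
      and cost: "(\<integral>p. dist (fst p) (snd p) \<partial>\<pi>) < init_dist N + e"
      using near_optimal_coupling[OF emp0_prob[OF N] \<mu>0 \<open>e > 0\<close>] unfolding init_dist_def by metis
    note c = couplingD[OF \<pi>]
    note [measurable] = c(4,5) f_meas borel_measurable_flow[OF t]
    interpret prob_space \<pi> by (rule coupling_prob_space[OF \<pi> prob_onD(1)[OF emp0_prob[OF N]]])
    have atoms: "empirical N (X0 N) \<in> prob_on (X0 N ` {1..N})"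
      using N by (intro empirical_prob_on) (auto intro!: borel_closed finite_imp_closed)
    have AEp: "AE p in \<pi>. fst p \<in> X0 N ` {1..N} \<and> snd p \<in> supp \<mu>0"
      by (rule AE_coupling[OF \<pi> prob_onD(3)[OF atoms] AE_supp_\<mu>0])
    have AEb: "AE p in \<pi>. fst p \<in> cball 0 \<rho> \<and> snd p \<in> cball 0 \<rho>"
      by (rule AE_coupling[OF \<pi> prob_onD(3)[OF emp0_prob[OF N]] prob_onD(3)[OF \<mu>0]])
    have Id: "integrable \<pi> (\<lambda>p. dist (fst p) (snd p))"
    proof (rule integrable_const_bound[of _ "2 * \<rho>"])
      show "AE p in \<pi>. norm (dist (fst p) (snd p)) \<le> 2 * \<rho>"
        using AEb
      proof eventually_elim
        case (elim p)
        then show ?case using norm_triangle_ineq4[of "fst p" "snd p"] by (simp add: dist_norm)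
      qed
    qed measurable
    have "emp N t = distr \<pi> borel (\<lambda>p. f (fst p))"
      using distr_distr[OF f_meas c(4)] by (simp add: c(2) emp_distr comp_def)
    moreover have "mus t = distr \<pi> borel (\<lambda>p. flow t (snd p))"
      using distr_distr[OF borel_measurable_flow[OF t] c(5)] by (simp add: c(3) mus_def comp_def)
    ultimately have "W1 (emp N t) (mus t) \<le> (\<integral>p. dist (f (fst p)) (flow t (snd p)) \<partial>\<pi>)"
      by (simp only:) (rule W1_distr_le; measurable)
    also have "\<dots> \<le> (\<integral>p. stability_const * (dist (fst p) (snd p) + data_error N) \<partial>\<pi>)"
    proof (rule integral_mono_AE')
      show "AE p in \<pi>. dist (f (fst p)) (flow t (snd p)) \<le> stability_const * (dist (fst p) (snd p) + data_error N)"
        using AEp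
      proof eventually_elim
        case (elim p)
        then obtain i where i: "1 \<le> i" "i \<le> N" "fst p = X0 N i" by auto
        then show ?case
          using Phi_gap[OF _ t i(1,2), of "snd p"] elim XJ[OF i(1,2)] by (simp add: f_def flow_eq dist_norm)
      qed
      show "integrable \<pi> (\<lambda>p. stability_const * (dist (fst p) (snd p) + data_error N))" using Id by simp
    qed (use stability_const_pos data_error_nonneg[OF N] in auto)
    also have "\<dots> = stability_const * ((\<integral>p. dist (fst p) (snd p) \<partial>\<pi>) + data_error N)"
      using Id by (simp add: prob_space)
    also have "\<dots> \<le> stability_const * (init_dist N + e + data_error N)"
      using cost stability_const_pos by (intro mult_left_mono) auto
    finally show ?thesis .
  qed
  show ?thesis
  proof (rule field_le_epsilon)
    fix e :: real assume "e > 0"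
    then show "W1 (emp N t) (mus t) \<le> stability_const * (init_dist N + data_error N) + e"
      using *[of "e / stability_const"] stability_const_pos by (simp add: algebra_simps)
  qed
qed

lemma chi_dist_to_limit:
  assumes "1 \<le> N" "t \<in> {0..T}"
  shows "chi_dist (Y N t, emp N t) (Ys t, mus t) \<le> mT * \<eta> N + stability_const * (init_dist N + data_error N)"
proof -
  have "mean_dist (Y N t) (Ys t) \<le> mT * \<eta> N"
  proof (rule mean_dist_le)
    show "norm (Y N t $ k - Ys t $ k) \<le> mT * \<eta> N" for k
      using norm_component_le[of "Y N t - Ys t" k] Ys_gap[OF assms] by simp
  qed
  then show ?thesis using emp_to_mus[OF assms] by (simp add: chi_dist_def)
qed

lemma Ys_mus_in_C0_chi: "(\<lambda>t. (Ys t, mus t)) \<in> C0_chi T"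
proof (rule C0_chi_lipschitzI[OF mus_prob])
  show "chi_dist (Ys s, mus s) (Ys t, mus t) \<le> (M + speed_bound) * \<bar>s - t\<bar>" if "s \<in> {0..T}" "t \<in> {0..T}" for s t
    using Ys_time_lipschitz[OF that] mus_time_lipschitz[OF that] by (simp add: chi_dist_def distrib_right)
qed

theorem converges_to_limit:
  "C0_chi_converges T (\<lambda>N t. (Y N t, emp N t)) (\<lambda>t. (Ys t, mus t))"
  unfolding C0_chi_converges_def
proof (intro conjI allI impI Ys_mus_in_C0_chi)
  fix N :: nat assume N: "1 \<le> N"
  show "(\<lambda>t. (Y N t, emp N t)) \<in> C0_chi T"
  proof (rule C0_chi_lipschitzI[OF emp_prob[OF N]])
    show "chi_dist (Y N s, emp N s) (Y N t, emp N t) \<le> (M + speed_bound) * \<bar>s - t\<bar>"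
      if "s \<in> {0..T}" "t \<in> {0..T}" for s t
      using Y_time_lipschitz[OF N that] emp_time_lipschitz[OF N that] by (simp add: chi_dist_def distrib_right)
  qed
next
  fix e :: real assume "e > 0"
  have "(\<lambda>N. mT * \<eta> N + stability_const * (init_dist N + data_error N)) \<longlonglongrightarrow> 0"
    using \<eta>_lim init_dist_lim data_error_lim by (auto intro!: tendsto_eq_intros)
  then have "\<forall>\<^sub>F N in sequentially. mT * \<eta> N + stability_const * (init_dist N + data_error N) < e"
    using \<open>e > 0\<close> by (rule order_tendstoD(2))
  then show "\<forall>\<^sub>F N in sequentially. \<forall>t\<in>{0..T}. chi_dist (Y N t, emp N t) (Ys t, mus t) < e"
    using eventually_ge_at_top[of 1]
  proof eventually_elim
    case (elim N)
    show ?case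
    proof
      fix t assume "t \<in> {0..T}"
      from chi_dist_to_limit[OF elim(2) this] elim(1)
      show "chi_dist (Y N t, emp N t) (Ys t, mus t) < e" by linarith
    qed
  qed
qed

end

section \<open>Test functions and measurability of velocity fields\<close>

lemma Ck_function_SucD: "Ck_function (Suc k) f \<Longrightarrow> Ck_function k f"
proof (induction k arbitrary: f)
  case 0
  then show ?case
    by (simp add: continuous_at_imp_continuous_on differentiable_imp_continuous_within)
next
  case (Suc k)
  then have "\<forall>x. f differentiable (at x)"
    and *: "Ck_function (Suc k) (\<lambda>x. frechet_derivative f (at x) v)" for v
    unfolding Ck_function.simps(2)[of "Suc k" f] by blast+
  then show ?case using Suc.IH[OF *] by simp
qed

text \<open>Directional derivatives that are continuous for each fixed direction are bounded on the ball, and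
  finitely many of them bound the operator norm of the derivative.\<close>

lemma C1_lipschitz_on_ball:
  fixes f :: "'a::euclidean_space \<Rightarrow> real"
  assumes "Ck_function (Suc 0) f"
  obtains L where "L-lipschitz_on (cball 0 r) f"
proof -
  define D where "D x = frechet_derivative f (at x)" for x
  have der: "(f has_derivative D x) (at x)" for x
    using assms by (auto simp: D_def frechet_derivative_works[symmetric])
  have "\<exists>c. \<forall>x\<in>cball 0 r. \<bar>D x i\<bar> \<le> c" for i
  proof -
    have "continuous_on (cball 0 r) (\<lambda>x. D x i)"
      using assms by (auto simp: D_def intro: continuous_on_subset)
    then have "bounded ((\<lambda>x. D x i) ` cball 0 r)"
      by (intro compact_imp_bounded compact_continuous_image) auto
    then show ?thesis by (auto simp: bounded_iff)
  qed
  then obtain c where c: "\<And>x i. x \<in> cball 0 r \<Longrightarrow> \<bar>D x i\<bar> \<le> c i" by metis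
  define L where "L = (\<Sum>i\<in>Basis. \<bar>c i\<bar>)"
  have "onorm (D x) \<le> L" if x: "x \<in> cball 0 r" for x
  proof (rule onorm_le)
    fix v :: 'a
    interpret bounded_linear "D x" using der by (rule has_derivative_bounded_linear)
    have "D x v = D x (\<Sum>i\<in>Basis. (v \<bullet> i) *\<^sub>R i)" by (simp add: euclidean_representation)
    also have "\<dots> = (\<Sum>i\<in>Basis. (v \<bullet> i) * D x i)" by (simp add: sum scaleR)
    finally have eq: "D x v = (\<Sum>i\<in>Basis. (v \<bullet> i) * D x i)" .
    have "norm (D x v) \<le> (\<Sum>i\<in>Basis. \<bar>v \<bullet> i\<bar> * \<bar>D x i\<bar>)"
      unfolding eq real_norm_def abs_mult[symmetric] by (rule sum_abs)
    also have "\<dots> \<le> (\<Sum>i\<in>Basis. norm v * \<bar>c i\<bar>)"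
    proof (intro sum_mono mult_mono)
      show "\<bar>v \<bullet> i\<bar> \<le> norm v" if "i \<in> Basis" for i using that by (rule Basis_le_norm)
      show "\<bar>D x i\<bar> \<le> \<bar>c i\<bar>" for i using c[OF x, of i] by linarith
    qed auto
    finally show "norm (D x v) \<le> L * norm v" by (simp add: L_def sum_distrib_left mult.commute)
  qed
  then have bd: "norm (f x - f y) \<le> L * norm (x - y)" if "x \<in> cball 0 r" "y \<in> cball 0 r" for x y
    by (intro differentiable_bound[of "cball 0 r" f D])
      (use der that in \<open>auto intro: has_derivative_at_withinI\<close>)
  have "L-lipschitz_on (cball 0 r) f"
  proof (rule lipschitz_onI)
    fix x y :: 'a assume "x \<in> cball 0 r" "y \<in> cball 0 r"
    from bd[OF this] show "dist (f x) (f y) \<le> L * dist x y" by (simp add: dist_norm)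
  qed (simp add: L_def sum_nonneg)
  then show thesis by (rule that)
qed

lemma has_derivative_grad:
  fixes \<phi> :: "real^'d \<Rightarrow> real"
  assumes "\<phi> differentiable (at x)"
  shows "(\<phi> has_derivative (\<lambda>v. grad \<phi> x \<bullet> v)) (at x)"
proof -
  let ?D = "frechet_derivative \<phi> (at x)"
  have D: "(\<phi> has_derivative ?D) (at x)" using assms by (simp add: frechet_derivative_works)
  interpret bounded_linear ?D using D by (rule has_derivative_bounded_linear)
  have "?D v = grad \<phi> x \<bullet> v" for v
  proof -
    have "?D v = ?D (\<Sum>i\<in>UNIV. v $ i *\<^sub>R axis i 1)"
      using basis_expansion[of v] by (simp add: scalar_mult_eq_scaleR)
    also have "\<dots> = (\<Sum>i\<in>UNIV. v $ i * ?D (axis i 1))" by (simp add: sum scaleR)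
    finally show ?thesis by (simp add: grad_def inner_vec_def mult.commute)
  qed
  then have "?D = (\<lambda>v. grad \<phi> x \<bullet> v)" by auto
  then show ?thesis using D by simp
qed

lemma grad_lipschitz_on_ball:
  fixes \<phi> :: "real^'d \<Rightarrow> real"
  assumes "Ck_function (Suc (Suc 0)) \<phi>"
  obtains L where "L-lipschitz_on (cball 0 r) (grad \<phi>)"
proof -
  have "\<exists>L. L-lipschitz_on (cball 0 r) (\<lambda>x. grad \<phi> x $ i)" for i
  proof -
    have "Ck_function (Suc 0) (\<lambda>x. grad \<phi> x $ i)"
      using assms by (simp add: grad_def)
    then show ?thesis by (metis C1_lipschitz_on_ball)
  qed
  then obtain L where L: "\<And>i. (L i)-lipschitz_on (cball 0 r) (\<lambda>x. grad \<phi> x $ i)" by metis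
  have "(\<Sum>i\<in>UNIV. L i)-lipschitz_on (cball 0 r) (grad \<phi>)"
  proof (rule lipschitz_onI)
    fix x y :: "real^'d" assume xy: "x \<in> cball 0 r" "y \<in> cball 0 r"
    have "norm (grad \<phi> x - grad \<phi> y) \<le> (\<Sum>i\<in>UNIV. \<bar>(grad \<phi> x - grad \<phi> y) $ i\<bar>)"
      by (rule norm_le_l1_cart)
    also have "\<dots> \<le> (\<Sum>i\<in>UNIV. L i * dist x y)"
    proof (rule sum_mono)
      fix i
      show "\<bar>(grad \<phi> x - grad \<phi> y) $ i\<bar> \<le> L i * dist x y"
        using lipschitz_onD[OF L[of i] xy] by (simp add: dist_real_def)
    qed
    finally show "dist (grad \<phi> x) (grad \<phi> y) \<le> (\<Sum>i\<in>UNIV. L i) * dist x y"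
      by (simp add: dist_norm sum_distrib_right)
  qed (use lipschitz_on_nonneg[OF L] in \<open>auto intro: sum_nonneg\<close>)
  then show thesis by (rule that)
qed

lemma continuous_grad:
  fixes \<phi> :: "real^'d \<Rightarrow> real"
  assumes "Ck_function (Suc 0) \<phi>"
  shows "continuous_on UNIV (grad \<phi>)"
  unfolding grad_def using assms by (intro continuous_on_vec_lambda) simp

lemma borel_measurable_conv:
  fixes H :: "'a::euclidean_space \<Rightarrow> 'b::euclidean_space"
  assumes "continuous_on UNIV H" "\<mu> \<in> prob_on S"
  shows "conv H \<mu> \<in> borel_measurable borel"
proof -
  interpret prob_space \<mu> using assms(2) by (rule prob_onD)
  have [measurable]: "H \<in> borel_measurable borel" using assms(1) by (rule borel_measurable_continuous_onI)
  have "(\<lambda>p. H (fst p - snd p)) \<in> borel_measurable (borel \<Otimes>\<^sub>M borel)" by measurable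
  moreover have "sets (borel \<Otimes>\<^sub>M \<mu>) = sets (borel \<Otimes>\<^sub>M borel)"
    using prob_onD(2)[OF assms(2)] by (intro sets_pair_measure_cong) auto
  ultimately have "(\<lambda>p. H (fst p - snd p)) \<in> borel_measurable (borel \<Otimes>\<^sub>M \<mu>)"
    using measurable_cong_sets by blast
  then show ?thesis
    unfolding conv_def by (intro borel_measurable_lebesgue_integral) (simp add: case_prod_beta')
qed

lemma continuous_control_field:
  fixes G :: "'d::finite \<Rightarrow> real^'d \<Rightarrow> real^'d" and v y :: "real^'d^'m"
  assumes "\<And>l. continuous_on UNIV (G l)"
  shows "continuous_on UNIV (control_field G v y)"
proof -
  have "continuous_on UNIV (\<lambda>x. G l (x - y $ k))" for l k
    by (intro continuous_on_compose2[OF assms] continuous_intros) auto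
  then show ?thesis
    unfolding control_field_def conv_atoms_def by (intro continuous_intros)
qed

section \<open>The weak equation for the limit\<close>

context confined_systems
begin

lemma emp_weak_equation:
  assumes \<phi>: "Ck_function (Suc (Suc 0)) \<phi>" and N: "1 \<le> N"
  shows "caratheodory T (\<lambda>t. \<integral>x. \<phi> x \<partial>emp N t)
    (\<lambda>t. (1 / real N) *\<^sub>R (\<Sum>i=1..N. grad \<phi> (X N i t) \<bullet> velocity H G (u N t) (Y N t) (emp N t) (X N i t)))"
proof -
  obtain L where L: "L-lipschitz_on (cball 0 \<rho>) \<phi>"
    using C1_lipschitz_on_ball[OF Ck_function_SucD[OF \<phi>]] by metis
  have dif: "\<phi> differentiable (at x)" for x using \<phi> by simp
  then have "continuous_on UNIV \<phi>"
    by (simp add: continuous_at_imp_continuous_on differentiable_imp_continuous_within)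
  then have eq: "(\<integral>x. \<phi> x \<partial>emp N t) = (1 / real N) *\<^sub>R (\<Sum>i=1..N. \<phi> (X N i t))" for t
    by (intro integral_empirical borel_measurable_continuous_onI)
  have "abs_cont_on 0 T (\<lambda>t. (1 / real N) *\<^sub>R (\<Sum>i=1..N. \<phi> (X N i t)))"
  proof (rule abs_cont_on_lipschitz)
    fix s t assume st: "0 \<le> s" "s \<le> t" "t \<le> T"
    have "norm ((1 / real (card {1..N})) *\<^sub>R (\<Sum>i=1..N. \<phi> (X N i s) - \<phi> (X N i t))) \<le> L * speed_bound * (t - s)"
    proof (rule norm_average_le)
      fix i assume i: "i \<in> {1..N}"
      have "dist (\<phi> (X N i s)) (\<phi> (X N i t)) \<le> L * dist (X N i s) (X N i t)"
        using i st X_ball by (intro lipschitz_onD[OF L]) auto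
      also have "\<dots> \<le> L * (speed_bound * (t - s))"
        using X_time_lipschitz[of i N s t] i st lipschitz_on_nonneg[OF L]
        by (intro mult_left_mono) (auto simp: dist_norm)
      finally show "norm (\<phi> (X N i s) - \<phi> (X N i t)) \<le> L * speed_bound * (t - s)"
        by (simp add: dist_norm mult.assoc)
    qed (use N in auto)
    then show "dist ((1 / real N) *\<^sub>R (\<Sum>i=1..N. \<phi> (X N i s))) ((1 / real N) *\<^sub>R (\<Sum>i=1..N. \<phi> (X N i t)))
        \<le> L * speed_bound * (t - s)"
      unfolding dist_norm scaleR_diff_right[symmetric] sum_subtractf[symmetric] by simp
  qed
  moreover have "AE t in lebesgue_on {0..T}. \<forall>i\<in>{1..N}.
      (X N i has_vector_derivative velocity H G (u N t) (Y N t) (emp N t) (X N i t)) (at t within {0..T})"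
    using X_caratheodory[of _ N] by (intro AE_finite_allI) (auto simp: caratheodory_def)
  then have "AE t in lebesgue_on {0..T}. ((\<lambda>t. (1 / real N) *\<^sub>R (\<Sum>i=1..N. \<phi> (X N i t)))
      has_vector_derivative ((1 / real N) *\<^sub>R (\<Sum>i=1..N. grad \<phi> (X N i t) \<bullet> velocity H G (u N t) (Y N t) (emp N t) (X N i t)))) (at t within {0..T})"
  proof eventually_elim
    case (elim t)
    let ?v = "\<lambda>i. velocity H G (u N t) (Y N t) (emp N t) (X N i t)"
    have "((\<lambda>t. \<phi> (X N i t)) has_vector_derivative (grad \<phi> (X N i t) \<bullet> ?v i)) (at t within {0..T})"
      if "i \<in> {1..N}" for i
    proof -
      have "(X N i has_derivative (\<lambda>h. h *\<^sub>R ?v i)) (at t within {0..T})"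
        using elim that by (simp add: has_vector_derivative_def)
      from has_derivative_compose[OF this has_derivative_grad[OF dif]]
      show ?thesis by (simp add: has_vector_derivative_def)
    qed
    then show ?case
      by (intro has_vector_derivative_sum bounded_linear.has_vector_derivative[OF bounded_linear_scaleR_right])
  qed
  ultimately show ?thesis unfolding caratheodory_def eq by simp
qed

text \<open>Both sides of the equation for \<open>emp N\<close> are integrals over \<open>emp N t\<close>. The integrand on the right
  depends on \<open>N\<close> through the velocity; its distance to the limit integrand is bounded by the
  distances of controls, agents and measures, and the limit integrand is Lipschitz on the ball, so
  that replacing the measure costs a multiple of \<open>W1\<close>.\<close>

theorem limit_weak_equation:
  assumes \<phi>: "Ck_function (Suc (Suc 0)) \<phi>"
  shows "caratheodory T (\<lambda>t. \<integral>x. \<phi> x \<partial>mus t)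
    (\<lambda>t. \<integral>x. grad \<phi> x \<bullet> velocity H G (us t) (Ys t) (mus t) x \<partial>mus t)"
proof -
  obtain L where L: "L-lipschitz_on (cball 0 \<rho>) \<phi>"
    using C1_lipschitz_on_ball[OF Ck_function_SucD[OF \<phi>]] by metis
  obtain K where K: "K-lipschitz_on (cball 0 \<rho>) (grad \<phi>)"
    using grad_lipschitz_on_ball[OF \<phi>] by metis
  have K0: "0 \<le> K" using K by (rule lipschitz_on_nonneg)
  have "bounded (grad \<phi> ` cball 0 \<rho>)"
    using lipschitz_on_uniformly_continuous[OF K] bounded_cball by (rule bounded_uniformly_continuous_image)
  then obtain B where B: "\<And>x. x \<in> cball 0 \<rho> \<Longrightarrow> norm (grad \<phi> x) \<le> B"
    unfolding bounded_iff by blast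
  have B0: "0 \<le> B" using order_trans[OF norm_ge_zero B[of 0]] \<rho> by simp
  have C1: "Ck_function (Suc 0) \<phi>" using \<phi> by (rule Ck_function_SucD)
  have "\<phi> differentiable (at x)" for x using \<phi> by simp
  then have "continuous_on UNIV \<phi>"
    by (simp add: continuous_at_imp_continuous_on differentiable_imp_continuous_within)
  then have \<phi>_meas: "\<phi> \<in> borel_measurable borel" by (rule borel_measurable_continuous_onI)
  let ?gN = "\<lambda>N t. (1 / real N) *\<^sub>R (\<Sum>i=1..N. grad \<phi> (X N i t) \<bullet> velocity H G (u N t) (Y N t) (emp N t) (X N i t))"
  let ?g = "\<lambda>t. \<integral>x. grad \<phi> x \<bullet> velocity H G (us t) (Ys t) (mus t) x \<partial>mus t"
  let ?e = "\<lambda>N. B * (b * (\<eta> N + mT * \<eta> N) + b * (stability_const * (init_dist N + data_error N))) + (K * speed_bound + 2 * B * b) * (stability_const * (init_dist N + data_error N))"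
  show ?thesis
  proof (rule caratheodory_limit[where C = "B * speed_bound" and e = ?e])
    show "caratheodory T (\<lambda>t. \<integral>x. \<phi> x \<partial>emp N t) (?gN N)" if "1 \<le> N" for N
      by (rule emp_weak_equation[OF \<phi> that])
    show "(\<lambda>N. \<integral>x. \<phi> x \<partial>emp N t) \<longlonglongrightarrow> (\<integral>x. \<phi> x \<partial>mus t)" if t: "t \<in> {0..T}" for t
    proof (rule LIM_zero_cancel, rule Lim_null_comparison)
      show "\<forall>\<^sub>F N in sequentially. norm ((\<integral>x. \<phi> x \<partial>emp N t) - (\<integral>x. \<phi> x \<partial>mus t)) \<le> L * (stability_const * (init_dist N + data_error N))"
        using eventually_ge_at_top[of 1]
      proof eventually_elim
        case (elim N)
        have "norm ((\<integral>x. \<phi> x \<partial>emp N t) - (\<integral>x. \<phi> x \<partial>mus t)) \<le> L * W1 (emp N t) (mus t)"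
          by (rule integral_diff_le_W1[OF emp_prob[OF elim t] mus_prob[OF t] bounded_cball \<phi>_meas L])
        also have "\<dots> \<le> L * (stability_const * (init_dist N + data_error N))"
          using emp_to_mus[OF elim t] lipschitz_on_nonneg[OF L] by (intro mult_left_mono)
        finally show ?case .
      qed
      show "(\<lambda>N. L * (stability_const * (init_dist N + data_error N))) \<longlonglongrightarrow> 0"
        using init_dist_lim data_error_lim by (auto intro!: tendsto_eq_intros)
    qed
    show "?e \<longlonglongrightarrow> 0"
      using init_dist_lim data_error_lim \<eta>_lim by (auto intro!: tendsto_eq_intros)
    show "0 \<le> ?e N" if "1 \<le> N" for N
      using B0 b mT_nonneg \<eta>_nonneg[of N] stability_const_pos init_dist_nonneg[OF that] data_error_nonneg[OF that] K0 speed_nonneg by simp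
    show "0 \<le> B * speed_bound" using B0 speed_nonneg by simp
    show "AE t in lebesgue_on {0..T}. norm (?gN N t) \<le> B * speed_bound" if N: "1 \<le> N" for N
      using AE_time u_bound[OF N]
    proof eventually_elim
      case (elim t)
      let ?v = "velocity H G (u N t) (Y N t) (emp N t)"
      have "norm ((1 / real (card {1..N})) *\<^sub>R (\<Sum>i=1..N. grad \<phi> (X N i t) \<bullet> ?v (X N i t))) \<le> B * speed_bound"
      proof (rule norm_average_le)
        fix i assume i: "i \<in> {1..N}"
        then have x: "norm (X N i t) \<le> \<rho>" using X_ball elim by simp
        have "norm (?v (X N i t)) \<le> speed_bound"
          using elim N x by (intro velocity_bound Y_ball emp_prob)
        then show "norm (grad \<phi> (X N i t) \<bullet> ?v (X N i t)) \<le> B * speed_bound"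
          using Cauchy_Schwarz_ineq2[of "grad \<phi> (X N i t)" "?v (X N i t)"] B[of "X N i t"] x B0
          by (auto intro: order_trans[OF _ mult_mono])
      qed (use N in auto)
      then show ?case by simp
    qed
    show "AE t in lebesgue_on {0..T}. norm (?gN N t - ?g t) \<le> ?e N" if N: "1 \<le> N" for N
      using AE_time u_bound[OF N] us_bound u_conv[OF N]
    proof eventually_elim
      case (elim t)
      note t = elim(1)
      let ?v = "velocity H G (u N t) (Y N t) (emp N t)"
      define v where "v = velocity H G (us t) (Ys t) (mus t)"
      define q where "q x = grad \<phi> x \<bullet> v x" for x
      have v_lip: "norm (v x - v y) \<le> 2 * b * norm (x - y)" if "norm x \<le> \<rho>" "norm y \<le> \<rho>" for x y
        using velocity_diff[OF elim(3,3) that Ys_ball[OF t] Ys_ball[OF t] mus_prob[OF t], where \<nu> = "mus t"]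
        by (simp add: v_def)
      have v_bound: "norm (v x) \<le> speed_bound" if "norm x \<le> \<rho>" for x
        unfolding v_def by (rule velocity_bound[OF elim(3) that Ys_ball[OF t] mus_prob[OF t]])
      have q_lip: "(K * speed_bound + 2 * B * b)-lipschitz_on (cball 0 \<rho>) q"
      proof (rule lipschitz_onI)
        fix x y :: "real^'d" assume xy: "x \<in> cball 0 \<rho>" "y \<in> cball 0 \<rho>"
        have "q x - q y = (grad \<phi> x - grad \<phi> y) \<bullet> v x + grad \<phi> y \<bullet> (v x - v y)"
          by (simp add: q_def inner_diff_left inner_diff_right)
        then have "\<bar>q x - q y\<bar> \<le> \<bar>(grad \<phi> x - grad \<phi> y) \<bullet> v x\<bar> + \<bar>grad \<phi> y \<bullet> (v x - v y)\<bar>"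
          by linarith
        moreover have "\<bar>(grad \<phi> x - grad \<phi> y) \<bullet> v x\<bar> \<le> norm (grad \<phi> x - grad \<phi> y) * norm (v x)"
          by (rule Cauchy_Schwarz_ineq2)
        moreover have "\<dots> \<le> (K * dist x y) * speed_bound"
          using lipschitz_onD[OF K xy] v_bound[of x] xy K0 by (intro mult_mono) (auto simp: dist_norm)
        moreover have "\<bar>grad \<phi> y \<bullet> (v x - v y)\<bar> \<le> norm (grad \<phi> y) * norm (v x - v y)"
          by (rule Cauchy_Schwarz_ineq2)
        moreover have "\<dots> \<le> B * (2 * b * dist x y)"
          using v_lip[of x y] B[OF xy(2)] xy B0 by (intro mult_mono) (auto simp: dist_norm)
        ultimately show "dist (q x) (q y) \<le> (K * speed_bound + 2 * B * b) * dist x y"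
          by (simp add: dist_real_def algebra_simps)
      qed (use K0 speed_nonneg B0 b in simp)
      have v_eq: "v = (\<lambda>x. conv H (mus t) x + control_field G (us t) (Ys t) x)"
        by (auto simp: v_def velocity_eq)
      have "v \<in> borel_measurable borel"
        unfolding v_eq
        by (intro borel_measurable_add borel_measurable_conv[OF H_cont mus_prob[OF t]]
            borel_measurable_continuous_onI[OF continuous_control_field[OF G_cont]])
      then have q_meas: "q \<in> borel_measurable borel"
        unfolding q_def using borel_measurable_continuous_onI[OF continuous_grad[OF C1]]
        by (intro borel_measurable_inner)
      have W: "W1 (emp N t) (mus t) \<le> stability_const * (init_dist N + data_error N)" by (rule emp_to_mus[OF N t])
      have "norm ((\<integral>x. q x \<partial>emp N t) - ?g t) \<le> (K * speed_bound + 2 * B * b) * W1 (emp N t) (mus t)"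
        using integral_diff_le_W1[OF emp_prob[OF N t] mus_prob[OF t] bounded_cball q_meas q_lip]
        by (simp add: q_def v_def)
      also have "\<dots> \<le> (K * speed_bound + 2 * B * b) * (stability_const * (init_dist N + data_error N))"
        using W K0 speed_nonneg B0 b by (intro mult_left_mono) auto
      finally have second: "norm ((\<integral>x. q x \<partial>emp N t) - ?g t) \<le> (K * speed_bound + 2 * B * b) * (stability_const * (init_dist N + data_error N))" .
      have "norm ((1 / real (card {1..N})) *\<^sub>R (\<Sum>i=1..N. grad \<phi> (X N i t) \<bullet> ?v (X N i t) - q (X N i t)))
          \<le> B * (b * (\<eta> N + mT * \<eta> N) + b * (stability_const * (init_dist N + data_error N)))"
      proof (rule norm_average_le)
        fix i assume "i \<in> {1..N}"
        then have x: "norm (X N i t) \<le> \<rho>" using X_ball t by simp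
        let ?x = "X N i t"
        have "norm (?v ?x - v ?x) \<le> b * (norm (u N t - us t) + 2 * norm (?x - ?x) + norm (Y N t - Ys t))
            + norm (conv H (emp N t) ?x - conv H (mus t) ?x)"
          unfolding v_def by (rule velocity_diff[OF elim(2,3) x x Y_ball[OF N t] Ys_ball[OF t] emp_prob[OF N t]])
        also have "\<dots> \<le> b * (\<eta> N + 2 * 0 + mT * \<eta> N) + b * (stability_const * (init_dist N + data_error N))"
        proof (intro add_mono mult_left_mono)
          have "norm (conv H (emp N t) ?x - conv H (mus t) ?x) \<le> b * W1 (emp N t) (mus t)"
            by (rule conv_diff_le_W1[OF H_cont H_lip emp_prob[OF N t] mus_prob[OF t] x])
          also have "\<dots> \<le> b * (stability_const * (init_dist N + data_error N))" using W b by (intro mult_left_mono) auto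
          finally show "norm (conv H (emp N t) ?x - conv H (mus t) ?x) \<le> b * (stability_const * (init_dist N + data_error N))" .
        qed (use elim(4) Ys_gap[OF N t] b in auto)
        finally have "norm (?v ?x - v ?x) \<le> b * (\<eta> N + mT * \<eta> N) + b * (stability_const * (init_dist N + data_error N))" by simp
        then have "norm (grad \<phi> ?x) * norm (?v ?x - v ?x) \<le> B * (b * (\<eta> N + mT * \<eta> N) + b * (stability_const * (init_dist N + data_error N)))"
          using B[of ?x] x B0 by (intro mult_mono) auto
        moreover have "\<bar>grad \<phi> ?x \<bullet> (?v ?x - v ?x)\<bar> \<le> norm (grad \<phi> ?x) * norm (?v ?x - v ?x)"
          by (rule Cauchy_Schwarz_ineq2)
        ultimately show "norm (grad \<phi> ?x \<bullet> ?v ?x - q ?x) \<le> B * (b * (\<eta> N + mT * \<eta> N) + b * (stability_const * (init_dist N + data_error N)))"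
          unfolding q_def real_norm_def inner_diff_right by linarith
      qed (use N in auto)
      moreover have "(1 / real (card {1..N})) *\<^sub>R (\<Sum>i=1..N. grad \<phi> (X N i t) \<bullet> ?v (X N i t) - q (X N i t))
          = ?gN N t - (\<integral>x. q x \<partial>emp N t)"
        by (simp add: integral_empirical[OF q_meas] sum_subtractf diff_divide_distrib)
      ultimately have "norm (?gN N t - (\<integral>x. q x \<partial>emp N t)) \<le> B * (b * (\<eta> N + mT * \<eta> N) + b * (stability_const * (init_dist N + data_error N)))"
        by (simp only:)
      then show ?case
        using second norm_triangle_ineq[of "?gN N t - (\<integral>x. q x \<partial>emp N t)" "(\<integral>x. q x \<partial>emp N t) - ?g t"]
        by simp
    qed
  qed
qed

theorem limit_is_solution: "limit_solution H G T us Ys mus"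
  unfolding limit_solution_def
proof (intro conjI allI impI)
  show "\<exists>R'>0. \<forall>t\<in>{0..T}. supp (mus t) \<subseteq> cball 0 R'"
    using \<rho> supp_subset_closed[OF mus_prob closed_cball] by blast
  show "(\<lambda>t. (Ys t, mus t)) \<in> C0_chi T" by (rule Ys_mus_in_C0_chi)
  show "caratheodory T (\<lambda>t. Ys t $ k) (\<lambda>t. us t $ k)" for k by (rule Ys_caratheodory)
  show "caratheodory T (\<lambda>t. \<integral>x. \<phi> x \<partial>mus t)
      (\<lambda>t. \<integral>x. grad \<phi> x \<bullet> velocity H G (us t) (Ys t) (mus t) x \<partial>mus t)" if "test_function \<phi>" for \<phi>
    using that unfolding test_function_def by (intro limit_weak_equation) blast
qed

end

section \<open>The mean-field limit\<close>

text \<open>The essential suprema are extended reals; cutting them off at a common bound makes them real.\<close>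

lemma Linf_convergence_rate:
  fixes v :: "nat \<Rightarrow> real \<Rightarrow> 'a::euclidean_space"
  assumes "0 \<le> M" and v: "\<And>n. 1 \<le> n \<Longrightarrow> AE t in S. norm (v n t) \<le> M"
    and lim: "(\<lambda>n. Linf_norm S (v n)) \<longlonglongrightarrow> 0"
  obtains e where "\<And>n. 0 \<le> e n" "e \<longlonglongrightarrow> 0" "\<And>n. 1 \<le> n \<Longrightarrow> AE t in S. norm (v n t) \<le> e n"
proof -
  define E where "E n = min (ereal M) (max 0 (Linf_norm S (v n)))" for n
  have E: "0 \<le> E n" "E n \<le> ereal M" for n using \<open>0 \<le> M\<close> by (auto simp: E_def)
  then have real_E: "ereal (real_of_ereal (E n)) = E n" for n
    by (intro ereal_real') (metis MInfty_neq_PInfty(1) abs_ereal_ge0 ereal_infty_less_eq(1) ereal_less_eq(1) PInfty_neq_ereal(1))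
  show thesis
  proof (rule that[of "\<lambda>n. real_of_ereal (E n)"])
    show "0 \<le> real_of_ereal (E n)" for n using E by (simp add: real_of_ereal_pos)
    have "E \<longlonglongrightarrow> min (ereal M) (max 0 0)"
      unfolding E_def by (intro tendsto_min tendsto_max tendsto_const lim)
    moreover have "min (ereal M) (max 0 0) = ereal 0"
      using \<open>0 \<le> M\<close> by (simp add: min_absorb2 zero_ereal_def[symmetric])
    ultimately have "E \<longlonglongrightarrow> ereal 0" by simp
    then show "(\<lambda>n. real_of_ereal (E n)) \<longlonglongrightarrow> 0" by (rule lim_real_of_ereal)
    show "AE t in S. norm (v n t) \<le> real_of_ereal (E n)" if "1 \<le> n" for n
      using v[OF that] esssup_AE[of "\<lambda>t. ereal (norm (v n t))" S]
    proof eventually_elim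
      case (elim t)
      then have "ereal (norm (v n t)) \<le> E n" by (auto simp: E_def Linf_norm_def le_max_iff_disj)
      then have "ereal (norm (v n t)) \<le> ereal (real_of_ereal (E n))" by (simp only: real_E)
      then show ?case by (simp only: ereal_less_eq)
    qed
  qed
qed

text \<open>It remains to choose the constants of the locale: first the bound \<open>M\<close> of the controls, which
  bounds the agents; then the confining radius \<open>\<rho>\<close>; and last the Lipschitz constant \<open>b\<close> on the
  balls that \<open>\<rho>\<close> determines.\<close>

theorem theorem3p3:
  fixes H :: "real^'d \<Rightarrow> real^'d"
    and G :: "'d \<Rightarrow> real^'d \<Rightarrow> real^'d"
    and T R :: real
    and U :: "(real^'d^'m) set"
    and Y0 :: "real^'d^'m"
    and \<mu>0 :: "(real^'d) measure"
    and X0 :: "nat \<Rightarrow> nat \<Rightarrow> real^'d"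
    and u :: "nat \<Rightarrow> real \<Rightarrow> real^'d^'m"
    and us :: "real \<Rightarrow> real^'d^'m"
    and Y :: "nat \<Rightarrow> real \<Rightarrow> real^'d^'m"
    and X :: "nat \<Rightarrow> nat \<Rightarrow> real \<Rightarrow> real^'d"
  assumes "T > 0"
    and "hypothesis_A TYPE('m) T H G"
    and "(Y0, \<mu>0) \<in> chi_space" and "supp \<mu>0 \<subseteq> cball 0 R"
    and "\<And>N. N \<ge> 1 \<Longrightarrow> supp (empirical N (X0 N)) \<subseteq> cball 0 R"
    and "(\<lambda>N. W1 (empirical N (X0 N)) \<mu>0) \<longlonglongrightarrow> 0"
    and "compact U" and "U \<noteq> {}"
    and "\<And>N. N \<ge> 1 \<Longrightarrow> u N \<in> Linf T U" and "us \<in> Linf T U"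
    and "(\<lambda>N. Linf_norm (lebesgue_on {0..T}) (\<lambda>t. u N t - us t)) \<longlonglongrightarrow> 0"
    and "\<And>N. N \<ge> 1 \<Longrightarrow> finite_solution H G T (u N) N (Y N) (X N)"
    and "\<And>N. N \<ge> 1 \<Longrightarrow> Y N 0 = Y0"
    and "\<And>N i. 1 \<le> i \<Longrightarrow> i \<le> N \<Longrightarrow> X N i 0 = X0 N i"
  shows "\<exists>Ys \<mu>s.
    C0_chi_converges T (\<lambda>N t. (Y N t, empirical N (\<lambda>i. X N i t))) (\<lambda>t. (Ys t, \<mu>s t)) \<and>
    limit_solution H G T us Ys \<mu>s \<and> Ys 0 = Y0 \<and> \<mu>s 0 = \<mu>0"
proof -
  have locH: "locally_lipschitz H" and growH: "sublinear_growth H"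
    and locG: "\<And>l. locally_lipschitz (G l)" and growG: "\<And>l. sublinear_growth (G l)"
    using assms(2) unfolding hypothesis_A_def by auto
  note T = assms(1)
  obtain M where M: "\<And>v. v \<in> U \<Longrightarrow> norm v \<le> M"
    using compact_imp_bounded[OF assms(7)] by (auto simp: bounded_iff)
  then have M0: "0 \<le> M" using assms(8) by (metis equals0I norm_ge_zero order_trans)
  have u_bound: "AE t in lebesgue_on {0..T}. norm (u N t) \<le> M" if "1 \<le> N" for N
  proof -
    have "AE t in lebesgue_on {0..T}. u N t \<in> U" using assms(9)[OF that] by (simp add: Linf_def)
    then show ?thesis by eventually_elim (rule M)
  qed
  have us_bound: "AE t in lebesgue_on {0..T}. norm (us t) \<le> M"
  proof -
    have "AE t in lebesgue_on {0..T}. us t \<in> U" using assms(10) by (simp add: Linf_def)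
    then show ?thesis by eventually_elim (rule M)
  qed
  have gap_bound: "AE t in lebesgue_on {0..T}. norm (u N t - us t) \<le> 2 * M" if "1 \<le> N" for N
    using u_bound[OF that] us_bound
  proof eventually_elim
    case (elim t)
    then show ?case using norm_triangle_ineq4[of "u N t" "us t"] by simp
  qed
  have M2: "0 \<le> 2 * M" using M0 by simp
  obtain \<eta> where \<eta>: "\<And>n. 0 \<le> \<eta> n" "\<eta> \<longlonglongrightarrow> 0"
    "\<And>n. 1 \<le> n \<Longrightarrow> AE t in lebesgue_on {0..T}. norm (u n t - us t) \<le> \<eta> n"
    by (rule Linf_convergence_rate[OF M2 gap_bound assms(11)]) blast+
  define r where "r = norm Y0 + M * T"
  have Y_ball: "norm (Y N t $ k) \<le> r" if N: "1 \<le> N" and t: "t \<in> {0..T}" for N t k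
  proof -
    have "AE t in lebesgue_on {0..T}. norm (u N t $ k) \<le> M"
      by (rule AE_norm_component_le[OF u_bound[OF N]])
    moreover have "caratheodory T (\<lambda>t. Y N t $ k) (\<lambda>t. u N t $ k)"
      using assms(12)[OF N] by (simp add: finite_solution_def)
    ultimately have "norm (Y N t $ k - Y N 0 $ k) \<le> M * \<bar>t - 0\<bar>"
      using caratheodory_lipschitz M0 t T by (metis atLeastAtMost_iff order_refl less_imp_le)
    also have "\<dots> \<le> M * T" using t M0 by (intro mult_left_mono) auto
    finally show ?thesis
      using norm_triangle_sub[of "Y N t $ k" "Y N 0 $ k"] norm_component_le[of Y0 k] assms(13)[OF N]
      by (simp add: r_def)
  qed
  obtain CH where CH: "\<And>\<xi>. norm (H \<xi>) \<le> CH * (1 + norm \<xi>)"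
    using growH by (auto simp: sublinear_growth_def)
  obtain CG where "CG \<ge> 0" and CG: "\<And>(v::real^'d^'m) y x. \<lbrakk>norm v \<le> M; \<And>k. norm (y $ k) \<le> r\<rbrakk> \<Longrightarrow>
       norm (control_field G v y x) \<le> CG * (1 + norm x)"
    by (rule control_field_growth[where G = G, OF growG, where M = M and \<rho> = r]) blast
  define C where "C = \<bar>CH\<bar> + CG + 1"
  have C: "0 < C" using \<open>CG \<ge> 0\<close> by (simp add: C_def)
  have X0_ball: "norm (X0 N i) \<le> \<bar>R\<bar>" if "1 \<le> i" "i \<le> N" for N i
    using assms(5)[of N] atom_in_supp_empirical[OF that, of "X0 N"] that by fastforce
  define \<rho> where "\<rho> = (4 * \<bar>R\<bar> + 2) * exp (4 * C * T) + r + \<bar>R\<bar>"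
  have r0: "0 \<le> r" using M0 T by (simp add: r_def)
  have \<rho>: "0 < \<rho>" "r \<le> \<rho>" "\<bar>R\<bar> \<le> \<rho>" "(4 * \<bar>R\<bar> + 2) * exp (4 * C * T) \<le> \<rho>"
  proof -
    have "0 < (4 * \<bar>R\<bar> + 2) * exp (4 * C * T)" by simp
    then show "0 < \<rho>" "r \<le> \<rho>" "\<bar>R\<bar> \<le> \<rho>" "(4 * \<bar>R\<bar> + 2) * exp (4 * C * T) \<le> \<rho>"
      using r0 unfolding \<rho>_def by linarith+
  qed
  have H_cont: "continuous_on UNIV H" by (rule locally_lipschitz_imp_continuous[OF locH])
  have X_ball: "norm (X N i t) \<le> \<rho>" if i: "1 \<le> i" "i \<le> N" and t: "t \<in> {0..T}" for N i t
  proof -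
    have N: "1 \<le> N" using i by simp
    have "norm (X N i t) \<le> (4 * \<bar>R\<bar> + 2) * exp (4 * C * t)"
    proof (rule particle_confinement[OF assms(12)[OF N] N H_cont _ _ C _ i t])
      show "norm (H \<xi>) \<le> C * (1 + norm \<xi>)" for \<xi>
      proof (rule order_trans[OF CH mult_right_mono])
        show "CH \<le> C" using \<open>CG \<ge> 0\<close> unfolding C_def by linarith
      qed simp
      have "AE t in lebesgue_on {0..T}. t \<in> {0..T}"
        using AE_space[of "lebesgue_on {0..T}"] by simp
      then show "AE t in lebesgue_on {0..T}. \<forall>x. norm (control_field G (u N t) (Y N t) x) \<le> C * (1 + norm x)"
        using u_bound[OF N]
      proof eventually_elim
        case (elim t)
        show ?case
        proof
          fix x
          have "norm (control_field G (u N t) (Y N t) x) \<le> CG * (1 + norm x)"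
            using elim Y_ball[OF N elim(1)] by (intro CG)
          also have "\<dots> \<le> C * (1 + norm x)"
            unfolding C_def by (intro mult_right_mono) auto
          finally show "norm (control_field G (u N t) (Y N t) x) \<le> C * (1 + norm x)" .
        qed
      qed
      show "norm (X N i 0) \<le> \<bar>R\<bar>" if "1 \<le> i" "i \<le> N" for i
        using X0_ball[OF that] assms(14)[OF that] by simp
    qed
    also have "\<dots> \<le> (4 * \<bar>R\<bar> + 2) * exp (4 * C * T)"
      using t C by (intro mult_left_mono) auto
    finally show ?thesis using \<rho>(4) by linarith
  qed
  obtain LH where LH: "LH-lipschitz_on (cball 0 (2 * \<rho>)) H"
    using locally_lipschitz_on_compact[OF locH compact_cball] by metis
  obtain bG where "bG \<ge> 0" and bG: "\<And>(v::real^'d^'m) v' y y' x x'.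
      \<lbrakk>norm v \<le> M; norm v' \<le> M; norm x \<le> \<rho>; norm x' \<le> \<rho>;
       \<And>k. norm (y $ k) \<le> \<rho>; \<And>k. norm (y' $ k) \<le> \<rho>\<rbrakk> \<Longrightarrow>
       norm (control_field G v y x - control_field G v' y' x')
         \<le> bG * (norm (v - v') + norm (x - x') + norm (y - y'))"
    by (rule control_field_lipschitz[where G = G, OF locG, where M = M and \<rho> = \<rho>]) blast
  define b where "b = LH + bG + 1"
  have LH0: "0 \<le> LH" using LH by (rule lipschitz_on_nonneg)
  interpret confined_systems H G T \<rho> M b \<mu>0 X0 Y0 u us Y X \<eta>
  proof
    show "0 < b" using LH0 \<open>bG \<ge> 0\<close> by (simp add: b_def)
    show "b-lipschitz_on (cball 0 (2 * \<rho>)) H"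
      by (rule lipschitz_on_le[OF LH]) (use \<open>bG \<ge> 0\<close> in \<open>simp add: b_def\<close>)
    show "norm (control_field G v y x - control_field G v' y' x')
         \<le> b * (norm (v - v') + norm (x - x') + norm (y - y'))"
      if "norm v \<le> M" "norm v' \<le> M" "norm x \<le> \<rho>" "norm x' \<le> \<rho>"
        "\<And>k. norm (y $ k) \<le> \<rho>" "\<And>k. norm (y' $ k) \<le> \<rho>" for v v' y y' :: "real^'d^'m" and x x'
      by (rule order_trans[OF bG[OF that] mult_right_mono]) (use LH0 in \<open>auto simp: b_def\<close>)
    show "\<mu>0 \<in> prob_on (cball 0 \<rho>)"
      using assms(3,4) \<rho>(3) by (intro prob_on_supp) (auto simp: chi_space_def)
    show "norm (Y N t $ k) \<le> \<rho>" if "1 \<le> N" "t \<in> {0..T}" for N t k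
      using Y_ball[OF that, of k] \<rho>(2) by linarith
    show "continuous_on UNIV (G l)" for l by (rule locally_lipschitz_imp_continuous[OF locG])
  qed (fact T \<rho>(1) M0 H_cont X_ball u_bound us_bound \<eta> assms)+
  show ?thesis
    by (intro exI[of _ Ys] exI[of _ mus] conjI converges_to_limit limit_is_solution Ys_init mus_init)
qed

end
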